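(* Let $f(x)\in\mathbb Z[x]$ have degree greater than $1$, and let $f^0(x)=x$, $f^m(x)=f(f^{m-1}(x))$. Then $\sum_{n=0}^\infty\frac1{f^n(x)}\in\mathbb Q((x^{-1}))$ has a specializable continued fraction if and only if $f(x)$ satisfies one of the following congruences in $\mathbb Z[x]$: (1) $f\equiv0\pmod{x^2}$; (2) $f\equiv-x\pmod{x^2}$; (3) $f\equiv1\pmod{x^2(x-1)}$; (4) $f\equiv-1\pmod{x^2(x+1)}$; (5) $f\equiv x^3-x^2-x+1\pmod{x^2(x-1)^2}$; (6) $f\equiv-x^3+2x^2-x+1\pmod{x^2(x-1)^2}$; (7) $f\equiv-x^3+3x^2-2x+1\pmod{x^2(x-1)^2}$; (8) $f\equiv x^3+x^2-x-1\pmod{x^2(x+1)^2}$; (9) $f\equiv-x^3-2x^2-x-1\pmod{x^2(x+1)^2}$; (10) $f\equiv-x^3-3x^2-2x-1\pmod{x^2(x+1)^2}$; (11) $f\equiv x^2-x+1\pmod{x^2(x-1)^2}$; (12) $f\equiv x^2-2x+1\pmod{x^2(x-1)^2}$; (13) $f\equiv-x^2-x-1\pmod{x^2(x+1)^2}$; (14) $f\equiv-x^2-2x-1\pmod{x^2(x+1)^2}$.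
   Context: $\mathbb Q((x^{-1}))$ is the field of formal Laurent series in $x^{-1}$ (the series converges there). An element of $\mathbb Q((x^{-1}))$ is said to have a specializable continued fraction if it can be written as a (finite, or infinite and convergent in $\mathbb Q((x^{-1}))$) continued fraction $[b_0,b_1,b_2,\dots]=b_0+\cfrac{1}{b_1+\cfrac{1}{b_2+\cdots}}$ all of whose partial quotients $b_i$ lie in $\mathbb Z[x]$. *)

theory Defs
  imports Complex_Main "HOL-Computational_Algebra.Computational_Algebra"
begin

abbreviation pX :: "int poly" where
  "pX \<equiv> [:0, 1:]"

abbreviation poly_congruent :: "int poly \<Rightarrow> int poly \<Rightarrow> int poly \<Rightarrow> bool" where
  "poly_congruent f g m \<equiv> m dvd f - g"

definition poly_iterate :: "int poly \<Rightarrow> nat \<Rightarrow> int poly" where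
  "poly_iterate f n = ((\<lambda>g. pcompose f g) ^^ n) pX"

(* The field of formal Laurent series in 1/x over the rationals is the type rat fls, whose
   variable fls_X plays the role of 1/x; the indeterminate x is therefore fls_X_inv. The metric
   on fls is the one in which two series are close iff they agree up to a high power of 1/x. *)
definition laurent_of_poly :: "int poly \<Rightarrow> rat fls" where
  "laurent_of_poly p = poly (map_poly of_int p) fls_X_inv"

(* b0 + 1/(b1 + 1/(b2 + ...)), evaluated from the inside. None stands for the point at infinity,
   with 1/0 = infinity, 1/infinity = 0 and b + infinity = infinity. This is needed because partial
   quotients may be arbitrary elements, 0 included, and HOL's convention 1/0 = 0 would give
   wrong values. The empty list is infinity, so that the value of [b] is b. *)
fun cf_value :: "'a::field list \<Rightarrow> 'a option" where
  "cf_value [] = None"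
| "cf_value (b # bs) =
     (case cf_value bs of
        None \<Rightarrow> Some b
      | Some v \<Rightarrow> if v = 0 then None else Some (b + 1 / v))"

definition cf_converges_to :: "(nat \<Rightarrow> rat fls) \<Rightarrow> rat fls \<Rightarrow> bool" where
  "cf_converges_to b s \<longleftrightarrow>
     (\<forall>\<^sub>F n in sequentially. cf_value (map b [0..<n]) \<noteq> None) \<and>
     (\<lambda>n. the (cf_value (map b [0..<n]))) \<longlonglongrightarrow> s"

(* Constant partial quotients are allowed: with f = 2 x^2 - x the expansion of the sum begins
   [0, x, -2, ...], whereas its unique expansion over the rationals with nonconstant
   partial quotients begins [0, x - 1/2, ...]. *)
definition has_specializable_cf :: "rat fls \<Rightarrow> bool" where
  "has_specializable_cf s \<longleftrightarrow>
     (\<exists>bs :: int poly list. cf_value (map laurent_of_poly bs) = Some s) \<or>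
     (\<exists>b :: nat \<Rightarrow> int poly. cf_converges_to (\<lambda>n. laurent_of_poly (b n)) s)"

end

theory Submission
  imports Defs
begin

unbundle fps_syntax

text \<open>Order the ring of integral polynomials by making x infinitely large. No polynomial lies strictly between 0 and 1, so
  every finite continued fraction over this ring can be rewritten as a regular one, with partial quotients at least 1
  after the first. Hence a specializable fraction whose degree is positive has an integral leading coefficient, and this
  obstruction is applied to complete quotients. A Laurent series is specializable iff it is a limit of finite continued
  fractions: all its good rational approximations are then specializable themselves, and conversely the expansion is
  obtained by repeatedly taking floors.

  The partial sum P/Q of the series, with P J = 1 modulo Q, extends to the specializable P/Q + 1/F iff
  F/Q^2 + J/Q is specializable. For the congruences in the theorem the latter fraction, computed modulo polynomials with
  the help of explicit inverses J, is a folded continued fraction or can be traced back to earlier partial sums; for all other f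
  a complete quotient with non-integral leading coefficient appears after at most four terms if the degree is at least 3.
  In degree 2 the partial sums need not be convergents, so that complete quotients of the series itself are used, which
  leaves seven exceptional polynomials (up to the symmetry x to -x) to be refuted by explicit convergents.\<close>

section \<open>Laurent series in 1/x\<close>

text \<open>Z[x] is not Euclidean, and constant partial quotients destroy uniqueness of expansions.
  The finite values are therefore handled as the orbit of infinity under elementary matrices, on
  which only an order and the degree are used. Constants also escape the integrality obstruction,
  since 1/2 = [0, 2]; so a quotient of positive degree must always be exhibited. The criterion with
  J comes from the matrix with rows (P, P') and (Q, J): it sends - (eta/Q^2 + J/Q) to P/Q + 1/eta.
  With d the degree of f, the sum of n terms has a denominator of degree (d^n - 1)/(d - 1), and the
  tail has degree - d^n. Legendre's criterion asks for twice the former to be below d^n, which for n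
  > 0 means d >= 3. For f = c x^2 + (B - 1) x + A with A > 0, leading coefficients leave (A, c) =
  (1, 1), (1, 2), (2, 1) and B = -1, 0, 1. Of these nine polynomials x^2 - x + 1 and x^2 - 2 x + 1
  satisfy (11) and (12); the other seven are the exceptional ones.\<close>

abbreviation L :: "int poly \<Rightarrow> rat fls" where "L \<equiv> laurent_of_poly"

lemma L_pCons: "L (pCons a p) = of_int a + fls_X_inv * L p"
  by (simp add: laurent_of_poly_def map_poly_pCons)

lemma L_nth: "L p $$ k = (if k \<le> 0 then of_int (coeff p (nat (- k))) else 0)"
proof (induction p arbitrary: k)
  case 0
  then show ?case by (simp add: laurent_of_poly_def)
next
  case (pCons a p)
  have "nat (- k) = Suc (nat (- (k + 1)))" if "k < 0" using that by simp
  then show ?case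
    using pCons by (auto simp: L_pCons fls_X_inv_times_conv_shift fls_of_int_nth coeff_pCons split: nat.splits)
qed

lemma L_add [simp]: "L (p + q) = L p + L q"
  and L_minus [simp]: "L (- p) = - L p"
  and L_diff [simp]: "L (p - q) = L p - L q"
  and L_0 [simp]: "L 0 = 0"
  by (auto simp: fls_eq_iff L_nth)

lemma L_smult: "L (smult a p) = of_int a * L p"
  by (induction p) (simp_all add: L_pCons algebra_simps)

lemma L_mult [simp]: "L (p * q) = L p * L q"
  by (induction p) (simp_all add: L_pCons L_smult algebra_simps)

lemma L_of_int [simp]: "L [:n:] = of_int n" and L_1 [simp]: "L 1 = 1"
  by (simp_all add: L_pCons one_pCons)

lemma L_numeral [simp]: "L (numeral n) = numeral n"
  by (simp add: numeral_poly)

lemma L_power [simp]: "L (p ^ n) = L p ^ n"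
  by (induction n) simp_all

lemma L_eq_0_iff [simp]: "L p = 0 \<longleftrightarrow> p = 0"
proof
  assume "L p = 0"
  then have "L p $$ (- int n) = 0" for n by simp
  then show "p = 0" by (simp add: L_nth poly_eq_iff)
qed simp

lemma L_eq_iff [simp]: "L p = L q \<longleftrightarrow> p = q"
  using L_eq_0_iff [of "p - q"] by (simp del: L_eq_0_iff)

lemma L_subdegree [simp]: "fls_subdegree (L p) = - int (degree p)"
proof (cases "p = 0")
  case False
  then show ?thesis
    by (intro fls_subdegree_eqI) (auto simp: L_nth coeff_eq_0)
qed simp

text \<open>Subdegrees count powers of 1/x, so this is the coefficient at the highest power of x. It
  is multiplicative and vanishes only at 0.\<close>

definition fls_lc :: "rat fls \<Rightarrow> rat" where
  "fls_lc s = s $$ fls_subdegree s"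

lemma fls_lc_L [simp]: "fls_lc (L p) = of_int (lead_coeff p)"
  by (simp add: fls_lc_def L_nth)

lemma fls_lc_0 [simp]: "fls_lc 0 = 0"
  by (simp add: fls_lc_def)

lemma fls_lc_eq_0_iff [simp]: "fls_lc s = 0 \<longleftrightarrow> s = 0"
  by (simp add: fls_lc_def nth_fls_subdegree_zero_iff)

lemma fls_lc_mult [simp]: "fls_lc (s * t) = fls_lc s * fls_lc t"
  by (cases "s = 0 \<or> t = 0") (auto simp: fls_lc_def fls_times_base)

lemma fls_lc_minus [simp]: "fls_lc (- s) = - fls_lc s"
  by (simp add: fls_lc_def)

lemma fls_lc_1 [simp]: "fls_lc 1 = 1"
  by (simp add: fls_lc_def)

lemma fls_lc_inverse [simp]: "fls_lc (inverse s) = inverse (fls_lc s)"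
proof (cases "s = 0")
  case False
  then have "fls_lc s * fls_lc (inverse s) = 1" by (simp flip: fls_lc_mult)
  then show ?thesis by (simp add: inverse_unique)
qed simp

lemma fls_lc_divide [simp]: "fls_lc (s / t) = fls_lc s / fls_lc t"
  by (simp add: divide_inverse)

lemma fls_subdegree_divide [simp]:
  "s \<noteq> 0 \<Longrightarrow> t \<noteq> 0 \<Longrightarrow> fls_subdegree (s / t) = fls_subdegree s - fls_subdegree t" for s t :: "rat fls"
  by (simp add: divide_inverse)

text \<open>The exponents of \<open>rat fls\<close> are those of 1/x, so \<open>tiny K s\<close> means that the degree of \<open>s\<close> in x is less than \<open>- K\<close>.\<close>

definition tiny :: "int \<Rightarrow> rat fls \<Rightarrow> bool" where
  "tiny K s \<longleftrightarrow> (\<forall>k\<le>K. s $$ k = 0)"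

lemma tiny_iff: "tiny K s \<longleftrightarrow> s = 0 \<or> K < fls_subdegree s"
proof
  assume *: "tiny K s"
  show "s = 0 \<or> K < fls_subdegree s"
    using * nth_fls_subdegree_zero_iff[of s] by (force simp: tiny_def not_less)
qed (auto simp: tiny_def)

lemma tiny_0 [simp]: "tiny K 0"
  and tiny_minus [simp]: "tiny K (- s) \<longleftrightarrow> tiny K s"
  and tiny_add: "tiny K s \<Longrightarrow> tiny K t \<Longrightarrow> tiny K (s + t)"
  and tiny_diff: "tiny K s \<Longrightarrow> tiny K t \<Longrightarrow> tiny K (s - t)"
  and tiny_mono: "tiny K s \<Longrightarrow> K' \<le> K \<Longrightarrow> tiny K' s"
  by (auto simp: tiny_def)

lemma tiny_commute: "tiny K (s - t) \<longleftrightarrow> tiny K (t - s)"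
  using tiny_minus [of K "s - t"] by (simp del: tiny_minus)

lemma tiny_mult: "tiny K s \<Longrightarrow> M \<le> fls_subdegree t \<Longrightarrow> tiny (K + M) (s * t)"
  by (cases "s = 0 \<or> t = 0") (auto simp: tiny_iff)

text \<open>An error beyond the leading exponent of \<open>s\<close> leaves the whole leading term
  intact. Degrees and leading coefficients of limits are read off approximations in this
  way.\<close>

lemma tiny_subdegree_eq:
  assumes "s \<noteq> 0" "tiny (fls_subdegree s) (t - s)"
  shows "t \<noteq> 0" "fls_subdegree t = fls_subdegree s" "fls_lc t = fls_lc s"
proof -
  have *: "t $$ k = s $$ k" if "k \<le> fls_subdegree s" for k
    using assms that by (simp add: tiny_def)
  then show "t \<noteq> 0" using assms(1) nth_fls_subdegree_nonzero[of s] by force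
  show sd: "fls_subdegree t = fls_subdegree s"
    by (rule fls_subdegree_eqI) (use * assms(1) in auto)
  show "fls_lc t = fls_lc s" using * sd by (simp add: fls_lc_def)
qed

text \<open>The positive cone of the order on Laurent series that extends the one on
  \<open>int poly\<close>. Being decided by the leading term, it survives small perturbations
  (\<open>fls_pos_tiny\<close>).\<close>

definition fls_pos :: "rat fls \<Rightarrow> bool" where
  "fls_pos s \<longleftrightarrow> 0 < fls_lc s"

lemma not_fls_pos_0 [simp]: "\<not> fls_pos 0" and fls_pos_1 [simp]: "fls_pos 1"
  by (simp_all add: fls_pos_def)

lemma fls_pos_nonzero: "fls_pos s \<Longrightarrow> s \<noteq> 0"
  by auto

lemma fls_pos_mult: "fls_pos s \<Longrightarrow> fls_pos t \<Longrightarrow> fls_pos (s * t)"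
  and fls_pos_inverse: "fls_pos s \<Longrightarrow> fls_pos (inverse s)"
  and fls_pos_divide: "fls_pos s \<Longrightarrow> fls_pos t \<Longrightarrow> fls_pos (s / t)"
  by (simp_all add: fls_pos_def)

lemma fls_pos_total: "s = 0 \<or> fls_pos s \<or> fls_pos (- s)"
  by (metis fls_lc_eq_0_iff fls_lc_minus fls_pos_def linorder_neqE_linordered_idom neg_0_less_iff_less)

lemma fls_pos_L [simp]: "fls_pos (L p) \<longleftrightarrow> 0 < p"
  by (simp add: fls_pos_def less_poly_def pos_poly_def)

lemma fls_pos_tiny:
  assumes "fls_pos s" "tiny (fls_subdegree s) (t - s)"
  shows "fls_pos t"
  using assms tiny_subdegree_eq fls_pos_nonzero by (metis fls_pos_def)

text \<open>Positive leading coefficients cannot cancel, so the subdegree of a sum is exactly the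
  minimum. This controls degrees even where partial quotients are constants.\<close>

lemma fls_pos_add_aux:
  assumes "fls_pos s" "fls_pos t" "fls_subdegree s \<le> fls_subdegree t"
  shows "fls_pos (s + t) \<and> fls_subdegree (s + t) = fls_subdegree s"
proof -
  let ?k = "fls_subdegree s"
  have "0 < s $$ ?k" using assms by (simp add: fls_pos_def fls_lc_def)
  moreover have "0 \<le> t $$ ?k"
    using assms by (cases "?k = fls_subdegree t") (auto simp: fls_pos_def fls_lc_def)
  ultimately have nn: "0 < s $$ ?k" "0 \<le> t $$ ?k" by auto
  then have "fls_subdegree (s + t) = ?k"
    using assms(3) by (intro fls_subdegree_eqI) auto
  with nn show ?thesis by (simp add: fls_pos_def fls_lc_def)
qed

lemma fls_pos_add:
  assumes "fls_pos s" "fls_pos t" shows "fls_pos (s + t)"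
    and "fls_subdegree (s + t) = min (fls_subdegree s) (fls_subdegree t)"
  using fls_pos_add_aux[OF assms] fls_pos_add_aux[OF assms(2,1)] linear[of "fls_subdegree s" "fls_subdegree t"]
  by (auto simp: add.commute min_def)

section \<open>Finite continued fractions over the integral polynomials\<close>

text \<open>The orbit of the vectors \<open>(t, 0)\<close> under the group generated by elementary matrices: \<open>reducible p q\<close>
  holds iff the (possibly infinite) value \<open>p / q\<close> is a finite continued fraction over \<open>int poly\<close>.\<close>

inductive reducible :: "int poly \<Rightarrow> int poly \<Rightarrow> bool" where
  base: "reducible t 0"
| add: "reducible p q \<Longrightarrow> reducible (p + b * q) q"
| swap: "reducible p q \<Longrightarrow> reducible q p"
| neg: "reducible p q \<Longrightarrow> reducible (- p) q"

lemma reducible_swap_iff: "reducible p q \<longleftrightarrow> reducible q p"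
  by (auto intro: reducible.swap)

lemma reducible_neg_iff [simp]: "reducible (- p) q \<longleftrightarrow> reducible p q"
  using reducible.neg by fastforce

lemma reducible_neg_right_iff [simp]: "reducible p (- q) \<longleftrightarrow> reducible p q"
  by (metis reducible_neg_iff reducible_swap_iff)

lemma reducible_add_iff: "reducible (p + b * q) q \<longleftrightarrow> reducible p q"
  using reducible.add[of p q b] reducible.add[of "p + b * q" q "- b"] by auto

lemma reducible_step: "reducible p q \<Longrightarrow> p = b * q + r \<Longrightarrow> reducible q r"
  by (metis add.commute reducible_add_iff reducible_swap_iff)

text \<open>The moves are linear and commute with multiplication by \<open>c\<close>, and the
  starting vectors \<open>(t, 0)\<close> have arbitrary \<open>t\<close>. Hence only the fraction
  matters, not common factors.\<close>

lemma reducible_cancel: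
  assumes "c \<noteq> 0" shows "reducible (c * p) (c * q) \<longleftrightarrow> reducible p q"
proof
  have "P = c * p \<Longrightarrow> Q = c * q \<Longrightarrow> reducible p q" if "reducible P Q" for P Q p q
    using that
  proof (induction arbitrary: p q rule: reducible.induct)
    case (base t)
    then show ?case using assms by (simp add: reducible.base)
  next
    case (add P Q b)
    from add.prems have "P = c * (p - b * q)" by (simp add: algebra_simps)
    from add.IH[OF this] add.prems(2) show ?case
      using reducible_add_iff[of "p - b * q" b q] by simp
  next
    case (swap P Q)
    then show ?case using reducible.swap by blast
  next
    case (neg P Q)
    from neg.prems have "P = c * (- p)" by (metis minus_equation_iff mult_minus_right)
    from neg.IH[OF this neg.prems(2)] show ?case by simp
  qed
  then show "reducible (c * p) (c * q) \<Longrightarrow> reducible p q" by blast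
next
  assume "reducible p q"
  then show "reducible (c * p) (c * q)"
  proof (induction rule: reducible.induct)
    case (base t)
    then show ?case by (simp add: reducible.base)
  next
    case (add p q b)
    then show ?case using reducible_add_iff[of "c * p" b "c * q"] by (simp add: algebra_simps)
  qed (auto intro: reducible.swap)
qed

text \<open>A unimodular matrix whose first column is reducible lies in the group generated by elementary matrices.\<close>

lemma reducible_transport:
  assumes "reducible P Q" "P * J - P' * Q = 1"
  shows "reducible (P * u + P' * v) (Q * u + J * v) \<longleftrightarrow> reducible u v"
proof -
  \<comment> \<open>Swaps and sign changes flip the determinant, so the induction runs over all
    second columns that complete the first to a matrix of unit determinant.\<close>
  have "is_unit (P * J - P' * Q) \<Longrightarrow> reducible (P * u + P' * v) (Q * u + J * v) \<longleftrightarrow> reducible u v"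
    for P' J using assms(1)
  proof (induction arbitrary: P' J rule: reducible.induct)
    \<comment> \<open>The matrix is upper triangular, and its diagonal entries are 1 or -1, the only
      units of Z[x]; the remaining entry is one elementary move.\<close>
    case (base t)
    have unit: "a = 1 \<or> a = -1" if "is_unit a" for a :: "int poly"
    proof -
      from that obtain c where "a = [:c:]" "is_unit c" by (auto simp: is_unit_poly_iff)
      then show ?thesis by (metis one_pCons minus_pCons minus_zero zdvd1_eq abs_eq_iff' abs_1 abs_of_nonneg  linorder_linear neg_equal_zero)
    qed
    from base have "is_unit t" "is_unit J" by (auto simp: is_unit_mult_iff)
    then have "t = 1 \<or> t = -1" "J = 1 \<or> J = -1" by (simp_all add: unit)
    moreover have "reducible (t * u + P' * v) v \<longleftrightarrow> reducible (t * u) v" by (rule reducible_add_iff)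
    ultimately show ?case by auto
  next
    case (add P Q b)
    have eq: "(P + b * Q) * J - P' * Q = P * J - (P' - b * J) * Q" by (simp add: algebra_simps)
    have "reducible (P * u + (P' - b * J) * v) (Q * u + J * v) \<longleftrightarrow> reducible u v"
      using add.prems unfolding eq by (rule add.IH)
    moreover have "(P + b * Q) * u + P' * v = P * u + (P' - b * J) * v + b * (Q * u + J * v)"
      by (simp add: algebra_simps)
    ultimately show ?case by (simp add: reducible_add_iff)
  next
    case (swap P Q)
    have "P * P' - J * Q = - (Q * J - P' * P)" by (simp add: algebra_simps)
    with swap.prems have "is_unit (P * P' - J * Q)" by (simp only: minus_dvd_iff)
    from swap.IH[OF this] show ?case by (simp add: reducible_swap_iff)
  next
    case (neg P Q)
    have "P * J - (- P') * Q = - (- P * J - P' * Q)" by (simp add: algebra_simps)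
    with neg.prems have "is_unit (P * J - (- P') * Q)" by (simp only: minus_dvd_iff)
    from neg.IH[OF this] have "reducible (- (- P * u + P' * v)) (Q * u + J * v) \<longleftrightarrow> reducible u v"
      by (simp add: algebra_simps)
    then show ?case by (simp only: reducible_neg_iff)
  qed
  then show ?thesis using assms(2) by simp
qed

section \<open>Regular continued fractions for the discrete order\<close>

lemma degree_mono_pos:
  fixes p q :: "int poly"
  assumes "0 \<le> p" "p \<le> q" shows "degree p \<le> degree q"
proof (rule ccontr)
  assume *: "\<not> degree p \<le> degree q"
  then have "lead_coeff (q - p) = - lead_coeff p" "p \<noteq> 0"
    by (auto simp: degree_add_eq_right[of q "- p", simplified] coeff_eq_0)
  moreover have "0 < lead_coeff p" using assms(1) \<open>p \<noteq> 0\<close> by (auto simp: less_eq_poly_def pos_poly_def)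
  moreover have "q = p \<or> 0 < lead_coeff (q - p)" using assms(2) by (auto simp: less_eq_poly_def pos_poly_def)
  ultimately show False using * by auto
qed

text \<open>Regular continued fractions, with partial quotients \<open>\<ge> 1\<close> after the first one, for the order on
  \<open>int poly\<close> that makes x infinitely large.\<close>

inductive regular_cf :: "int poly \<Rightarrow> int poly \<Rightarrow> bool" where
  base: "0 < t \<Longrightarrow> regular_cf (c * t) t"
| step: "regular_cf p q \<Longrightarrow> 0 < q \<Longrightarrow> q < p \<Longrightarrow> regular_cf (c * p + q) p"

lemma regular_cf_add: "regular_cf p q \<Longrightarrow> regular_cf (p + b * q) q"
proof (induction rule: regular_cf.induct)
  case (base t c)
  then show ?case using regular_cf.base[of t "c + b"] by (simp add: algebra_simps)
next
  case (step p q c)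
  then show ?case using regular_cf.step[of p q "c + b"] by (simp add: algebra_simps)
qed

text \<open>Subtracting 1 from a nonconstant polynomial leaves its leading coefficient alone, and
  constants are integers.\<close>

lemma int_poly_discrete: "0 < (p :: int poly) \<Longrightarrow> 1 \<le> p"
proof -
  assume p: "0 < p"
  show "1 \<le> p"
  proof (cases "degree p = 0")
    case True
    then obtain a where "p = [:a:]" by (metis degree_eq_zeroE)
    then show ?thesis using p by (auto simp: less_poly_def less_eq_poly_def pos_poly_def one_pCons)
  next
    case False
    then have "lead_coeff (p - 1) = lead_coeff p"
      by (simp add: degree_add_eq_left[of "-1" p, simplified] coeff_eq_0)
    then show ?thesis using p by (simp add: less_poly_def less_eq_poly_def pos_poly_def)
  qed
qed

lemma regular_cf_cases:
  assumes "regular_cf p q"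
  obtains c where "p = c * q" "0 < q"
  | c r where "p = c * q + r" "0 < r" "r < q" "regular_cf q r"
  using assms by (cases rule: regular_cf.cases) auto

text \<open>A positive value is inverted by prepending a first quotient 0, or by deleting one that
  is already there. The first quotient of a positive value cannot be negative: by discreteness it
  would be at most -1, which outweighs the remainder.\<close>

lemma regular_cf_inverse_pos:
  assumes "regular_cf p q" "0 < p" shows "regular_cf q p"
  using assms(1)
proof (cases rule: regular_cf_cases)
  case (1 c)
  with assms(2) have "0 < c" by (simp add: zero_less_mult_iff)
  then have "1 \<le> c" by (rule int_poly_discrete)
  show ?thesis
  proof (cases "c = 1")
    case True
    then show ?thesis using 1 regular_cf.base[of q 1] by simp
  next
    case False
    with \<open>1 \<le> c\<close> have "1 < c" by simp
    then have "q < p" using 1 by simp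
    then show ?thesis using regular_cf.step[OF assms(1) 1(2), of 0] by simp
  qed
next
  case (2 c r)
  have "0 \<le> c"
  proof (rule ccontr)
    assume "\<not> 0 \<le> c"
    then have "1 \<le> - c" by (intro int_poly_discrete) simp
    then have "1 * q \<le> - c * q" using 2 by (intro mult_right_mono) auto
    with 2 assms(2) show False by simp
  qed
  show ?thesis
  proof (cases "c = 0")
    case True
    then show ?thesis using 2 by simp
  next
    case False
    with \<open>0 \<le> c\<close> have "1 \<le> c" by (intro int_poly_discrete) simp
    then have "1 * q \<le> c * q" using 2 by (intro mult_right_mono) auto
    with 2(1,2) have "q < p" by (metis add_strict_increasing2 mult_1 add.commute add_less_le_mono add_0 less_le_trans add_le_less_mono)
    then show ?thesis using regular_cf.step[OF assms(1), of 0] 2 by simp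
  qed
qed

text \<open>Write \<open>- (c + 1/t)\<close> as \<open>(- c - 1) + (1 - 1/t)\<close> and \<open>1 - 1/t\<close> as \<open>1/(1 + 1/(t - 1))\<close>.\<close>

lemma regular_cf_neg: "regular_cf p q \<Longrightarrow> regular_cf (- p) q"
proof (erule regular_cf_cases)
  fix c assume "p = c * q" "0 < q"
  then show ?thesis using regular_cf.base[of q "- c"] by simp
next
  fix c r assume *: "p = c * q + r" "0 < r" "r < q" "regular_cf q r"
  have "regular_cf (q - r) r" using regular_cf_add[OF *(4), of "- 1"] by simp
  then have "regular_cf r (q - r)" by (rule regular_cf_inverse_pos) (use *(3) in simp)
  then have "regular_cf q (q - r)" using regular_cf_add[of r "q - r" 1] by simp
  then have "regular_cf ((- c - 1) * q + (q - r)) q"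
    using * by (intro regular_cf.step) auto
  then show ?thesis using * by (simp add: algebra_simps)
qed

text \<open>Induction over the moves, each fraction being normalised to a positive denominator by
  changing both signs; nothing is claimed for denominator 0.\<close>

lemma reducible_imp_regular_cf: "reducible p q \<Longrightarrow> 0 < q \<Longrightarrow> regular_cf p q"
proof -
  have "(0 < q \<longrightarrow> regular_cf p q) \<and> (q < 0 \<longrightarrow> regular_cf (- p) (- q))" if "reducible p q"
    using that
  proof (induction rule: reducible.induct)
    case (add p q b)
    then show ?case using regular_cf_add[of p q b] regular_cf_add[of "- p" "- q" b] by auto
  next
    case (swap p q)
    then have q0: ?case if "q = 0"
      using that regular_cf.base[of p 0] regular_cf.base[of "- p" 0] by auto
    have "regular_cf q p" if "0 < p" "0 < q" using swap that regular_cf_inverse_pos by blast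
    moreover have "regular_cf (- q) (- p)" if "p < 0" "q < 0"
      using swap that regular_cf_inverse_pos[of "- p" "- q"] by simp
    moreover have "regular_cf q p" if "0 < p" "q < 0"
      using swap that regular_cf_inverse_pos[of "p" "- q"] regular_cf_neg[of "- p" "- q"] regular_cf_neg[of "- q" p] by simp
    moreover have "regular_cf (- q) (- p)" if "p < 0" "0 < q"
      using swap that regular_cf_inverse_pos[of "- p" "q"] regular_cf_neg[of "p" "q"] regular_cf_neg[of "q" "- p"] by simp
    ultimately show ?case using q0 by (metis linorder_neqE_linordered_idom)
  next
    case (neg p q)
    then show ?case using regular_cf_neg[of p q] regular_cf_neg[of "- p" "- q"] by auto
  qed simp
  then show "reducible p q \<Longrightarrow> 0 < q \<Longrightarrow> regular_cf p q" by blast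
qed

text \<open>Having a floor is already a restriction: x/2 has none, because every
  \<open>pX - 2 * c\<close> is nonconstant. For reducible fractions the first regular partial
  quotient is one.\<close>

lemma reducible_floor:
  assumes "reducible p q" "0 < q"
  obtains c where "0 \<le> p - c * q" "p - c * q < q"
  using reducible_imp_regular_cf[OF assms]
proof (cases rule: regular_cf_cases)
  case (1 c)
  then show ?thesis using that[of c] by simp
next
  case (2 c r)
  then show ?thesis using that[of c] by simp
qed

lemma lead_coeff_add_le: "degree r < degree p \<Longrightarrow> lead_coeff (p + r) = lead_coeff p"
  by (simp add: degree_add_eq_left coeff_eq_0)

text \<open>The remainder left by the floor lies between 0 and \<open>q\<close>, so its degree is at
  most that of \<open>q\<close>, hence below that of \<open>p\<close>. The leading term of
  \<open>p\<close> is therefore that of a multiple of \<open>q\<close>.\<close>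

lemma reducible_lead_coeff_dvd:
  assumes "reducible p q" "q \<noteq> 0" "degree q < degree p"
  shows "lead_coeff q dvd lead_coeff p"
proof -
  have *: "lead_coeff q dvd lead_coeff p"
    if pq: "reducible p q" "0 < q" "degree q < degree p" for p q
  proof -
    obtain c where c: "0 \<le> p - c * q" "p - c * q < q" using reducible_floor pq by blast
    then have "degree (p - c * q) \<le> degree q" by (intro degree_mono_pos) auto
    then have "degree (p - c * q) < degree p" using pq by simp
    then have "degree (- (p - c * q)) < degree p" by (simp only: degree_minus)
    then have "lead_coeff (p + - (p - c * q)) = lead_coeff p" by (rule lead_coeff_add_le)
    then have "lead_coeff (c * q) = lead_coeff p" by simp
    then show ?thesis by (metis dvd_triv_right lead_coeff_mult)
  qed
  show ?thesis
  proof (cases "0 < q")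
    case False
    then show ?thesis using *[of p "- q"] assms by simp
  qed (use * assms in blast)
qed

text \<open>Legendre's criterion without expansions: the degree condition says that a/c - p/q has
  degree below - 2 deg q. A move applied to both fractions changes \<open>a * q - p * c\<close> at
  most in sign. For the swap, closeness makes deg p - deg q equal the degree difference of the
  approximated fraction, so the condition carries over to the inverses.\<close>

lemma reducible_approximant:
  assumes "reducible a c" "c \<noteq> 0" "q \<noteq> 0"
    and "a * q = p * c \<or> degree (a * q - p * c) + degree q < degree c"
  shows "reducible p q"
  using assms
proof (induction arbitrary: p q rule: reducible.induct)
  case (add a c b)
  have eq: "(a + b * c) * q - p * c = a * q - (p - b * q) * c" by (simp add: algebra_simps)
  have "reducible (p - b * q) q"
    using add.prems by (intro add.IH) (auto simp: eq algebra_simps)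
  then show ?case using reducible_add_iff[of "p - b * q" b q] by simp
next
  case (swap a c)
  note a0 = swap.prems(1)
  show ?case
  proof (cases "p = 0")
    case True
    then show ?thesis using reducible.base reducible.swap by blast
  next
    case p: False
    show ?thesis
    proof (cases "c * q = p * a")
      case True
      then have "c \<noteq> 0" using p a0 by auto
      then have "reducible q p" using True p by (intro swap.IH) (auto simp: mult.commute)
      then show ?thesis by (rule reducible.swap)
    next
      case False
      then have D: "degree (c * q - p * a) + degree q < degree a" using swap.prems by simp
      have pa: "degree (p * a) = degree p + degree a" using p a0 by (simp add: degree_mult_eq)
      have "degree (c * q) = degree (p * a)"
        using degree_add_eq_right[of "c * q - p * a" "p * a"] D pa by simp
      then have c: "c \<noteq> 0" using pa D by auto
      then have "degree c + degree q = degree p + degree a"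
        using pa \<open>degree (c * q) = degree (p * a)\<close> swap.prems(2) by (simp add: degree_mult_eq)
      moreover have "degree (a * p - q * c) = degree (c * q - p * a)"
        by (metis degree_minus minus_diff_eq mult.commute)
      ultimately have "reducible q p" using D p c by (intro swap.IH) auto
      then show ?thesis by (rule reducible.swap)
    qed
  qed
next
  case (neg a c)
  have eq: "- a * q - p * c = - (a * q - (- p) * c)" by simp
  have "reducible (- p) q"
    using neg.prems degree_minus[of "a * q - (- p) * c"] unfolding eq
    by (intro neg.IH) (auto simp: algebra_simps minus_equation_iff equation_minus_iff)
  then show ?case by simp
qed simp

section \<open>Values of finite continued fractions among the Laurent series\<close>

definition finite_cf :: "rat fls \<Rightarrow> bool" where
  "finite_cf s \<longleftrightarrow> (\<exists>p q. q \<noteq> 0 \<and> reducible p q \<and> s = L p / L q)"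

lemma finite_cf_iff: "q \<noteq> 0 \<Longrightarrow> finite_cf (L p / L q) \<longleftrightarrow> reducible p q"
proof
  assume q: "q \<noteq> 0" and "finite_cf (L p / L q)"
  then obtain p' q' where *: "q' \<noteq> 0" "reducible p' q'" "L p / L q = L p' / L q'"
    by (auto simp: finite_cf_def)
  then have "L (p * q') = L (p' * q)" using q by (simp add: field_simps)
  then have eq: "p * q' = p' * q" by (simp only: L_eq_iff)
  have "reducible (q * p') (q * q')" using * q by (simp add: reducible_cancel)
  moreover have "q * p' = q' * p" "q * q' = q' * q" using eq by (simp_all add: mult.commute)
  ultimately show "reducible p q" using * by (simp add: reducible_cancel)
qed (auto simp: finite_cf_def)

lemma finite_cf_L [simp]: "finite_cf (L p)"
  using finite_cf_iff[of 1 p] reducible_add_iff[of 0 p 1] reducible.base[of 1] reducible.swap by auto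

lemma finite_cf_0 [simp]: "finite_cf 0" and finite_cf_1 [simp]: "finite_cf 1"
  using finite_cf_L[of 0] finite_cf_L[of 1] by (simp_all del: finite_cf_L)

lemma finite_cf_add_iff [simp]: "finite_cf (s + L b) \<longleftrightarrow> finite_cf s"
proof -
  have *: "finite_cf (s + L b)" if "finite_cf s" for s b
  proof -
    from that obtain p q where "q \<noteq> 0" "reducible p q" "s = L p / L q" by (auto simp: finite_cf_def)
    then have "reducible (p + b * q) q" "s + L b = L (p + b * q) / L q"
      by (simp_all add: reducible.add field_simps)
    with \<open>q \<noteq> 0\<close> show ?thesis unfolding finite_cf_def by blast
  qed
  from this[of s b] this[of "s + L b" "- b"] show ?thesis by auto
qed

lemma finite_cf_diff_iff [simp]: "finite_cf (s - L b) \<longleftrightarrow> finite_cf s"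
  using finite_cf_add_iff[of s "- b"] by (simp del: finite_cf_add_iff)

lemma finite_cf_minus_iff [simp]: "finite_cf (- s) \<longleftrightarrow> finite_cf s"
proof -
  have "finite_cf (- s)" if "finite_cf s" for s
  proof -
    from that obtain p q where "q \<noteq> 0" "reducible p q" "s = L p / L q" by (auto simp: finite_cf_def)
    then have "q \<noteq> 0" "reducible (- p) q" "- s = L (- p) / L q" by simp_all
    then show ?thesis unfolding finite_cf_def by blast
  qed
  from this[of s] this[of "- s"] show ?thesis by auto
qed

lemma finite_cf_inverse_iff [simp]: "finite_cf (inverse s) \<longleftrightarrow> finite_cf s"
proof -
  have "finite_cf (inverse s)" if fs: "finite_cf s" for s
  proof (cases "s = 0")
    case False
    from fs obtain p q where pq: "q \<noteq> 0" "reducible p q" "s = L p / L q" by (auto simp: finite_cf_def)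
    then have "p \<noteq> 0" "reducible q p" "inverse s = L q / L p" using False by (auto intro: reducible.swap)
    then show ?thesis by (auto simp: finite_cf_def)
  qed simp
  from this[of s] this[of "inverse s"] show ?thesis by auto
qed

lemma finite_cf_one_divide_iff [simp]: "finite_cf (1 / s) \<longleftrightarrow> finite_cf s"
  using finite_cf_inverse_iff[of s] by (simp add: divide_inverse)

text \<open>The Moebius transformation with matrix \<open>(P, P'; Q, J)\<close>, written without \<open>P'\<close>. For \<open>eta = 0\<close> both
  sides hold by the convention 1/0 = 0.\<close>

lemma finite_cf_transport:
  assumes Q: "Q \<noteq> 0" and red: "finite_cf (L P / L Q)" and dvd: "Q dvd P * J - 1"
  shows "finite_cf (L P / L Q + 1 / eta) \<longleftrightarrow> finite_cf (eta / L Q ^ 2 + L J / L Q)"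
    and "finite_cf (L J / L Q)"
proof -
  from dvd obtain P' where "P * J - 1 = Q * P'" by (elim dvdE)
  then have det: "P * J - P' * Q = 1" by (simp add: algebra_simps)
  then have LP': "L P * L J - L P' * L Q = 1" by (metis L_1 L_diff L_mult)
  have red': "reducible P Q" using red Q by (simp add: finite_cf_iff)
  note tr = reducible_transport[OF red' det]
  \<comment> \<open>The matrix sends \<open>(J, - Q)\<close> to (1, 0), a base vector.\<close>
  have "P * J + P' * (- Q) = 1" "Q * J + J * (- Q) = 0" using det by (simp_all add: algebra_simps)
  then have "reducible J (- Q)" using tr[of J "- Q"] reducible.base[of 1] by simp
  then have J: "reducible J Q" by simp
  then show JQ: "finite_cf (L J / L Q)" using Q by (simp add: finite_cf_iff)
  have fwd: "finite_cf (L P / L Q + 1 / eta)" if "finite_cf (eta / L Q ^ 2 + L J / L Q)"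
  proof (cases "eta = 0")
    case False
    from that obtain u w where uw: "w \<noteq> 0" "reducible u w" "eta / L Q ^ 2 + L J / L Q = L u / L w"
      by (auto simp: finite_cf_def)
    have eta: "eta = L Q * (L Q * L u - L J * L w) / L w"
      using uw Q by (simp add: field_simps power2_eq_square)
    then have nz: "L (Q * u - J * w) \<noteq> 0" using False Q uw by auto
    \<comment> \<open>At z = - u/w the matrix gives (P z + P') / (Q z + J) = P/Q - 1 / (Q^2 (z +
      J/Q)); hence the sign of \<open>w\<close>.\<close>
    have "reducible (P * u + P' * (- w)) (Q * u + J * (- w))" using tr[of u "- w"] uw by simp
    then have "finite_cf (L (P * u - P' * w) / L (Q * u - J * w))"
      using nz by (simp add: finite_cf_iff del: L_diff L_mult)
    moreover have "L (P * u - P' * w) / L (Q * u - J * w) = L P / L Q + 1 / eta"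
    proof -
      have "L P / L Q + 1 / eta = (L P * (L Q * L u - L J * L w) + L w) / (L Q * (L Q * L u - L J * L w))"
        using nz Q uw by (simp add: eta field_simps)
      also have "L P * (L Q * L u - L J * L w) + L w = L Q * (L P * L u - L P' * L w)"
        using LP' by algebra
      also have "L Q * (L P * L u - L P' * L w) / (L Q * (L Q * L u - L J * L w)) = L (P * u - P' * w) / L (Q * u - J * w)"
        using Q by simp
      finally show ?thesis by simp
    qed
    ultimately show ?thesis by simp
  qed (use red in simp)
  have bwd: "finite_cf (eta / L Q ^ 2 + L J / L Q)" if "finite_cf (L P / L Q + 1 / eta)"
  proof (cases "eta = 0")
    case False
    from that obtain u w where uw: "w \<noteq> 0" "reducible u w" "L P / L Q + 1 / eta = L u / L w"
      by (auto simp: finite_cf_def)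
    have "1 / eta = L u / L w - L P / L Q" using uw(3) by (simp add: algebra_simps)
    also have "\<dots> = (L u * L Q - L P * L w) / (L w * L Q)" using uw Q by (simp add: field_simps)
    finally have ie: "1 / eta = (L u * L Q - L P * L w) / (L w * L Q)" .
    then have nz: "L u * L Q - L P * L w \<noteq> 0" using False by auto
    have eta: "eta = L w * L Q / (L u * L Q - L P * L w)"
      using ie False nz by (simp add: field_simps)
    \<comment> \<open>The new vector is the inverse matrix applied to \<open>(u, w)\<close>.\<close>
    have e1: "P * (J * u - P' * w) + P' * (P * w - Q * u) = u" 
      and e2: "Q * (J * u - P' * w) + J * (P * w - Q * u) = w"
      using det by algebra+
    then have "reducible (J * u - P' * w) (P * w - Q * u)" 
      using tr[of "J * u - P' * w" "P * w - Q * u"] uw by simp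
    then have "reducible (J * u - P' * w) (Q * u - P * w)"
      by (metis minus_diff_eq reducible_neg_right_iff)
    moreover have "Q * u - P * w \<noteq> 0" using nz by (metis L_diff L_eq_0_iff L_mult mult.commute)
    ultimately have "finite_cf (L (J * u - P' * w) / L (Q * u - P * w))" by (simp add: finite_cf_iff del: L_diff L_mult)
    moreover have "L (J * u - P' * w) / L (Q * u - P * w) = eta / L Q ^ 2 + L J / L Q"
    proof -
      have "eta / L Q ^ 2 + L J / L Q = (L w + L J * (L u * L Q - L P * L w)) / (L Q * (L u * L Q - L P * L w))"
        using nz Q by (simp add: eta field_simps power2_eq_square)
      also have "L w + L J * (L u * L Q - L P * L w) = L Q * (L J * L u - L P' * L w)"
        using LP' by algebra
      also have "L Q * (L J * L u - L P' * L w) / (L Q * (L u * L Q - L P * L w)) = L (J * u - P' * w) / L (Q * u - P * w)"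
        using Q by (simp add: mult.commute)
      finally show ?thesis by simp
    qed
    ultimately show ?thesis by simp
  qed (use JQ in simp)
  show "finite_cf (L P / L Q + 1 / eta) \<longleftrightarrow> finite_cf (eta / L Q ^ 2 + L J / L Q)"
    using fwd bwd by blast
qed

text \<open>The approximations may come from unrelated expansions, which makes the closure
  properties immediate. A single expansion is recovered in
  \<open>cf_limit_irrational_expansion\<close>.\<close>

definition cf_limit :: "rat fls \<Rightarrow> bool" where
  "cf_limit s \<longleftrightarrow> (\<forall>K. \<exists>t. finite_cf t \<and> tiny K (s - t))"

lemma cf_limitI: "finite_cf s \<Longrightarrow> cf_limit s"
  unfolding cf_limit_def by (metis diff_self tiny_0)

lemma cf_limit_diff_L: "cf_limit s \<Longrightarrow> cf_limit (s - L b)"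
  unfolding cf_limit_def
  by (metis finite_cf_diff_iff diff_diff_eq2 diff_add_cancel add.commute add_diff_cancel_right)

lemma cf_limit_minus: "cf_limit s \<Longrightarrow> cf_limit (- s)"
  unfolding cf_limit_def by (metis finite_cf_minus_iff minus_diff_minus tiny_minus)

lemma cf_limit_inverse:
  assumes "cf_limit s" shows "cf_limit (inverse s)"
proof (cases "s = 0")
  case False
  show ?thesis unfolding cf_limit_def
  proof
    fix K
    define d where "d = fls_subdegree s"
    \<comment> \<open>Precision \<open>d\<close> forces \<open>t\<close> to share the leading term
      of \<open>s\<close>, so that it is nonzero; dividing the error by \<open>s * t\<close> costs
      another \<open>2 * d\<close>.\<close>
    obtain t where t: "finite_cf t" "tiny (max d (K + 2 * d)) (s - t)"
      using assms unfolding cf_limit_def by blast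
    then have "tiny (fls_subdegree s) (t - s)" "tiny (K + 2 * d) (t - s)"
      unfolding d_def by (auto simp: tiny_commute[of _ s] intro: tiny_mono)
    note sd = tiny_subdegree_eq[OF False this(1)]
    have "tiny (K + 2 * d + - (2 * d)) ((t - s) * inverse (s * t))"
      using \<open>tiny (K + 2 * d) (t - s)\<close> False sd by (intro tiny_mult) (simp_all add: d_def)
    moreover have "(t - s) * inverse (s * t) = inverse s - inverse t"
      using False sd by (simp add: field_simps)
    ultimately show "\<exists>t. finite_cf t \<and> tiny K (inverse s - t)" using t(1)
      by (metis add.right_neutral add.assoc add.right_inverse finite_cf_inverse_iff)
  qed
qed (simp add: cf_limitI)

lemma cf_limit_lc_Ints:
  assumes "cf_limit s" "fls_subdegree s < 0" shows "fls_lc s \<in> \<int>"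
proof -
  from assms(2) have s: "s \<noteq> 0" by auto
  obtain t where t: "finite_cf t" "tiny (fls_subdegree s) (s - t)"
    using assms(1) unfolding cf_limit_def by blast
  note sd = tiny_subdegree_eq[OF s, of t] 
  then have sd: "t \<noteq> 0" "fls_subdegree t = fls_subdegree s" "fls_lc t = fls_lc s"
    using t(2) tiny_commute by blast+
  obtain p q where pq: "q \<noteq> 0" "reducible p q" "t = L p / L q" using t(1) by (auto simp: finite_cf_def)
  with sd(1) have "p \<noteq> 0" by auto
  with pq sd(2) assms(2) have "degree q < degree p" by simp
  then have "lead_coeff q dvd lead_coeff p" using reducible_lead_coeff_dvd pq by blast
  then obtain k where "lead_coeff p = lead_coeff q * k" by (elim dvdE)
  then have "fls_lc t = of_int k" using pq by simp
  then show ?thesis using sd(3) by simp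
qed

text \<open>If a finite fraction \<open>t\<close> is as close to \<open>s\<close> as p/q is, then
  p/q is a good approximation of \<open>t\<close>, and \<open>reducible_approximant\<close> applies
  to it.\<close>

lemma cf_limit_approximant:
  assumes "cf_limit s" "q \<noteq> 0" "tiny (2 * int (degree q)) (s - L p / L q)"
  shows "finite_cf (L p / L q)"
proof -
  obtain t where t: "finite_cf t" "tiny (2 * int (degree q)) (s - t)"
    using assms(1) unfolding cf_limit_def by blast
  obtain a c where ac: "c \<noteq> 0" "reducible a c" "t = L a / L c" using t(1) by (auto simp: finite_cf_def)
  have "tiny (2 * int (degree q)) (t - L p / L q)"
    using tiny_diff[OF assms(3) t(2)] by simp
  moreover have eq: "t - L p / L q = L (a * q - p * c) / L (c * q)" using ac assms(2) by (simp add: field_simps)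
  moreover have "fls_subdegree (L u / L (c * q)) = int (degree (c * q)) - int (degree u)"
    if "u \<noteq> 0" for u :: "int poly"
    using that ac assms(2) by (subst fls_subdegree_divide) (simp_all del: L_mult)
  ultimately have "a * q - p * c = 0 \<or> 2 * int (degree q) < int (degree (c * q)) - int (degree (a * q - p * c))"
    unfolding eq using ac assms(2) by (cases "a * q - p * c = 0") (simp_all add: tiny_iff del: L_diff L_mult right_minus_eq)
  then have "a * q = p * c \<or> degree (a * q - p * c) + degree q < degree c"
    using ac assms(2) by (auto simp: degree_mult_eq)
  then have "reducible p q" using reducible_approximant ac assms(2) by blast
  then show ?thesis using assms(2) by (simp add: finite_cf_iff)
qed

section \<open>Limits of finite continued fractions\<close>

lemma cf_value_finite:
  "cf_value (map L bs) = Some s \<Longrightarrow> finite_cf s"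
proof (induction bs arbitrary: s)
  case (Cons b bs)
  show ?case
  proof (cases "cf_value (map L bs)")
    case None
    then have "s = L b" using Cons.prems by simp
    then show ?thesis by simp
  next
    case (Some v)
    then have "finite_cf v" "s = 1 / v + L b" using Cons by (auto split: if_splits)
    then show ?thesis by simp
  qed
qed simp

lemma cf_value_neg: "cf_value (map uminus bs) = map_option uminus (cf_value bs)"
  by (induction bs) (auto split: option.splits)

text \<open>Translation changes the first partial quotient, inversion prepends a 0, a change of sign
  negates all partial quotients, and infinity is the empty list.\<close>

lemma finite_cf_value:
  assumes "finite_cf s" shows "\<exists>bs. cf_value (map L bs) = Some s"
proof -
  \<comment> \<open>The pair (0, 0) is reducible but has no value; any other pair with denominator 0
    stands for infinity, encoded as \<open>None\<close>.\<close>
  have "\<exists>bs. cf_value (map L bs) = (if q = 0 then None else Some (L p / L q))" 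
    if "reducible p q" "p \<noteq> 0 \<or> q \<noteq> 0" for p q using that
  proof (induction rule: reducible.induct)
    case (base t)
    have "cf_value (map L []) = None" by simp
    then show ?case by metis
  next
    case (add p q b)
    show ?case
    proof (cases "q = 0")
      case False
      then obtain bs where bs: "cf_value (map L bs) = Some (L p / L q)" using add by auto
      then obtain c cs where cs: "bs = c # cs" by (cases bs) auto
      have "cf_value (map L ((c + b) # cs)) = Some (L p / L q + L b)"
        using bs unfolding cs by (auto split: option.splits if_splits)
      then show ?thesis using False by (intro exI[of _ "(c + b) # cs"]) (simp add: field_simps)
    qed (use add in simp)
  next
    case (swap p q)
    then obtain bs where bs: "cf_value (map L bs) = (if q = 0 then None else Some (L p / L q))" by auto
    have "cf_value (map L (0 # bs)) = (if p = 0 then None else Some (L q / L p))"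
      using bs swap.prems by auto
    then show ?case by blast
  next
    case (neg p q)
    then obtain bs where bs: "cf_value (map L bs) = (if q = 0 then None else Some (L p / L q))" by auto
    have "map L (map uminus bs) = map uminus (map L bs)" by simp
    then have "cf_value (map L (map uminus bs)) = (if q = 0 then None else Some (L (- p) / L q))"
      using bs by (simp only: cf_value_neg) simp
    then show ?case by blast
  qed
  then show ?thesis using assms unfolding finite_cf_def by (metis (full_types))
qed

lemma dist_fls_less: "dist s t < inverse (2 ^ n) \<Longrightarrow> tiny (int n) (s - t)" for s t :: "rat fls"
proof (cases "s = t")
  case False
  assume d: "dist s t < inverse (2 ^ n)"
  show ?thesis
  proof (cases "0 \<le> fls_subdegree (s - t)")
    case True
    then have "(2::real) ^ n < 2 ^ nat (fls_subdegree (s - t))"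
      using d False by (simp add: dist_fls_def)
    then have "n < nat (fls_subdegree (s - t))" by (simp add: power_strict_increasing_iff)
    then show ?thesis unfolding tiny_iff by linarith
  next
    case neg: False
    then have "(2::real) ^ nat (- fls_subdegree (s - t)) < inverse (2 ^ n)"
      using d False by (simp add: dist_fls_def)
    also have "\<dots> \<le> 1" by (simp add: inverse_le_1_iff)
    finally have "(2::real) ^ nat (- fls_subdegree (s - t)) < 1" .
    moreover have "(1::real) \<le> 2 ^ nat (- fls_subdegree (s - t))" by (rule one_le_power) simp
    ultimately show ?thesis by linarith
  qed
qed simp

lemma dist_fls_le: "tiny (int n) (s - t) \<Longrightarrow> dist s t \<le> inverse (2 ^ n)" for s t :: "rat fls"
  by (auto simp: dist_fls_def tiny_iff)

lemma tendsto_fls_iff: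
  "X \<longlonglongrightarrow> (s :: rat fls) \<longleftrightarrow> (\<forall>K. \<forall>\<^sub>F n in sequentially. tiny K (s - X n))"
proof
  assume X: "X \<longlonglongrightarrow> s"
  show "\<forall>K. \<forall>\<^sub>F n in sequentially. tiny K (s - X n)"
  proof
    fix K :: int
    have "\<forall>\<^sub>F n in sequentially. dist (X n) s < inverse (2 ^ nat K)"
      using X by (intro tendstoD) simp_all
    then show "\<forall>\<^sub>F n in sequentially. tiny K (s - X n)"
      by eventually_elim (metis dist_commute dist_fls_less tiny_mono nat_le_iff order_refl)
  qed
next
  assume *: "\<forall>K. \<forall>\<^sub>F n in sequentially. tiny K (s - X n)"
  show "X \<longlonglongrightarrow> s"
  proof (rule tendstoI)
    fix e :: real assume "0 < e"
    then obtain m where m: "inverse (2 ^ m) < e" 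
      using real_arch_pow_inv[of e "1/2"] by (auto simp: power_divide inverse_eq_divide)
    have "\<forall>\<^sub>F n in sequentially. tiny (int m) (s - X n)" using * by blast
    then show "\<forall>\<^sub>F n in sequentially. dist (X n) s < e"
      by eventually_elim (metis dist_commute dist_fls_le m order_le_less_trans)
  qed
qed

lemma has_specializable_cf_imp_cf_limit:
  assumes "has_specializable_cf s" shows "cf_limit s"
  using assms unfolding has_specializable_cf_def
proof (elim disjE exE)
  fix bs assume "cf_value (map L bs) = Some s"
  then show ?thesis using cf_value_finite cf_limitI by blast
next
  fix b assume "cf_converges_to (\<lambda>n. L (b n)) s"
  then have ev: "\<forall>\<^sub>F n in sequentially. cf_value (map (\<lambda>n. L (b n)) [0..<n]) \<noteq> None"
    and lim: "\<And>K. \<forall>\<^sub>F n in sequentially. tiny K (s - the (cf_value (map (\<lambda>n. L (b n)) [0..<n])))"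
    by (auto simp: cf_converges_to_def tendsto_fls_iff)
  show ?thesis unfolding cf_limit_def
  proof
    fix K
    from ev lim[of K] have "\<forall>\<^sub>F n in sequentially. \<exists>t. finite_cf t \<and> tiny K (s - t)"
    proof eventually_elim
      case (elim n)
      have "map (\<lambda>n. L (b n)) [0..<n] = map L (map b [0..<n])" by simp
      with elim show ?case using cf_value_finite by (metis option.collapse)
    qed
    then show "\<exists>t. finite_cf t \<and> tiny K (s - t)" by (auto dest: eventually_happens)
  qed
qed

text \<open>A finite \<open>t\<close> at infinitesimal distance from \<open>s\<close> has a floor
  \<open>c\<close>. If \<open>t\<close> is infinitely close to an end of its unit interval, the
  floor of \<open>s\<close> may instead be \<open>c - 1\<close> or \<open>c + 1\<close>.
  Irrationality keeps \<open>s\<close> off the polynomials, so all comparisons are strict.\<close>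

lemma cf_limit_floor:
  assumes "cf_limit s" and irr: "\<And>p q. q \<noteq> 0 \<Longrightarrow> s \<noteq> L p / L q"
  obtains c where "fls_pos (s - L c)" "fls_pos (1 - (s - L c))"
proof -
  obtain t where t: "finite_cf t" "tiny 0 (s - t)" using assms(1) unfolding cf_limit_def by blast
  then obtain p q where pq: "q \<noteq> 0" "reducible p q" "t = L p / L q" by (auto simp: finite_cf_def)
  obtain p q where pq: "0 < q" "reducible p q" "t = L p / L q"
  proof (cases "0 < q")
    case False
    then show ?thesis using that[of "- q" "- p"] pq by simp
  qed (use pq that in blast)
  obtain c where c: "0 \<le> p - c * q" "p - c * q < q" using reducible_floor pq by blast
  have q: "L q \<noteq> 0" using pq by auto
  have e: "t - L c = L (p - c * q) / L q" "1 - (t - L c) = L (q - (p - c * q)) / L q"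
    using pq by (simp_all add: field_simps)
  have q_pos: "fls_pos (L q)" using pq by simp
  have e0: "t - L c = 0 \<or> fls_pos (t - L c)"
  proof (cases "p - c * q = 0")
    case True
    then show ?thesis unfolding e by (simp only: L_0 div_0 simp_thms)
  next
    case False
    with c(1) have "fls_pos (L (p - c * q))" by (metis fls_pos_L less_le)
    then show ?thesis unfolding e using q_pos by (intro disjI2 fls_pos_divide)
  qed
  have "fls_pos (L (q - (p - c * q)))" using c(2) by (simp only: fls_pos_L diff_gt_0_iff_gt)
  then have e1: "fls_pos (1 - (t - L c))" unfolding e(2) using q_pos by (rule fls_pos_divide)
  have near: "fls_pos (1 + u)" if "tiny 0 u" for u
    by (rule fls_pos_tiny[of 1]) (use that in simp_all)
  have "fls_pos (1 + (s - t))" "fls_pos (1 - (s - t))"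
    using near[of "s - t"] near[of "t - s"] t tiny_commute[of 0 s t] by (simp_all add: algebra_simps)
  then have up: "fls_pos (s - L (c - 1))" and down: "fls_pos (1 - (s - L (c + 1)))"
    using fls_pos_add(1)[of "1 + (s - t)" "t - L c"] fls_pos_add(1)[of "1 - (s - t)" "1 - (t - L c)"] e0 e1
    by (auto simp: algebra_simps)
  have ne: "s - L d \<noteq> 0" for d using irr[of 1 d] by simp
  show ?thesis
  proof (cases "fls_pos (s - L c)")
    case False
    then have "fls_pos (1 - (s - L (c - 1)))" using ne[of c] fls_pos_total[of "s - L c"] by simp
    with up that show ?thesis by blast
  next
    case True
    show ?thesis
    proof (cases "fls_pos (1 - (s - L c))")
      case False
      then have "fls_pos (s - L (c + 1))"
        using ne[of "c + 1"] fls_pos_total[of "s - L (c + 1)"] by (simp add: algebra_simps)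
      with down that show ?thesis by blast
    qed (use True that in blast)
  qed
qed

text \<open>A continued fraction with positive integral partial quotients cannot have only rational complete quotients:
  their denominators would decrease.\<close>

lemma no_infinite_rational_cf:
  fixes r :: "nat \<Rightarrow> rat" and a :: "nat \<Rightarrow> int"
  assumes r: "\<And>n. 0 < r n" and a: "\<And>n. 1 \<le> a n" and eq: "\<And>n. r n = of_int (a n) + 1 / r (Suc n)"
  shows False
proof -
  have "0 < v \<Longrightarrow> r n * of_nat v = of_int u \<Longrightarrow> False" for v n u
  proof (induction v arbitrary: n u rule: less_induct)
    case (less v)
    define w where "w = u - a n * int v"
    have w: "of_int w * r (Suc n) = (of_nat v :: rat)"
      using less.prems eq[of n] r[of "Suc n"] by (simp add: w_def field_simps)
    have "(1::rat) \<le> of_int (a (Suc n))" "0 < 1 / r (Suc (Suc n))"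
      using a[of "Suc n"] r[of "Suc (Suc n)"] by simp_all
    then have "r (Suc n) > 1" using eq[of "Suc n"] by linarith
    have "0 < (of_int w :: rat)"
      using w r[of "Suc n"] less.prems(1) by (metis of_nat_0_less_iff zero_less_mult_pos2)
    then have "0 < w" by simp
    have "(of_int w :: rat) * 1 < of_int w * r (Suc n)"
      using \<open>r (Suc n) > 1\<close> \<open>0 < (of_int w :: rat)\<close> by (intro mult_strict_left_mono)
    then have "w < int v" using w by simp
    show False
      by (rule less.IH[of "nat w" "Suc n" "int v"]) (use \<open>0 < w\<close> \<open>w < int v\<close> w in \<open>auto simp: mult.commute\<close>)
  qed
  moreover obtain u v where "quotient_of (r 0) = (u, v)" by fastforce
  then have v: "0 < v" and "r 0 = of_int u / of_int v"
    using quotient_of_denom_pos quotient_of_div by blast+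
  then have "r 0 * of_nat (nat v) = of_int u" by simp
  ultimately show False using v by (metis zero_less_nat_eq)
qed

lemma fls_pos_subdegree_mono:
  assumes "fls_pos s" "fls_pos (t - s)" shows "fls_subdegree t \<le> fls_subdegree s"
  using fls_pos_add(2)[OF assms] by simp

text \<open>Take the floor, invert the rest, repeat. Partial quotients after the first are at least
  1 but may be constants, and the error bound improves only by their degrees. Convergence thus
  requires infinitely many nonconstant ones.\<close>

lemma cf_limit_irrational_expansion:
  assumes s: "cf_limit s" and irr: "\<And>p q. q \<noteq> 0 \<Longrightarrow> s \<noteq> L p / L q"
  shows "\<exists>b. cf_converges_to (\<lambda>n. L (b n)) s"
proof -
  define good where "good t \<longleftrightarrow> cf_limit t \<and> (\<forall>p q. q \<noteq> 0 \<longrightarrow> t \<noteq> L p / L q)" for t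
  define fl where "fl t = (SOME c. fls_pos (t - L c) \<and> fls_pos (1 - (t - L c)))" for t
  define nx where "nx t = inverse (t - L (fl t))" for t
  define st where "st n = (nx ^^ n) s" for n
  define b where "b n = fl (st n)" for n
  have fl: "fls_pos (t - L (fl t)) \<and> fls_pos (1 - (t - L (fl t)))" if "good t" for t
  proof -
    from that have "cf_limit t" and *: "\<And>p q. q \<noteq> 0 \<Longrightarrow> t \<noteq> L p / L q" by (auto simp: good_def)
    then obtain c where "fls_pos (t - L c)" "fls_pos (1 - (t - L c))" by (rule cf_limit_floor)
    then show ?thesis unfolding fl_def by (intro someI[of "\<lambda>c. fls_pos (t - L c) \<and> fls_pos (1 - (t - L c))" c] conjI)
  qed
  have good_nx: "good (nx t)" if "good t" for t
    unfolding good_def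
  proof (intro conjI allI impI notI)
    show "cf_limit (nx t)" using that unfolding nx_def good_def by (simp add: cf_limit_inverse cf_limit_diff_L)
    fix p q assume q: "q \<noteq> 0" and "nx t = L p / L q"
    then have "t = L (fl t) + inverse (L p / L q)" by (metis nx_def inverse_inverse_eq add.commute diff_add_cancel)
    moreover have "L p \<noteq> 0" using calculation that q unfolding good_def by (metis L_eq_0_iff add.right_neutral div_0 div_by_1 inverse_zero L_1 zero_neq_one)
    ultimately have "t = L (fl t * p + q) / L p" by (simp add: field_simps)
    then show False using that \<open>L p \<noteq> 0\<close> unfolding good_def by (metis L_eq_0_iff)
  qed
  have good: "good (st n)" for n
  proof (induction n)
    case 0
    then show ?case using assms by (simp add: st_def good_def)
  qed (simp add: st_def good_nx)
  have pos: "fls_pos (st n - L (b n))" "fls_pos (1 - (st n - L (b n)))" for n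
    using fl[OF good[of n]] by (simp_all add: b_def)
  have st_Suc: "st (Suc n) = inverse (st n - L (b n))" for n
    by (simp add: st_def nx_def b_def)
  have st_eq: "st n = L (b n) + inverse (st (Suc n))" for n by (simp add: st_Suc)
  have st_gt1: "fls_pos (st (Suc n) - 1)" for n
  proof -
    have "st (Suc n) - 1 = (1 - (st n - L (b n))) / (st n - L (b n))"
      using fls_pos_nonzero[OF pos(1)[of n]] by (simp add: st_Suc field_simps)
    then show ?thesis using pos[of n] by (simp add: fls_pos_divide)
  qed
  have b_ge1: "1 \<le> b (Suc n)" for n
  proof -
    have "fls_pos ((st (Suc n) - 1) + (1 - (st (Suc n) - L (b (Suc n)))))"
      by (rule fls_pos_add(1)[OF st_gt1 pos(2)])
    then show ?thesis by (intro int_poly_discrete) simp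
  qed
  have b_pos: "0 < b (Suc n)" for n
    using b_ge1[of n] by (meson less_le_trans zero_less_one)
  have st_sub: "fls_subdegree (st (Suc n)) \<le> - int (degree (b (Suc n)))" for n
    using fls_pos_subdegree_mono[of "L (b (Suc n))" "st (Suc n)"] pos b_pos by simp

  define cf where "cf k n = cf_value (map (\<lambda>n. L (b n)) [k..<n])" for k n
  have cf_step: "cf k n = (case cf (Suc k) n of None \<Rightarrow> Some (L (b k)) | Some v \<Rightarrow> if v = 0 then None else Some (L (b k) + 1 / v))"
    if "k < n" for k n using that by (simp add: cf_def upt_conv_Cons)
  \<comment> \<open>The complete quotient \<open>st k\<close> is compared with the truncation that
    starts at \<open>k\<close>. For positive \<open>k\<close> the truncation is at least
    \<open>b k\<close>, so the inversions never meet 0. The offset - 1 is there because the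
    fractional part in the base case may have degree 0.\<close>
  have cf_close: "\<exists>r. cf k (Suc (k + m)) = Some r \<and> (k = 0 \<or> fls_pos (r - L (b k)) \<or> r = L (b k)) \<and>
      tiny ((\<Sum>i\<in>{k<..k+m}. int (degree (b i))) - 1) (st k - r)" for k m
  proof (induction m arbitrary: k)
    case 0
    have "fls_subdegree (st k - L (b k)) \<ge> 0"
      using fls_pos_subdegree_mono[of "st k - L (b k)" 1] pos by simp
    then have "tiny (- 1) (st k - L (b k))" by (simp add: tiny_iff)
    moreover have "cf k (Suc k) = Some (L (b k))" by (simp add: cf_def)
    ultimately show ?case by simp
  next
    case (Suc m)
    obtain r where r: "cf (Suc k) (Suc (Suc k + m)) = Some r"
      "fls_pos (r - L (b (Suc k))) \<or> r = L (b (Suc k))"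
      "tiny ((\<Sum>i\<in>{Suc k<..Suc k+m}. int (degree (b i))) - 1) (st (Suc k) - r)"
      using Suc.IH[of "Suc k"] by auto
    have rpos: "fls_pos r" and rsub: "fls_subdegree r \<le> 0"
    proof -
      have "fls_pos (L (b (Suc k)))" using b_pos by simp
      then show "fls_pos r" using r(2) fls_pos_add(1)[of "L (b (Suc k))" "r - L (b (Suc k))"] by auto
      have "fls_subdegree r \<le> fls_subdegree (L (b (Suc k)))"
        using r(2) fls_pos_subdegree_mono \<open>fls_pos (L (b (Suc k)))\<close> by fastforce
      then show "fls_subdegree r \<le> 0" by simp
    qed
    then have r0: "r \<noteq> 0" by auto
    have s0: "st (Suc k) \<noteq> 0" using good[of "Suc k"] unfolding good_def by (metis L_0 div_0 zero_neq_one)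
    have "tiny ((\<Sum>i\<in>{Suc k<..Suc k+m}. int (degree (b i))) - 1 + int (degree (b (Suc k))))
        ((st (Suc k) - r) * inverse (- (r * st (Suc k))))"
      using r(3) rsub st_sub[of k] r0 s0 by (intro tiny_mult) auto
    moreover have "(st (Suc k) - r) * inverse (- (r * st (Suc k))) = st k - (L (b k) + 1 / r)"
      using r0 s0 by (simp add: st_eq[of k] field_simps)
    moreover have "{k<..k + Suc m} = insert (Suc k) {Suc k<..Suc k + m}" by auto
    then have "(\<Sum>i\<in>{Suc k<..Suc k+m}. int (degree (b i))) - 1 + int (degree (b (Suc k))) = (\<Sum>i\<in>{k<..k+Suc m}. int (degree (b i))) - 1"
      by simp
    ultimately have "tiny ((\<Sum>i\<in>{k<..k+Suc m}. int (degree (b i))) - 1) (st k - (L (b k) + 1 / r))"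
      by (simp only:)
    moreover have "cf k (Suc (k + Suc m)) = Some (L (b k) + 1 / r)"
      using r(1) r0 cf_step[of k "Suc (k + Suc m)"] by simp
    moreover have "fls_pos (L (b k) + 1 / r - L (b k))" using rpos by (simp add: fls_pos_divide)
    ultimately show ?case by blast
  qed

  \<comment> \<open>If the partial quotients were constants from some index on, the complete
    quotients would have degree 0, and their constant terms would be rational numbers with an
    infinite continued fraction over the positive integers.\<close>
  have nonconst: "\<exists>i>m. 0 < degree (b i)" for m
  proof (rule ccontr)
    assume "\<not> ?thesis"
    then have deg0: "degree (b (m + Suc n)) = 0" for n by auto
    define r where "r n = st (m + Suc n) $$ 0" for n
    define a where "a n = coeff (b (m + Suc n)) 0" for n
    have ba: "b (m + Suc n) = [:a n:]" for n using deg0[of n] by (metis a_def degree_eq_zeroE coeff_pCons_0)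
    have "1 \<le> a n" for n
      using b_ge1[of "m + n"] ba[of n] by (auto simp: less_eq_poly_def pos_poly_def one_pCons split: if_splits)
    have sd: "fls_subdegree (st (m + Suc n)) = 0" for n
    proof -
      have "0 \<le> fls_subdegree (st (m + Suc n) - L (b (m + Suc n)))"
        using fls_pos_subdegree_mono[of "st (m + Suc n) - L (b (m + Suc n))" 1] pos by simp
      moreover have "0 < b (m + Suc n)" using b_pos[of "m + n"] by simp
      ultimately have "0 \<le> fls_subdegree (st (m + Suc n))"
        using fls_pos_add(2)[of "st (m + Suc n) - L (b (m + Suc n))" "L (b (m + Suc n))"] pos[of "m + Suc n"] deg0[of n] by simp
      then show ?thesis using st_sub[of "m + n"] deg0[of n] by simp
    qed
    have rlc: "r n = fls_lc (st (m + Suc n))" for n using sd[of n] by (simp add: r_def fls_lc_def)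
    have "fls_pos (st (m + Suc n))" for n
      using fls_pos_add(1)[OF st_gt1[of "m + n"] fls_pos_1] by simp
    then have "0 < r n" for n by (simp only: rlc fls_pos_def)
    moreover have "r n = of_int (a n) + 1 / r (Suc n)" for n
    proof -
      have "inverse (st (m + Suc (Suc n))) $$ 0 = fls_lc (inverse (st (m + Suc (Suc n))))"
        using sd[of "Suc n"] by (simp add: fls_lc_def del: fls_lc_inverse)
      then have "inverse (st (m + Suc (Suc n))) $$ 0 = 1 / r (Suc n)"
        by (simp only: rlc fls_lc_inverse) (simp add: inverse_eq_divide)
      moreover have "L (b (m + Suc n)) $$ 0 = of_int (a n)" by (simp add: L_nth a_def)
      ultimately show ?thesis using st_eq[of "m + Suc n"] by (simp add: r_def)
    qed
    ultimately show False using no_infinite_rational_cf[of r a] \<open>\<And>n. 1 \<le> a n\<close> by blast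
  qed
  have unbounded: "\<exists>m. int K \<le> (\<Sum>i\<in>{0<..m}. int (degree (b i)))" for K
  proof (induction K)
    case (Suc K)
    then obtain m where m: "int K \<le> (\<Sum>i\<in>{0<..m}. int (degree (b i)))" by blast
    obtain i where i: "m < i" "0 < degree (b i)" using nonconst by blast
    have "(\<Sum>j\<in>insert i {0<..m}. int (degree (b j))) \<le> (\<Sum>j\<in>{0<..i}. int (degree (b j)))"
      using i by (intro sum_mono2) auto
    moreover have "(\<Sum>j\<in>insert i {0<..m}. int (degree (b j))) = int (degree (b i)) + (\<Sum>i\<in>{0<..m}. int (degree (b i)))"
      using i by (subst sum.insert) auto
    ultimately have "int (Suc K) \<le> (\<Sum>j\<in>{0<..i}. int (degree (b j)))" using m i by linarith
    then show ?case by blast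
  next
    case 0
    show ?case by (rule exI[of _ 0]) simp
  qed
  have close: "\<exists>r. cf 0 (Suc n) = Some r \<and> tiny ((\<Sum>i\<in>{0<..n}. int (degree (b i))) - 1) (s - r)" for n
    using cf_close[of 0 n] by (auto simp: st_def)
  have "cf_converges_to (\<lambda>n. L (b n)) s"
    unfolding cf_converges_to_def cf_def[of 0, symmetric] tendsto_fls_iff
  proof (intro conjI allI)
    show "\<forall>\<^sub>F n in sequentially. cf 0 n \<noteq> None"
      unfolding eventually_sequentially
    proof (intro exI[of _ 1] allI impI)
      fix n :: nat assume "1 \<le> n"
      then show "cf 0 n \<noteq> None" using close[of "n - 1"] by auto
    qed
    fix K
    obtain m where m: "int (nat (K + 1)) \<le> (\<Sum>i\<in>{0<..m}. int (degree (b i)))" using unbounded by blast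
    show "\<forall>\<^sub>F n in sequentially. tiny K (s - the (cf 0 n))"
      unfolding eventually_sequentially
    proof (intro exI[of _ "Suc m"] allI impI)
      fix n assume n: "Suc m \<le> n"
      obtain r where r: "cf 0 (Suc (n - 1)) = Some r" "tiny ((\<Sum>i\<in>{0<..n - 1}. int (degree (b i))) - 1) (s - r)"
        using close by blast
      have "(\<Sum>i\<in>{0<..m}. int (degree (b i))) \<le> (\<Sum>i\<in>{0<..n - 1}. int (degree (b i)))"
        using n by (intro sum_mono2) auto
      then have "tiny K (s - r)" using r(2) m by (elim tiny_mono) linarith
      then show "tiny K (s - the (cf 0 n))" using r(1) n by simp
    qed
  qed
  then show ?thesis by blast
qed

theorem has_specializable_cf_iff_cf_limit: "has_specializable_cf s \<longleftrightarrow> cf_limit s"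
proof
  assume s: "cf_limit s"
  show "has_specializable_cf s"
  proof (cases "\<exists>p q. q \<noteq> 0 \<and> s = L p / L q")
    case True
    then obtain p q where "q \<noteq> 0" "s = L p / L q" by blast
    \<comment> \<open>A rational series approximates itself with error 0.\<close>
    then have "finite_cf s" using cf_limit_approximant[OF s, of q p] by simp
    then show ?thesis using finite_cf_value by (auto simp: has_specializable_cf_def)
  next
    case False
    then show ?thesis using cf_limit_irrational_expansion[OF s] by (auto simp: has_specializable_cf_def)
  qed
qed (rule has_specializable_cf_imp_cf_limit)

section \<open>Iterates and partial sums\<close>

text \<open>Completeness: as \<open>int n \<le> k n\<close>, the coefficient at \<open>j\<close> is
  stable from index \<open>nat j\<close> on and is read off there.\<close>

lemma tiny_limit_exists:
  assumes step: "\<And>n. tiny (k n) (u (Suc n) - u n)" and k: "mono k" "\<And>n. int n \<le> k n"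
  obtains s where "\<And>n. tiny (k n) (s - u n)"
proof -
  have const: "N \<le> M \<Longrightarrow> j \<le> k N \<Longrightarrow> u M $$ j = u N $$ j" for N M j
  proof (induction M rule: dec_induct)
    case (step M)
    have "k N \<le> k M" using step k(1) by (auto dest: monoD)
    then show ?case using step assms(1)[of M] by (simp add: tiny_def)
  qed simp
  define s where "s = Abs_fls (\<lambda>j. u (nat j) $$ j)"
  have s: "s $$ j = u (nat j) $$ j" for j unfolding s_def
    by (rule nth_Abs_fls_lower_bound[of "min 0 (fls_subdegree (u 0))"]) simp
  have "tiny (k n) (s - u n)" for n unfolding tiny_def
  proof (intro allI impI)
    fix j assume j: "j \<le> k n"
    have "j \<le> k (nat j)" using k(2)[of "nat j"] by linarith
    then show "(s - u n) $$ j = 0"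
      using const[of n "nat j" j] const[of "nat j" n j] j linear[of n "nat j"] by (auto simp: s)
  qed
  then show ?thesis using that by blast
qed

lemma poly_iterate_0 [simp]: "poly_iterate f 0 = pX"
  and poly_iterate_Suc [simp]: "poly_iterate f (Suc n) = pcompose f (poly_iterate f n)"
  by (simp_all add: poly_iterate_def)

lemma degree_poly_iterate: "degree (poly_iterate f n) = degree f ^ n"
  by (induction n) (simp_all add: degree_pcompose)

lemma poly_iterate_nonzero: "0 < degree f \<Longrightarrow> poly_iterate f n \<noteq> 0"
  using degree_poly_iterate[of f n] by (metis degree_0 zero_less_power less_irrefl)

definition orbit_sum :: "int poly \<Rightarrow> nat \<Rightarrow> rat fls" where
  "orbit_sum f n = (\<Sum>i<n. 1 / L (poly_iterate f i))"

lemma orbit_sum_0 [simp]: "orbit_sum f 0 = 0"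
  and orbit_sum_Suc [simp]: "orbit_sum f (Suc n) = orbit_sum f n + 1 / L (poly_iterate f n)"
  by (simp_all add: orbit_sum_def)

definition orbit_series :: "int poly \<Rightarrow> rat fls" where
  "orbit_series f = (\<Sum>n. 1 / L (poly_iterate f n))"

text \<open>The term with index n has subdegree exactly \<open>degree f ^ n\<close>; since
  \<open>tiny\<close> is a strict bound, 1 is subtracted.\<close>

lemma orbit_series_tail:
  assumes "1 < degree f"
  shows "tiny (int (degree f ^ n) - 1) (orbit_series f - orbit_sum f n)"
proof -
  define k where "k n = int (degree f ^ n) - 1" for n
  have step: "tiny (k n) (orbit_sum f (Suc n) - orbit_sum f n)" for n
    using poly_iterate_nonzero[of f n] assms by (simp add: k_def tiny_iff degree_poly_iterate)
  have "mono k" unfolding k_def using assms by (intro monoI diff_right_mono of_nat_mono power_increasing) auto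
  moreover have le: "int n \<le> k n" for n
  proof -
    have "n < degree f ^ n" using assms by (simp add: power_gt_expt)
    then show ?thesis unfolding k_def by linarith
  qed
  ultimately obtain s where s: "\<And>n. tiny (k n) (s - orbit_sum f n)"
    using tiny_limit_exists[where k = k and u = "orbit_sum f"] step by blast
  have "orbit_sum f \<longlonglongrightarrow> s" unfolding tendsto_fls_iff eventually_sequentially
  proof (intro allI exI impI)
    fix K n assume "nat K \<le> n"
    then show "tiny K (s - orbit_sum f n)"
      using le[of n] by (intro tiny_mono[OF s]) linarith
  qed
  then have "(\<lambda>n. 1 / L (poly_iterate f n)) sums s" by (simp add: sums_def orbit_sum_def[abs_def])
  then have "orbit_series f = s" by (simp add: orbit_series_def sums_iff)
  then show ?thesis using s[of n] by (simp add: k_def)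
qed

text \<open>Infinitely many finite partial sums suffice. For congruence (2) only the sums with an
  odd number of terms are treated.\<close>

lemma orbit_series_specializable:
  assumes "1 < degree f" and ev: "\<And>m. \<exists>n\<ge>m. finite_cf (orbit_sum f n)"
  shows "cf_limit (orbit_series f)"
  unfolding cf_limit_def
proof
  fix K
  obtain n where n: "nat K \<le> n" "finite_cf (orbit_sum f n)" using ev by blast
  have "n < degree f ^ n" using assms(1) by (simp add: power_gt_expt)
  then have "tiny K (orbit_series f - orbit_sum f n)"
    using n by (intro tiny_mono[OF orbit_series_tail[OF assms(1)]]) linarith
  then show "\<exists>t. finite_cf t \<and> tiny K (orbit_series f - t)" using n by blast
qed

text \<open>The product of the iterates is a common denominator, not always the least: if f(0) = 0,
  all iterates share the factor x. Congruences (1), (2), (5) and (12) are treated with smaller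
  denominators.\<close>

fun orbit_prod :: "int poly \<Rightarrow> nat \<Rightarrow> int poly" where
  "orbit_prod f 0 = 1"
| "orbit_prod f (Suc n) = orbit_prod f n * poly_iterate f n"

fun orbit_num :: "int poly \<Rightarrow> nat \<Rightarrow> int poly" where
  "orbit_num f 0 = 0"
| "orbit_num f (Suc n) = orbit_num f n * poly_iterate f n + orbit_prod f n"

lemma orbit_prod_nonzero: "0 < degree f \<Longrightarrow> orbit_prod f n \<noteq> 0"
  by (induction n) (simp_all add: poly_iterate_nonzero del: poly_iterate_Suc)

lemma orbit_sum_eq: "0 < degree f \<Longrightarrow> orbit_sum f n = L (orbit_num f n) / L (orbit_prod f n)"
  by (induction n) (simp_all add: orbit_prod_nonzero poly_iterate_nonzero field_simps)

lemma degree_orbit_prod: "1 < degree f \<Longrightarrow> degree (orbit_prod f n) * (degree f - 1) + 1 = degree f ^ n"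
proof (induction n)
  case (Suc n)
  then have "degree (orbit_prod f (Suc n)) = degree (orbit_prod f n) + degree f ^ n"
    using orbit_prod_nonzero[of f n] poly_iterate_nonzero[of f n] 
    by (simp add: degree_mult_eq degree_poly_iterate del: poly_iterate_Suc)
  then have "degree (orbit_prod f (Suc n)) * (degree f - 1) + 1 = degree f ^ n + degree f ^ n * (degree f - 1)"
    using Suc by (simp only: add_mult_distrib) simp
  also have "\<dots> = degree f ^ n * (1 + (degree f - 1))" by (simp only: distrib_left mult_1_right)
  finally show ?case using Suc.prems by simp
qed simp

text \<open>For degree at least 3 the partial sums are convergents of the series.\<close>

lemma orbit_sum_finite_cf:
  assumes "2 < degree f" "cf_limit (orbit_series f)"
  shows "finite_cf (orbit_sum f n)"
proof -
  have "degree (orbit_prod f n) * 2 \<le> degree (orbit_prod f n) * (degree f - 1)"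
    using assms(1) by (intro mult_left_mono) auto
  then have "2 * int (degree (orbit_prod f n)) \<le> int (degree f ^ n) - 1"
    using degree_orbit_prod[of f n] assms(1) by linarith
  moreover have "tiny (int (degree f ^ n) - 1) (orbit_series f - orbit_sum f n)"
    using assms(1) by (intro orbit_series_tail) simp
  ultimately have "tiny (2 * int (degree (orbit_prod f n))) (orbit_series f - orbit_sum f n)"
    by (rule tiny_mono[rotated])
  then show ?thesis
    using assms cf_limit_approximant[of "orbit_series f" "orbit_prod f n" "orbit_num f n"] orbit_prod_nonzero[of f n]
    by (simp add: orbit_sum_eq)
qed

section \<open>The symmetry x to -x\<close>

definition reflect :: "int poly \<Rightarrow> int poly" where
  "reflect p = pcompose p (- pX)"

lemma reflect_simps [simp]:
  "reflect 0 = 0" "reflect 1 = 1" "reflect (p + q) = reflect p + reflect q" "reflect (p * q) = reflect p * reflect q"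
  "reflect (- p) = - reflect p" "reflect (p - q) = reflect p - reflect q" "degree (reflect p) = degree p"
  by (simp_all add: reflect_def pcompose_add pcompose_mult pcompose_uminus pcompose_diff degree_pcompose pcompose_1)

lemma reflect_reflect [simp]: "reflect (reflect p) = p"
  by (simp add: reflect_def flip: pcompose_assoc)
     (simp add: pcompose_pCons pcompose_uminus)

lemma reflect_eq_0_iff [simp]: "reflect p = 0 \<longleftrightarrow> p = 0"
  by (metis reflect_reflect reflect_simps(1))

lemma reducible_reflect: "reducible p q \<Longrightarrow> reducible (reflect p) (reflect q)"
  by (induction rule: reducible.induct) (auto intro: reducible.intros)

text \<open>Conjugation of f by x -> -x. The iterates are conjugated as well, so the series s(x)
  becomes - s(-x).\<close>

definition conj_reflect :: "int poly \<Rightarrow> int poly" where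
  "conj_reflect f = - reflect f"

lemma conj_reflect_conj_reflect [simp]: "conj_reflect (conj_reflect f) = f"
  by (simp add: conj_reflect_def)

lemma degree_conj_reflect [simp]: "degree (conj_reflect f) = degree f"
  by (simp add: conj_reflect_def)

lemma poly_iterate_conj_reflect: "poly_iterate (conj_reflect f) n = - reflect (poly_iterate f n)"
proof (induction n)
  case 0
  then show ?case by (simp add: reflect_def pcompose_pCons)
next
  case (Suc n)
  have "pcompose (- pX) (- reflect (poly_iterate f n)) = reflect (poly_iterate f n)"
    by (simp add: pcompose_pCons)
  then have "pcompose (reflect f) (- reflect (poly_iterate f n)) = pcompose f (reflect (poly_iterate f n))"
    by (simp add: reflect_def pcompose_assoc[symmetric])
  then show ?case using Suc by (simp add: conj_reflect_def pcompose_uminus) (simp add: reflect_def pcompose_assoc)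
qed

lemma orbit_conj_reflect:
  "orbit_prod (conj_reflect f) n = (- 1) ^ n * reflect (orbit_prod f n)"
  "orbit_num (conj_reflect f) n = - ((- 1) ^ n * reflect (orbit_num f n))"
  by (induction n) (simp_all add: poly_iterate_conj_reflect algebra_simps del: poly_iterate_Suc)

text \<open>Expressed by degrees of polynomials, specializability is visibly invariant under
  \<open>reflect\<close>, without extending the substitution x -> -x to Laurent series. The n-th
  condition asks for precision up to the tail after n terms.\<close>

lemma cf_limit_orbit_series_iff:
  assumes "1 < degree f"
  shows "cf_limit (orbit_series f) \<longleftrightarrow> (\<forall>n. \<exists>p q. q \<noteq> 0 \<and> reducible p q \<and>
    (let r = orbit_num f n * q - p * orbit_prod f n in r = 0 \<or>
      degree r + degree f ^ n \<le> degree (orbit_prod f n) + degree q))" (is "_ \<longleftrightarrow> ?R")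
proof -
  have f: "0 < degree f" using assms by simp
  have eq: "orbit_sum f n - L p / L q = L (orbit_num f n * q - p * orbit_prod f n) / L (orbit_prod f n * q)"
    if "q \<noteq> 0" for p q n
    using that orbit_prod_nonzero[OF f, of n] by (simp add: orbit_sum_eq[OF f] field_simps)
  have sd: "fls_subdegree (L r / L (orbit_prod f n * q)) = int (degree (orbit_prod f n)) + int (degree q) - int (degree r)"
    if "q \<noteq> 0" "r \<noteq> 0" for r q n
    using that orbit_prod_nonzero[OF f, of n] by (subst fls_subdegree_divide) (simp_all add: degree_mult_eq del: L_mult)
  have near: "tiny (int (degree f ^ n) - 1) (orbit_sum f n - L p / L q) \<longleftrightarrow>
      (let r = orbit_num f n * q - p * orbit_prod f n in r = 0 \<or>
      degree r + degree f ^ n \<le> degree (orbit_prod f n) + degree q)" if "q \<noteq> 0" for p q n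
  proof -
    define r where "r = orbit_num f n * q - p * orbit_prod f n"
    have "tiny (int (degree f ^ n) - 1) (L r / L (orbit_prod f n * q)) \<longleftrightarrow>
        r = 0 \<or> degree r + degree f ^ n \<le> degree (orbit_prod f n) + degree q"
    proof (cases "r = 0")
      case False
      then have "L r / L (orbit_prod f n * q) \<noteq> 0" using that orbit_prod_nonzero[OF f, of n] by simp
      then show ?thesis using False sd[OF that False] by (simp only: tiny_iff) linarith
    qed simp
    then show ?thesis unfolding eq[OF that] Let_def r_def by blast
  qed
  have "cf_limit (orbit_series f) \<longleftrightarrow> (\<forall>n. \<exists>t. finite_cf t \<and> tiny (int (degree f ^ n) - 1) (orbit_sum f n - t))"
    (is "_ \<longleftrightarrow> ?R'")
  proof
    assume "cf_limit (orbit_series f)"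
    show ?R'
    proof
      fix n
      obtain t where t: "finite_cf t" "tiny (int (degree f ^ n) - 1) (orbit_series f - t)"
        using \<open>cf_limit (orbit_series f)\<close> unfolding cf_limit_def by blast
      have "tiny (int (degree f ^ n) - 1) (orbit_sum f n - t)"
        using tiny_diff[OF t(2) orbit_series_tail[OF assms]] by simp
      then show "\<exists>t. finite_cf t \<and> tiny (int (degree f ^ n) - 1) (orbit_sum f n - t)" using t(1) by blast
    qed
  next
    assume R: ?R'
    show "cf_limit (orbit_series f)" unfolding cf_limit_def
    proof
      fix K
      obtain t where t: "finite_cf t" "tiny (int (degree f ^ nat K) - 1) (orbit_sum f (nat K) - t)" using R by blast
      have "nat K < degree f ^ nat K" using assms by (simp add: power_gt_expt)
      moreover have "tiny (int (degree f ^ nat K) - 1) (orbit_series f - t)"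
        using tiny_add[OF orbit_series_tail[OF assms] t(2)] by simp
      moreover have "K \<le> int (degree f ^ nat K) - 1" using calculation(1) by linarith
      ultimately show "\<exists>t. finite_cf t \<and> tiny K (orbit_series f - t)"
        using t(1) tiny_mono by blast
    qed
  qed
  also have "\<dots> \<longleftrightarrow> (\<forall>n. \<exists>p q. q \<noteq> 0 \<and> reducible p q \<and> tiny (int (degree f ^ n) - 1) (orbit_sum f n - L p / L q))"
    unfolding finite_cf_def by blast
  also have "\<dots> \<longleftrightarrow> ?R" using near by (simp cong: conj_cong del: of_nat_power)
  finally show ?thesis .
qed

lemma cf_limit_conj_reflect:
  assumes "1 < degree f" "cf_limit (orbit_series f)"
  shows "cf_limit (orbit_series (conj_reflect f))"
proof -
  have f': "1 < degree (conj_reflect f)" using assms by simp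
  show ?thesis unfolding cf_limit_orbit_series_iff[OF f']
  proof
    fix n
    obtain p q where pq: "q \<noteq> 0" "reducible p q" 
      "let r = orbit_num f n * q - p * orbit_prod f n in r = 0 \<or>
        degree r + degree f ^ n \<le> degree (orbit_prod f n) + degree q"
      using assms(2) unfolding cf_limit_orbit_series_iff[OF assms(1)] by blast
    define r where "r = orbit_num f n * q - p * orbit_prod f n"
    have "orbit_num (conj_reflect f) n * reflect q - (- reflect p) * orbit_prod (conj_reflect f) n =
      - ((-1) ^ n * reflect r)"
      by (simp add: orbit_conj_reflect r_def algebra_simps)
    moreover have "degree ((- 1) ^ n * t) = degree t" "(- 1) ^ n * t = 0 \<longleftrightarrow> t = 0" for t :: "int poly"
      by (cases "even n"; simp)+
    ultimately have "let r = orbit_num (conj_reflect f) n * reflect q - (- reflect p) * orbit_prod (conj_reflect f) n in r = 0 \<or>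
        degree r + degree (conj_reflect f) ^ n \<le> degree (orbit_prod (conj_reflect f) n) + degree (reflect q)"
      using pq(3) unfolding r_def[symmetric] Let_def orbit_conj_reflect by simp
    moreover have "reducible (- reflect p) (reflect q)" "reflect q \<noteq> 0" using pq by (simp_all add: reducible_reflect)
    ultimately show "\<exists>p q. q \<noteq> 0 \<and> reducible p q \<and> (let r = orbit_num (conj_reflect f) n * q - p * orbit_prod (conj_reflect f) n in r = 0 \<or>
        degree r + degree (conj_reflect f) ^ n \<le> degree (orbit_prod (conj_reflect f) n) + degree q)" by blast
  qed
qed

section \<open>Sufficiency: orbits of 0 ending in the fixed point 1\<close>

text \<open>The folding lemma: for eta = Q^2 y the transported fraction is J/Q + y, an integral
  translate of J/Q.\<close>

lemma finite_cf_fold: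
  assumes "Q \<noteq> 0" "finite_cf (L P / L Q)" "Q dvd P * J - 1"
  shows "finite_cf (L P / L Q + 1 / (L Q ^ 2 * L y))"
proof -
  have "L Q ^ 2 * L y / L Q ^ 2 + L J / L Q = L J / L Q + L y" using assms(1) by (simp add: add.commute)
  then show ?thesis
    using finite_cf_transport(1)[OF assms, of "L Q ^ 2 * L y"] finite_cf_transport(2)[OF assms]
    by (simp add: add.commute[of "L y"])
qed

text \<open>Modulo f^i the iterate f^n is f^(n-i)(0). If f sends 0 to 1 and fixes 1, this is 1 for
  all i < n; so f^n is 1 modulo the product of its predecessors, with cofactor \<open>m\<close>.
  \<open>J\<close> inverts the numerator.\<close>

definition coprime_state :: "int poly \<Rightarrow> nat \<Rightarrow> int poly \<Rightarrow> int poly \<Rightarrow> bool" where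
  "coprime_state f n J m \<longleftrightarrow> poly_iterate f n = 1 + orbit_prod f n * m \<and> orbit_prod f n dvd orbit_num f n * J - 1"

lemma coprime_state_0: "coprime_state f 0 0 (pX - 1)"
  by (simp add: coprime_state_def)

text \<open>The new inverse comes from the Chinese remainder theorem. Modulo Q the new numerator is
  P and the inverse is J, because F = 1. Modulo F the numerator is Q; as Q m = -1, its inverse is -
  m, which is Q m^2.\<close>

lemma orbit_inverse_Suc:
  assumes "coprime_state f n J m"
  shows "orbit_prod f (Suc n) dvd orbit_num f (Suc n) * (poly_iterate f n * J + orbit_prod f n * m ^ 2) - 1"
proof -
  define P Q F where "P = orbit_num f n" "Q = orbit_prod f n" "F = poly_iterate f n"
  obtain k where "P * J - 1 = Q * k" and F: "F = 1 + Q * m"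
    using assms by (auto simp: coprime_state_def P_Q_F_def)
  then have k: "P * J = 1 + Q * k" by (simp add: algebra_simps)
  have "(P * F + Q) * (F * J + Q * m ^ 2) - 1 = Q * F * (F * k + P * m ^ 2 + J + 2 * m)"
    using k F by algebra
  then have "Q * F dvd (P * F + Q) * (F * J + Q * m ^ 2) - 1" by simp
  then show ?thesis by (simp add: P_Q_F_def)
qed

lemma coprime_state_Suc:
  assumes "coprime_state f n J m" "poly_iterate f (Suc n) = 1 + orbit_prod f (Suc n) * m'"
  shows "coprime_state f (Suc n) (poly_iterate f n * J + orbit_prod f n * m ^ 2) m'"
  using orbit_inverse_Suc[OF assms(1)] assms(2) unfolding coprime_state_def by blast

lemma finite_cf_orbit_sum_Suc:
  assumes "0 < degree f" "orbit_prod f n dvd orbit_num f n * J - 1" "finite_cf (orbit_sum f n)"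
  shows "finite_cf (orbit_sum f (Suc n)) \<longleftrightarrow>
    finite_cf (L (poly_iterate f n) / L (orbit_prod f n) ^ 2 + L J / L (orbit_prod f n))"
  using finite_cf_transport(1)[of "orbit_prod f n" "orbit_num f n" J] assms
  by (simp add: orbit_prod_nonzero orbit_sum_eq[symmetric] del: poly_iterate_Suc)

text \<open>Since f(0) = 1, the value of f(f(x)) at 0 is f(1): this is why the quotient of f is expanded at x = 1.\<close>

lemma coprime_state_expand:
  fixes f B e0 e1 r :: "int poly"
  defines "g \<equiv> e0 + e1 * (pX - 1) + (pX - 1) ^ 2 * r"
  assumes f: "f = 1 + (B - 1) * pX + pX ^ 2 * g" and const: "degree B = 0" "degree e0 = 0" "degree e1 = 0"
    and st: "coprime_state f n J m"
  shows "\<exists>R. poly_iterate f (Suc n) = 1 + (B - 1) * poly_iterate f n + poly_iterate f n ^ 2 *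
    (e0 + e1 * (orbit_prod f n * m) + (orbit_prod f n * m) ^ 2 * R)"
proof -
  have pc: "pcompose c h = c" if "degree c = 0" for c h :: "int poly"
    using that by (metis degree_eq_zeroE pcompose_const)
  have F: "poly_iterate f n - 1 = orbit_prod f n * m" using st by (simp add: coprime_state_def)
  have "pcompose f h = 1 + (B - 1) * h + h ^ 2 * (e0 + e1 * (h - 1) + (h - 1) ^ 2 * pcompose r h)" for h
    unfolding f g_def power2_eq_square
    by (simp add: pcompose_add pcompose_mult pcompose_diff pcompose_1 pcompose_idR pc const pcompose_pCons)
  then show ?thesis by (metis F poly_iterate_Suc)
qed

text \<open>The term m^2/F coming from the new inverse equals m/Q - 1/Q^2 + 1/(Q^2 F). It raises the
  coefficients of the expansion of F' by 1, -1 and 1; this is why the linear coefficient of f is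
  written \<open>B - 1\<close>.\<close>

lemma orbit_step_identity:
  fixes Q F m :: "'a::field"
  assumes "Q \<noteq> 0" "F \<noteq> 0" "F = 1 + Q * m"
    and "F' = 1 + (B - 1) * F + F ^ 2 * (e0 + e1 * (Q * m) + (Q * m) ^ 2 * R)"
  shows "F' / (Q * F) ^ 2 + (F * J + Q * m ^ 2) / (Q * F) =
    J / Q + (1 + e1) * m / Q + (e0 - 1) / Q ^ 2 + B / (Q ^ 2 * F) + 1 / (Q * F) ^ 2 + m ^ 2 * R"
proof -
  have m: "m = (F - 1) / Q" using assms by (simp add: field_simps)
  show ?thesis unfolding assms(4) unfolding m using assms(1,2)
    by (simp add: divide_simps) algebra
qed

lemma finite_cf_orbit_step:
  fixes f B e0 e1 r :: "int poly"
  assumes f: "f = 1 + (B - 1) * pX + pX ^ 2 * (e0 + e1 * (pX - 1) + (pX - 1) ^ 2 * r)" 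
    and const: "degree B = 0" "degree e0 = 0" "degree e1 = 0" and deg: "0 < degree f"
    and st: "coprime_state f n J m" and fin: "finite_cf (orbit_sum f (Suc n))"
  defines "Q \<equiv> L (orbit_prod f n)" and "F \<equiv> L (poly_iterate f n)"
  shows "finite_cf (orbit_sum f (Suc (Suc n))) \<longleftrightarrow> finite_cf (L J / Q + (1 + L e1) * L m / Q +
    (L e0 - 1) / Q ^ 2 + L B / (Q ^ 2 * F) + 1 / (Q * F) ^ 2)"
proof -
  obtain R where R: "poly_iterate f (Suc n) = 1 + (B - 1) * poly_iterate f n + poly_iterate f n ^ 2 *
    (e0 + e1 * (orbit_prod f n * m) + (orbit_prod f n * m) ^ 2 * R)"
    using coprime_state_expand[OF f const st] by blast
  have nz: "Q \<noteq> 0" "F \<noteq> 0" using deg by (simp_all add: Q_def F_def orbit_prod_nonzero poly_iterate_nonzero)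
  have F: "F = 1 + Q * L m" using st by (simp add: F_def Q_def coprime_state_def)
  define J' where "J' = poly_iterate f n * J + orbit_prod f n * m ^ 2"
  have dvd: "orbit_prod f (Suc n) dvd orbit_num f (Suc n) * J' - 1"
    using orbit_inverse_Suc[OF st] by (simp add: J'_def)
  have "L (poly_iterate f (Suc n)) = 1 + (L B - 1) * F + F ^ 2 * (L e0 + L e1 * (Q * L m) + (Q * L m) ^ 2 * L R)"
    unfolding R by (simp add: Q_def F_def)
  from orbit_step_identity[OF nz F this, of "L J"]
  have "L (poly_iterate f (Suc n)) / L (orbit_prod f (Suc n)) ^ 2 + L J' / L (orbit_prod f (Suc n)) =
    (L J / Q + (1 + L e1) * L m / Q +
    (L e0 - 1) / Q ^ 2 + L B / (Q ^ 2 * F) + 1 / (Q * F) ^ 2) + L (m ^ 2 * R)"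
    by (simp add: J'_def Q_def F_def del: poly_iterate_Suc)
  with finite_cf_orbit_sum_Suc[OF deg dvd fin] show ?thesis by (simp only: finite_cf_add_iff)
qed


lemma orbit_sum_1: "finite_cf (orbit_sum f (Suc 0))"
  using finite_cf_one_divide_iff[of "L pX"] by simp

lemma iterate_eq_one_plus:
  fixes Q m R e0 e1 :: "'a::comm_ring_1"
  assumes "F = 1 + Q * m"
  shows "1 + (- e0) * F + F ^ 2 * (e0 + e1 * (Q * m) + (Q * m) ^ 2 * R) =
    1 + (Q * F) * (m * (e0 + e1 * F + F * (Q * m) * R))"
  unfolding assms by (simp add: algebra_simps power2_eq_square)

text \<open>\<open>B - 1 = - e0\<close> says that f(1) = 1, so the iterates stay 1 modulo the
  growing product.\<close>

lemma coprime_state_exists: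
  fixes f B e0 e1 r :: "int poly"
  assumes f: "f = 1 + (B - 1) * pX + pX ^ 2 * (e0 + e1 * (pX - 1) + (pX - 1) ^ 2 * r)" 
    and const: "degree B = 0" "degree e0 = 0" "degree e1 = 0"
    and B: "B - 1 = - e0" and st: "coprime_state f n J m"
  shows "\<exists>R. coprime_state f (Suc n) (poly_iterate f n * J + orbit_prod f n * m ^ 2)
    (m * (e0 + e1 * poly_iterate f n + poly_iterate f n * (orbit_prod f n * m) * R))"
proof -
  obtain R where R: "poly_iterate f (Suc n) = 1 + (B - 1) * poly_iterate f n + poly_iterate f n ^ 2 *
    (e0 + e1 * (orbit_prod f n * m) + (orbit_prod f n * m) ^ 2 * R)"
    using coprime_state_expand[OF f const st] by blast
  have "poly_iterate f n = 1 + orbit_prod f n * m" using st by (simp add: coprime_state_def)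
  from iterate_eq_one_plus[OF this] R[unfolded B]
  have "poly_iterate f (Suc n) = 1 + orbit_prod f (Suc n) *
    (m * (e0 + e1 * poly_iterate f n + poly_iterate f n * (orbit_prod f n * m) * R))" 
    by (simp del: poly_iterate_Suc)
  then show ?thesis using coprime_state_Suc[OF st] by blast
qed

text \<open>In the names \<open>pX_cong_n\<close>, n is the number of the congruence in the theorem.\<close>

lemma pX_cong_3:
  assumes deg: "0 < degree f" and f: "f = 1 + pX ^ 2 * (pX - 1) * g"
  shows "finite_cf (orbit_sum f n)"
proof -
  \<comment> \<open>The cofactor is itself a multiple of Q here. Thus F/Q^2 is 1/Q^2 plus a
    polynomial, and the criterion is a fold of J/Q.\<close>
  have "\<exists>J m. coprime_state f n J (orbit_prod f n * m) \<and> finite_cf (orbit_sum f n)"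
  proof (induction n)
    case 0
    show ?case using coprime_state_0[of f] by (intro exI[of _ 0] exI[of _ "pX - 1"]) simp
  next
    case (Suc n)
    then obtain J m where st: "coprime_state f n J (orbit_prod f n * m)" and fin: "finite_cf (orbit_sum f n)" by blast
    define P Q F where "P = orbit_num f n" "Q = orbit_prod f n" "F = poly_iterate f n"
    have Q: "Q \<noteq> 0" using deg by (simp add: P_Q_F_def orbit_prod_nonzero)
    have F: "F = 1 + Q ^ 2 * m" and PJ: "Q dvd P * J - 1"
      using st by (simp_all add: coprime_state_def P_Q_F_def power2_eq_square mult.assoc)
    have finP: "finite_cf (L P / L Q)" using fin deg by (simp add: orbit_sum_eq P_Q_F_def)
    have "finite_cf (L J / L Q + 1 / (L Q ^ 2 * L 1))"
      using finite_cf_transport(2)[OF Q finP PJ] PJ by (intro finite_cf_fold[of Q J P] Q) (simp_all add: mult.commute)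
    moreover have "L F / L Q ^ 2 + L J / L Q = L J / L Q + 1 / (L Q ^ 2 * L 1) + L m"
      using Q by (simp add: F field_simps)
    ultimately have "finite_cf (orbit_sum f (Suc n))"
      using finite_cf_orbit_sum_Suc[OF deg PJ[unfolded P_Q_F_def] fin] by (simp only: P_Q_F_def finite_cf_add_iff)
    moreover have "pcompose f h = 1 + h ^ 2 * (h - 1) * pcompose g h" for h
      unfolding f by (simp add: pcompose_add pcompose_mult pcompose_diff pcompose_1 pcompose_pCons power2_eq_square algebra_simps)
    then have "poly_iterate f (Suc n) = 1 + F ^ 2 * (F - 1) * pcompose g F" by (simp add: P_Q_F_def)
    then have "poly_iterate f (Suc n) = 1 + orbit_prod f (Suc n) * (orbit_prod f (Suc n) * (m * pcompose g F))"
      unfolding orbit_prod.simps P_Q_F_def[symmetric] using F by algebra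
    ultimately show ?case using coprime_state_Suc[OF st] by blast
  qed
  then show ?thesis by blast
qed

text \<open>The invariant Q | m + J makes F/Q^2 + J/Q = 1/Q^2 + (m + J)/Q an integral translate of
  1/Q^2.\<close>

lemma pX_cong_11:
  assumes deg: "0 < degree f" and f: "f = 1 + (0 - 1) * pX + pX ^ 2 * (1 + 0 * (pX - 1) + (pX - 1) ^ 2 * r)"
  shows "finite_cf (orbit_sum f n)"
proof -
  have "\<exists>J m. coprime_state f n J m \<and> orbit_prod f n dvd m + J \<and> finite_cf (orbit_sum f n)"
  proof (induction n)
    case 0
    show ?case using coprime_state_0[of f] by (intro exI[of _ 0] exI[of _ "pX - 1"]) simp
  next
    case (Suc n)
    then obtain J m where st: "coprime_state f n J m" and dvd: "orbit_prod f n dvd m + J"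
      and fin: "finite_cf (orbit_sum f n)" by blast
    define P Q F where "P = orbit_num f n" "Q = orbit_prod f n" "F = poly_iterate f n"
    have Q: "Q \<noteq> 0" using deg by (simp add: P_Q_F_def orbit_prod_nonzero)
    have F: "F = 1 + Q * m" and PJ: "Q dvd P * J - 1"
      using st by (simp_all add: coprime_state_def P_Q_F_def)
    from dvd obtain w where w: "m + J = Q * w" unfolding P_Q_F_def by (elim dvdE)
    then have J: "J = Q * w - m" by (simp add: algebra_simps)
    have "L F / L Q ^ 2 + L J / L Q = 1 / L (Q ^ 2) + L w"
      using Q by (simp add: F J field_simps power2_eq_square)
    then have "finite_cf (L F / L Q ^ 2 + L J / L Q)" by (simp del: L_power)
    then have "finite_cf (orbit_sum f (Suc n))"
      using finite_cf_orbit_sum_Suc[OF deg PJ[unfolded P_Q_F_def] fin] by (simp only: P_Q_F_def)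
    moreover obtain R where R: "coprime_state f (Suc n) (F * J + Q * m ^ 2) (m * (1 + 0 * F + F * (Q * m) * R))"
      using coprime_state_exists[OF f _ _ _ _ st] by (auto simp: P_Q_F_def simp del: poly_iterate_Suc)
    moreover have "m * (1 + 0 * F + F * (Q * m) * R) + (F * J + Q * m ^ 2) = orbit_prod f (Suc n) * (w + m ^ 2 * R)"
      unfolding orbit_prod.simps P_Q_F_def[symmetric] using F J by algebra
    ultimately show ?case by (metis dvd_triv_left)
  qed
  then show ?thesis by blast
qed

text \<open>The middle terms of \<open>orbit_step_identity\<close> all vanish, leaving J/Q + 1/(Q
  F)^2, a fold. The criterion reaches two terms ahead, so two consecutive sums are carried
  along.\<close>

lemma pX_cong_6:
  assumes deg: "0 < degree f" and f: "f = 1 + (0 - 1) * pX + pX ^ 2 * (1 + (- 1) * (pX - 1) + (pX - 1) ^ 2 * r)"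
  shows "finite_cf (orbit_sum f n)"
proof -
  have "\<exists>J m. coprime_state f n J m \<and> finite_cf (orbit_sum f n) \<and> finite_cf (orbit_sum f (Suc n))"
  proof (induction n)
    case 0
    show ?case using coprime_state_0[of f] orbit_sum_1[of f] by auto
  next
    case (Suc n)
    then obtain J m where st: "coprime_state f n J m" 
      and fin: "finite_cf (orbit_sum f n)" "finite_cf (orbit_sum f (Suc n))" by blast
    define P Q F where "P = orbit_num f n" "Q = orbit_prod f n" "F = poly_iterate f n"
    have Q: "Q \<noteq> 0" using deg by (simp add: P_Q_F_def orbit_prod_nonzero)
    have PJ: "Q dvd P * J - 1" using st by (simp_all add: coprime_state_def P_Q_F_def)
    have finP: "finite_cf (L P / L Q)" using fin deg by (simp add: orbit_sum_eq P_Q_F_def)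
    have "finite_cf (L J / L Q + 1 / (L Q ^ 2 * L (F ^ 2)))"
      using finite_cf_transport(2)[OF Q finP PJ] PJ by (intro finite_cf_fold[of Q J P] Q) (simp_all add: mult.commute)
    then have "finite_cf (orbit_sum f (Suc (Suc n)))"
      using finite_cf_orbit_step[OF f _ _ _ deg st fin(2)] by (simp add: P_Q_F_def power_mult_distrib del: orbit_sum_Suc)
    moreover obtain R where "coprime_state f (Suc n) (F * J + Q * m ^ 2) (m * (1 + (- 1) * F + F * (Q * m) * R))"
      using coprime_state_exists[OF f _ _ _ _ st] by (auto simp: P_Q_F_def simp del: poly_iterate_Suc)
    ultimately show ?case using fin by blast
  qed
  then show ?thesis by blast
qed

text \<open>Read backwards, the criterion is J/q + 1/eta with eta = q^2 a^2/(a^2 - a + 1). Transport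
  gives P/q + 1 + (a - 1)/(a^2 - a + 1), then a/q^2 + J/q + 1/(q^2 (a - 1)). This perturbs the
  transported form of the preceding sum; a last transport, now with denominator q^2, ends in a fold
  up to sign.\<close>

lemma pX_cong_7:
  assumes deg: "0 < degree f" and f: "f = 1 + (- 1 - 1) * pX + pX ^ 2 * (2 + (- 1) * (pX - 1) + (pX - 1) ^ 2 * r)"
  shows "finite_cf (orbit_sum f n)"
proof -
  have "\<exists>J m. coprime_state f n J m \<and> finite_cf (orbit_sum f n) \<and> finite_cf (orbit_sum f (Suc n))"
  proof (induction n)
    case 0
    show ?case using coprime_state_0[of f] orbit_sum_1[of f] by auto
  next
    case (Suc n)
    then obtain J m where st: "coprime_state f n J m" 
      and fin: "finite_cf (orbit_sum f n)" "finite_cf (orbit_sum f (Suc n))" by blast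
    define P Q F where "P = orbit_num f n" "Q = orbit_prod f n" "F = poly_iterate f n"
    have Q: "Q \<noteq> 0" using deg by (simp add: P_Q_F_def orbit_prod_nonzero)
    have F: "F = 1 + Q * m" and PJ: "Q dvd P * J - 1" using st by (simp_all add: coprime_state_def P_Q_F_def)
    then have JP: "Q dvd J * P - 1" by (simp add: mult.commute)
    have "0 < degree F" using deg by (simp add: P_Q_F_def degree_poly_iterate)
    then have F1: "F \<noteq> 1" "F \<noteq> 0" by auto
    have F2: "F ^ 2 - F + 1 \<noteq> 0"
    proof
      assume "F ^ 2 - F + 1 = 0"
      then have "F * (1 - F) = 1" by (simp add: algebra_simps power2_eq_square)
      then have "is_unit F" by (metis dvd_triv_left)
      then show False using \<open>0 < degree F\<close> by (metis is_unit_polyE degree_pCons_0 less_irrefl)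
    qed
    define q a where "q = L Q" and "a = L F"
    have nz: "q \<noteq> 0" "a \<noteq> 0" "a - 1 \<noteq> 0" "a ^ 2 - a + 1 \<noteq> 0"
    proof -
      have "L (F - 1) \<noteq> 0" "L (F ^ 2 - F + 1) \<noteq> 0" using F1 F2 by (simp_all del: L_diff L_add)
      then show "q \<noteq> 0" "a \<noteq> 0" "a - 1 \<noteq> 0" "a ^ 2 - a + 1 \<noteq> 0" using Q F1 by (simp_all add: q_def a_def)
    qed
    have m: "L m = (a - 1) / q" using nz by (simp add: a_def q_def F)
    have finP: "finite_cf (L P / q)" using fin deg by (simp add: orbit_sum_eq P_Q_F_def q_def)
    have finJ: "finite_cf (L J / q)" unfolding q_def by (rule finite_cf_transport(2)[OF Q finP[unfolded q_def] PJ])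
    have W: "finite_cf (L (F + J * Q) / L (Q ^ 2))"
    proof -
      have "finite_cf (a / q ^ 2 + L J / q)" 
        using finite_cf_orbit_sum_Suc[OF deg PJ[unfolded P_Q_F_def] fin(1)] fin(2) by (simp add: P_Q_F_def a_def q_def)
      moreover have "a / q ^ 2 + L J / q = L (F + J * Q) / L (Q ^ 2)"
        using nz by (simp add: a_def q_def field_simps power2_eq_square)
      ultimately show ?thesis by simp
    qed
    \<comment> \<open>As F + J Q = 1 + (m + J) Q, the factor 1 - (m + J) Q inverts it modulo
      Q^2.\<close>
    have dvd2: "Q ^ 2 dvd (F + J * Q) * (1 - (m + J) * Q) - 1"
    proof -
      have "(F + J * Q) * (1 - (m + J) * Q) - 1 = Q ^ 2 * (- ((m + J) ^ 2))" using F by algebra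
      then show ?thesis by simp
    qed
    have "finite_cf (L J / q + 1 / (q ^ 2 * L (- 1)))"
      unfolding q_def by (rule finite_cf_fold[OF Q finJ[unfolded q_def] JP])
    then have "finite_cf (- (L J / q + 1 / (q ^ 2 * L (- 1))))" by (simp only: finite_cf_minus_iff)
    moreover have "q ^ 2 * (a - 1) / L (Q ^ 2) ^ 2 + L (1 - (m + J) * Q) / L (Q ^ 2) = - (L J / q + 1 / (q ^ 2 * L (- 1)))"
      using nz by (simp add: m flip: q_def) (simp add: field_simps power2_eq_square power4_eq_xxxx)
    ultimately have "finite_cf (q ^ 2 * (a - 1) / L (Q ^ 2) ^ 2 + L (1 - (m + J) * Q) / L (Q ^ 2))" by simp
    then have "finite_cf (L (F + J * Q) / L (Q ^ 2) + 1 / (q ^ 2 * (a - 1)))"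
      using finite_cf_transport(1)[OF _ W dvd2] Q by simp
    moreover have "L (F + J * Q) / L (Q ^ 2) + 1 / (q ^ 2 * (a - 1)) = ((a ^ 2 - a + 1) / (a - 1)) / q ^ 2 + L J / q"
      using nz by (simp flip: q_def a_def) (simp add: field_simps power2_eq_square)
    ultimately have "finite_cf (((a ^ 2 - a + 1) / (a - 1)) / q ^ 2 + L J / q)" by simp
    then have "finite_cf (L P / q + 1 / ((a ^ 2 - a + 1) / (a - 1)))"
      unfolding q_def using finite_cf_transport(1)[OF Q finP[unfolded q_def] PJ] by blast
    then have "finite_cf (L P / q + 1 / ((a ^ 2 - a + 1) / (a - 1)) + L 1)" by (simp only: finite_cf_add_iff)
    moreover have "L P / q + 1 / ((a ^ 2 - a + 1) / (a - 1)) + L 1 = (q ^ 2 * a ^ 2 / (a ^ 2 - a + 1)) / q ^ 2 + L P / q"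
    proof -
      define D where "D = a ^ 2 - a + 1"
      have "D \<noteq> 0" and a2: "a ^ 2 = (a - 1) + D" using nz by (simp_all add: D_def)
      then have "1 / (D / (a - 1)) + 1 = a ^ 2 / D" by (simp add: add_divide_distrib)
      then show ?thesis using nz by (simp add: D_def)
    qed
    ultimately have "finite_cf ((q ^ 2 * a ^ 2 / (a ^ 2 - a + 1)) / q ^ 2 + L P / q)" by (simp only:)
    then have "finite_cf (L J / q + 1 / (q ^ 2 * a ^ 2 / (a ^ 2 - a + 1)))"
      unfolding q_def using finite_cf_transport(1)[OF Q finJ[unfolded q_def] JP] by blast
    moreover have "L J / q + 1 / (q ^ 2 * a ^ 2 / (a ^ 2 - a + 1)) = L J / q + (1 + L (- 1)) * L m / q +
      (L 2 - 1) / q ^ 2 + L (- 1) / (q ^ 2 * a) + 1 / (q * a) ^ 2"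
      using nz by (simp add: field_simps power2_eq_square)
    moreover have "finite_cf (orbit_sum f (Suc (Suc n))) \<longleftrightarrow> finite_cf (L J / q + (1 + L (- 1)) * L m / q +
      (L 2 - 1) / q ^ 2 + L (- 1) / (q ^ 2 * a) + 1 / (q * a) ^ 2)"
      unfolding q_def a_def P_Q_F_def by (rule finite_cf_orbit_step[OF f _ _ _ deg st fin(2)]) simp_all
    ultimately have "finite_cf (orbit_sum f (Suc (Suc n)))" by (simp only:)
    moreover obtain R where "coprime_state f (Suc n) (F * J + Q * m ^ 2) (m * (2 + (- 1) * F + F * (Q * m) * R))"
      using coprime_state_exists[OF f _ _ _ _ st] by (auto simp: P_Q_F_def simp del: poly_iterate_Suc)
    ultimately show ?case using fin by blast
  qed
  then show ?thesis by blast
qed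

section \<open>Sufficiency: f(0) = 0\<close>

text \<open>Each iterate is a multiple of the square of the preceding one, so the last iterate is a
  denominator of the partial sum and every new term is a single fold.\<close>

lemma pX_cong_1:
  assumes deg: "1 < degree f" and f: "f = pX ^ 2 * g"
  shows "finite_cf (orbit_sum f (Suc n))"
proof -
  have "\<exists>P J. orbit_sum f (Suc n) = L P / L (poly_iterate f n) \<and> poly_iterate f n dvd P * J - 1 \<and> finite_cf (orbit_sum f (Suc n))"
  proof (induction n)
    case 0
    show ?case using finite_cf_one_divide_iff[of "L pX"] by (intro exI[of _ 1]) simp
  next
    case (Suc n)
    then obtain P J where IH: "orbit_sum f (Suc n) = L P / L (poly_iterate f n)" "poly_iterate f n dvd P * J - 1"
      "finite_cf (orbit_sum f (Suc n))" by blast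
    define Q where "Q = poly_iterate f n"
    have pc: "pcompose f h = h ^ 2 * pcompose g h" for h
      unfolding f by (simp add: pcompose_mult pcompose_pCons power2_eq_square)
    have F: "poly_iterate f (Suc n) = Q ^ 2 * pcompose g Q" by (simp add: pc Q_def)
    have nz: "Q \<noteq> 0" "pcompose g Q \<noteq> 0"
      using poly_iterate_nonzero[of f n] poly_iterate_nonzero[of f "Suc n"] deg F by (auto simp: Q_def)
    have "finite_cf (L P / L Q + 1 / (L Q ^ 2 * L (pcompose g Q)))"
      using IH nz by (intro finite_cf_fold[of _ _ J]) (simp_all add: Q_def)
    moreover have eq: "orbit_sum f (Suc (Suc n)) = L P / L Q + 1 / (L Q ^ 2 * L (pcompose g Q))"
      using IH(1) F by (subst orbit_sum_Suc) (simp add: Q_def del: poly_iterate_Suc orbit_sum_Suc)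
    moreover have "L P / L Q + 1 / (L Q ^ 2 * L (pcompose g Q)) = L (P * Q * pcompose g Q + 1) / L (poly_iterate f (Suc n))"
      unfolding F using nz by (simp add: field_simps power2_eq_square)
    \<comment> \<open>The new numerator is 1 + u, where u^2 is divisible by the new denominator;
      hence 1 - u inverts it.\<close>
    moreover have "(P * Q * pcompose g Q + 1) * (1 - P * Q * pcompose g Q) - 1 = poly_iterate f (Suc n) * (- (P ^ 2 * pcompose g Q))"
      unfolding F by algebra
    ultimately show ?case by (metis dvd_triv_left)
  qed
  then show ?thesis by blast
qed

text \<open>Two terms are added at once: 1/y1 + 1/(y1 a) = b/a for a = y1 b - 1. The cofactor
  \<open>E\<close> of \<open>q\<close> in the iterate is also the inverse of \<open>P\<close> modulo
  \<open>q\<close>, so the terms E/q cancel after transport and - 1/(b q^2) remains, up to a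
  polynomial.\<close>

lemma pX_cong_2:
  assumes deg: "1 < degree f" and f: "f = - pX + pX ^ 2 * g"
  shows "finite_cf (orbit_sum f (Suc (2 * n)))"
proof -
  have "\<exists>P q E. orbit_sum f (Suc (2 * n)) = L P / L q \<and> poly_iterate f (2 * n) = q * E \<and> q dvd P * E - 1 \<and>
    finite_cf (orbit_sum f (Suc (2 * n)))"
  proof (induction n)
    case 0
    show ?case using finite_cf_one_divide_iff[of "L pX"] 
      by (intro exI[of _ 1] exI[of _ pX]) simp
  next
    case (Suc n)
    then obtain P q E where IH: "orbit_sum f (Suc (2 * n)) = L P / L q" "poly_iterate f (2 * n) = q * E"
      "q dvd P * E - 1" "finite_cf (orbit_sum f (Suc (2 * n)))" by blast
    define y y1 where "y = poly_iterate f (2 * n)" and "y1 = poly_iterate f (Suc (2 * n))"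
    define g0 b where "g0 = pcompose g y" and "b = pcompose g y1"
    define a where "a = y1 * b - 1"
    have pc: "pcompose f h = h * (h * pcompose g h - 1)" for h
      unfolding f by (simp add: pcompose_mult pcompose_pCons pcompose_add pcompose_uminus power2_eq_square algebra_simps)
    have y1: "y1 = y * (y * g0 - 1)" unfolding y1_def g0_def by (simp add: pc y_def)
    have y2: "poly_iterate f (Suc (Suc (2 * n))) = y1 * a"
    proof -
      have "poly_iterate f (Suc (Suc (2 * n))) = pcompose f y1" unfolding y1_def by (rule poly_iterate_Suc)
      then show ?thesis by (simp only: pc a_def b_def)
    qed
    have "y1 \<noteq> 0" "y1 * a \<noteq> 0" "y \<noteq> 0"
      using deg poly_iterate_nonzero[of f "Suc (2 * n)"] poly_iterate_nonzero[of f "Suc (Suc (2 * n))"]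
        poly_iterate_nonzero[of f "2 * n"]
      unfolding y2 y1_def[symmetric] y_def[symmetric] by simp_all
    then have nz: "y1 \<noteq> 0" "a \<noteq> 0" "q \<noteq> 0" "E \<noteq> 0" using IH(2) by (auto simp: y_def)
    have b: "b \<noteq> 0"
    proof
      assume "b = 0"
      then have "degree (poly_iterate f (Suc (Suc (2 * n)))) = degree y1" unfolding y2 by (simp add: a_def)
      then show False using deg unfolding y1_def degree_poly_iterate by simp
    qed
    from IH(3) obtain k where k: "P * E - 1 = q * k" by (elim dvdE)
    have yqE: "y = q * E" using IH(2) by (simp add: y_def)
    have nz': "L y1 \<noteq> 0" "L a \<noteq> 0" "L q \<noteq> 0" "L E \<noteq> 0" "L b \<noteq> 0" using nz b by simp_all
    have La: "L a = L y1 * L b - 1" and Ly1: "L y1 = L q * L E * (L q * L E * L g0 - 1)"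
      by (simp_all add: a_def y1 yqE)
    have "orbit_sum f (Suc (2 * Suc n)) = L P / L q + (1 / L y1 + 1 / (L y1 * L a))"
      using IH(1) y2 by (simp add: y1_def del: poly_iterate_Suc)
    also have "1 / L y1 + 1 / (L y1 * L a) = (L a + 1) / (L y1 * L a)" using nz' by (simp add: field_simps)
    also have "\<dots> = L b / L a" using nz' by (simp add: La)
    finally have sum: "orbit_sum f (Suc (2 * Suc n)) = L P / L q + L b / L a" .
    have "(L a / L b) / L q ^ 2 + L E / L q = - (1 / (L (b * q ^ 2))) + L (E ^ 2 * g0)"
      using nz' unfolding La Ly1 by (simp add: field_simps power2_eq_square)
    then have "finite_cf ((L a / L b) / L q ^ 2 + L E / L q)"
      by (simp only: finite_cf_add_iff finite_cf_minus_iff finite_cf_one_divide_iff finite_cf_L)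
    moreover have "finite_cf (L P / L q)" using IH(4) unfolding IH(1) .
    ultimately have "finite_cf (L P / L q + 1 / (L a / L b))"
      using finite_cf_transport(1)[OF nz(3) _ IH(3)] by blast
    then have fin: "finite_cf (orbit_sum f (Suc (2 * Suc n)))" unfolding sum by simp
    have frac: "L P / L q + L b / L a = L (P * a + q * b) / L (q * a)"
      using nz' by (simp add: field_simps)
    have it: "poly_iterate f (2 * Suc n) = (q * a) * (E * (y * g0 - 1))"
      using y2 y1 yqE by (simp del: poly_iterate_Suc add: mult.assoc mult.left_commute)
    have inv: "q * a dvd (P * a + q * b) * (E * (y * g0 - 1)) - 1"
    proof -
      define X where "X = (P * a + q * b) * (E * (y * g0 - 1)) - 1"
      have Xa: "X = a * (1 + P * (E * (y * g0 - 1)))"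
        unfolding X_def a_def using y1 yqE by algebra
      have Xq: "X = q * (P * E * E * (y * g0 - 1) ^ 2 * b - P * E * E * g0 + k + b * E * (y * g0 - 1))"
        unfolding X_def a_def using y1 yqE k by algebra
      \<comment> \<open>\<open>X\<close> is divisible by \<open>a\<close> and by \<open>q\<close>.
        As q divides y1, the relation y1 b - a = 1 makes them coprime and combines the two.\<close>
      have "X = X * (y1 * b - a)" by (simp add: a_def)
      also have "\<dots> = (q * a) * ((1 + P * (E * (y * g0 - 1))) * (E * (y * g0 - 1)) * b
         - (P * E * E * (y * g0 - 1) ^ 2 * b - P * E * E * g0 + k + b * E * (y * g0 - 1)))"
        using Xa Xq y1 yqE by algebra
      finally show ?thesis by (metis X_def dvd_triv_left)
    qed
    show ?case by (intro exI conjI) (rule trans[OF sum frac], rule it, rule inv, rule fin)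
  qed
  then show ?thesis by blast
qed

section \<open>Sufficiency: the cycle 0, 1\<close>

text \<open>In the following lemmas a, b, c, d are consecutive iterates of f, where f maps 1 to 0, so that each divides
  1 minus the next one and its square divides the next but one. The polynomials p in numerators are those of partial sums
  with denominators that are products of two consecutive iterates.\<close>

lemma inverse_12:
  fixes a b c :: "int poly"
  assumes c: "c = a ^ 2 * c'" "c = 1 + b * j" and b: "b = 1 + a * ja" "b = a0 ^ 2 * b'" and j: "j = - 2 + b * s"
  shows "b * c dvd ((p0 * a0 * b' + a) * a * c' + b) * (- ((p0 * a0 * b' + a) * a * c' + j)) - 1"
proof -
  \<comment> \<open>Divisibility by \<open>b\<close> and by \<open>c\<close> is shown separately and
    combined by c - b j = 1. Modulo b, where c = 1 and j = -2, X reduces to - k^2, a multiple of b.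
    Modulo c it is used that b + j is a multiple of a and c = a^2 c'.\<close>
  define p k X where "p = p0 * a0 * b' + a" and "k = p0 * a0 * b' * a * c'" and
    "X = (p * a * c' + b) * (- (p * a * c' + j)) - 1"
  have pk: "p * a * c' = k + c" unfolding p_def k_def c(1) by algebra
  have kk: "k * k = b * (p0 ^ 2 * b' * a ^ 2 * c' ^ 2)" unfolding k_def b(2) by algebra
  have "X = - (k * k) - b * ((k + 1) * (j + s) + (j + 1) * (k - 1) + b * (j + 1) * (j + s))"
    unfolding X_def pk using c(2) j by algebra
  then have Xb: "X = b * (- (p0 ^ 2 * b' * a ^ 2 * c' ^ 2) - ((k + 1) * (j + s) + (j + 1) * (k - 1) + b * (j + 1) * (j + s)))"
    (is "X = b * ?u") unfolding kk by algebra
  have "b + j = a * (ja + a * c' - ja * j)" using c b(1) by algebra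
  then have Xc: "X = c * (- (p ^ 2 * c') - p * (ja + a * c' - ja * j) - 1)" (is "X = c * ?v")
    unfolding X_def using c by algebra
  have "X = X * (c - b * j)" using c(2) by algebra
  also have "\<dots> = b * c * (?u - j * ?v)" using Xb Xc by algebra
  finally show ?thesis unfolding X_def p_def by (metis dvd_triv_left)
qed

text \<open>In the product, the terms other than \<open>k * (b + c + j)\<close> are visibly
  multiples of b c. For this one, b + c + j is divisible by a0 and by a, which are coprime; the
  factor a0 a completes \<open>k\<close> to a multiple of b c.\<close>

lemma inverse_5:
  fixes a b c :: "int poly"
  assumes c: "c = a ^ 2 * c'" "c = 1 + b * j" and b: "b = 1 + a * ja" "b = a0 ^ 2 * b'" 
    and a: "a = 1 + a0 * j0" and j: "j = - 1 + b * s"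
  shows "b * c dvd ((p0 * a0 * b' + a) * a * c' + b) * (- (p0 * a0 * b' * a * c' + j)) - 1"
proof -
  define k X where "k = p0 * a0 * b' * a * c'" and
    "X = ((p0 * a0 * b' + a) * a * c' + b) * (- (p0 * a0 * b' * a * c' + j)) - 1"
  define u v where "u = a0 * b' * (1 + j + s)" and "v = ja + a * c' - ja * j + a * c'"
  have pk: "(p0 * a0 * b' + a) * a * c' = k + c" unfolding k_def c(1) by algebra
  have kk: "k * k = b * c * (p0 ^ 2 * b' * c')" unfolding k_def b(2) c(1) by algebra
  have X: "X = - (k * k) - k * (b + c + j) - b * c * s"
    unfolding X_def pk k_def[symmetric] using c(2) j by algebra
  have yu: "b + c + j = a0 * u" unfolding u_def using c(2) j b(2) by algebra
  have yv: "b + c + j = a * v" unfolding v_def using c b(1) by algebra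
  have "b + c + j = (b + c + j) * (a - a0 * j0)" using a by algebra
  also have "\<dots> = a0 * a * (u - v * j0)" using yu yv by algebra
  finally have y: "b + c + j = a0 * a * (u - v * j0)" .
  have "k * (a0 * a * w) = b * c * (p0 * w)" for w unfolding k_def b(2) c(1) by algebra
  then have "k * (b + c + j) = b * c * (p0 * (u - v * j0))" unfolding y by blast
  then have "X = b * c * (- (p0 ^ 2 * b' * c') - p0 * (u - v * j0) - s)" unfolding X kk by algebra
  then show ?thesis unfolding X_def by (metis dvd_triv_left)
qed

text \<open>A chain of four transports, each up to sign and an added polynomial. The fraction for
  the next sum becomes a perturbation of p1/(a b), then of p0/(a0 a), then of J0/(a0 a), and finally
  the unperturbed J1/(a b), which is finite because p1/(a b) is.\<close>

lemma identity_12: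
  fixes a b c :: "'a::field"
  assumes nz: "a \<noteq> 0" "b \<noteq> 0" "c \<noteq> 0" "a0 \<noteq> 0" "j \<noteq> 0" "1 + j \<noteq> 0"
    and c: "c = a ^ 2 * c'" "c = 1 + b * j" and b: "b = 1 + a * ja" "b = a0 ^ 2 * b'"
    and j: "j = - 2 + b * (1 + (b - 1) ^ 2 * r)" and p1: "p1 = p0 * a0 * b' + a"
  shows "b ^ 2 * j ^ 2 * (1 + c ^ 2 * R) / (b * c) ^ 2 + (- (p1 * a * c' + j)) / (b * c) =
      - (p1 / (a * b) + 1 / (b * c ^ 2 / j)) + j ^ 2 * R" (is ?A)
    and "b * c ^ 2 / j / (a * b) ^ 2 + (- (p0 * a0 * b' + ja)) / (a * b) =
      - (p0 / (a0 * a) + 1 / (- (j * a ^ 2 * b) / (1 + j))) + c'" (is ?B)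
    and "- (j * a ^ 2 * b) / (1 + j) / (a0 * a) ^ 2 + J0 / (a0 * a) = (J0 / (a0 * a) + 1 / ((1 + j) / b')) - b'" (is ?C)
    and "(1 + j) / b' / (a0 * a) ^ 2 + p0 / (a0 * a) = - ((- (p0 * a0 * b' + ja)) / (a * b)) + ja ^ 2 * r" (is ?D)
proof -
  have jj: "j = (c - 1) / b" and cc: "c' = c / a ^ 2" and bb: "b' = b / a0 ^ 2" and jja: "ja = (b - 1) / a"
    using nz c b by (simp_all add: field_simps)
  show ?A unfolding jj cc using nz by (simp add: divide_simps) algebra
  have "c ^ 2 = 1 + b * j * (1 + c)" using c(2) by algebra
  then have "b * c ^ 2 / j / (a * b) ^ 2 = (1 + b * j * (1 + a ^ 2 * c')) / (j * a ^ 2 * b)"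
    using nz c(1) by (simp add: field_simps power2_eq_square)
  then show ?B unfolding bb jja using nz by (simp add: divide_simps) algebra
  have "1 / ((1 + j) / b') = b' / (1 + j)" by simp
  then show ?C unfolding bb using nz by (simp add: divide_simps) algebra
  have "1 + j = - 1 + b * (1 + (a * ja) ^ 2 * r)" using j b(1) by algebra
  then show ?D unfolding bb using nz by (simp add: divide_simps) (use b(1) in algebra)
qed

text \<open>As in \<open>identity_12\<close>, but the inverse of each numerator involves the sum one
  index earlier. The chain therefore passes from p1/(a b) to p00/(a00 a0), two terms shorter, and to
  its inverse J00 before it ends at J1/(a b).\<close>

lemma identity_5:
  fixes a b c :: "'a::field"
  assumes nz: "a \<noteq> 0" "b \<noteq> 0" "c \<noteq> 0" "a0 \<noteq> 0" "a00 \<noteq> 0" "j \<noteq> 0" "1 + c \<noteq> 0" "t \<noteq> 0"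
    and c: "c = a ^ 2 * c'" "c = 1 + b * j" and b: "b = 1 + a * ja" "b = a0 ^ 2 * b'" and a: "a = a00 ^ 2 * a'"
    and j: "j = - 1 + b * s" "s = - 1 + b + (b - 1) ^ 2 * r" and p1: "p1 = p0 * a0 * b' + a"
    and t: "t = 1 + j * (1 + c)" and J1: "J1 = - (p00 * a00 * a' * a0 * b' + ja)"
  shows "b ^ 2 * j ^ 2 * (1 + c + c ^ 2 * R) / (b * c) ^ 2 + (- (p0 * a0 * b' * a * c' + j)) / (b * c) =
      - (p1 / (a * b) + 1 / (b * c ^ 2 / (j * (1 + c)))) + (s + j ^ 2 * R)" (is ?A)
    and "b * c ^ 2 / (j * (1 + c)) / (a * b) ^ 2 + J1 / (a * b) =
      - (p00 / (a00 * a0) + 1 / (- (j * (1 + c) * a ^ 2 * b) / t))" (is ?B)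
    and "- (j * (1 + c) * a ^ 2 * b) / t / (a00 * a0) ^ 2 + J00 / (a00 * a0) =
      (J00 / (a00 * a0) + 1 / (t * (a00 * a0) ^ 2 / (a ^ 2 * b))) - a00 ^ 2 * a' ^ 2 * b'" (is ?C)
    and "t * (a00 * a0) ^ 2 / (a ^ 2 * b) / (a00 * a0) ^ 2 + p00 / (a00 * a0) =
      - (J1 / (a * b)) + ja ^ 2 * (b ^ 2 - 2 + 2 * r + 2 * (- 1 - b + b ^ 2) * b * r + (b * (b - 1) * r) ^ 2)" (is ?D)
proof -
  have jj: "j = (c - 1) / b" and cc: "c' = c / a ^ 2" and bb: "b' = b / a0 ^ 2" and jja: "ja = (b - 1) / a"
    and aa: "a' = a / a00 ^ 2"
    using nz c b a by (simp_all add: field_simps)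
  have e: "(1 + j) / b = s" using nz j(1) by simp
  have "b ^ 2 * j ^ 2 * (1 + c + c ^ 2 * R) / (b * c) ^ 2 + (- (p0 * a0 * b' * a * c' + j)) / (b * c) =
      - (p1 / (a * b) + 1 / (b * c ^ 2 / (j * (1 + c)))) + ((1 + j) / b + j ^ 2 * R)"
    unfolding p1 jj cc bb using nz by (simp add: divide_simps) algebra
  then show ?A unfolding e .
  have J1': "J1 / (a * b) = - (p00 / (a00 * a0)) - (b - 1) / (a ^ 2 * b)"
    unfolding J1 aa bb jja using nz by (simp add: divide_simps) algebra
  have c2: "b * c ^ 2 / (j * (1 + c)) / (a * b) ^ 2 = (b * j * (1 + c) + 1) / (j * (1 + c) * a ^ 2 * b)"
  proof -
    have "b * j * (1 + c) + 1 = c ^ 2" using c(2) by algebra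
    then show ?thesis using nz by (simp add: power2_eq_square)
  qed
  have "b * j * (1 + c) + 1 = j * (1 + c) * (b - 1) + t" unfolding t by algebra
  then have "b * c ^ 2 / (j * (1 + c)) / (a * b) ^ 2 = (b - 1) / (a ^ 2 * b) + t / (j * (1 + c) * a ^ 2 * b)"
    unfolding c2 using nz by (simp add: add_divide_distrib)
  then show ?B unfolding J1' by simp
  have "- (j * (1 + c) * a ^ 2 * b) = (1 - t) * a ^ 2 * b" unfolding t by algebra
  moreover have "a00 ^ 2 * a' ^ 2 * b' = a ^ 2 * b / (a00 * a0) ^ 2"
    unfolding a b(2) using nz by (simp add: power2_eq_square)
  moreover have "(1 - t) * a ^ 2 * b / t / q ^ 2 + J00 / q = J00 / q + 1 / (t * q ^ 2 / (a ^ 2 * b)) - a ^ 2 * b / q ^ 2"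
    if "q \<noteq> 0" for q using nz that by (simp add: field_simps)
  ultimately show ?C using nz by simp
  \<comment> \<open>Expanding t in b shows that t - (b - 1) is divisible by b (b - 1)^2; the long
    factor is the quotient.\<close>
  have "t = (b - 1) + b * (a * ja) ^ 2 * (b ^ 2 - 2 + 2 * r + 2 * (- 1 - b + b ^ 2) * b * r + (b * (b - 1) * r) ^ 2)"
    (is "t = _ + b * (a * ja) ^ 2 * ?R")
  proof -
    have "a * ja = b - 1" using b(1) by algebra
    then show ?thesis unfolding t c(2) j by algebra
  qed
  then have "t / (a ^ 2 * b) = (b - 1) / (a ^ 2 * b) + ja ^ 2 * ?R"
    using nz by (simp add: field_simps power2_eq_square)
  then show ?D unfolding J1' using nz by simp
qed

lemma finite_cf_orbit_sum_2:
  assumes "0 < degree f"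
  shows "finite_cf (orbit_sum f 2) \<longleftrightarrow> finite_cf (L (f + pX) / L (pX ^ 2))"
proof -
  have "finite_cf (orbit_sum f 2) \<longleftrightarrow> finite_cf (L f / L pX ^ 2 + L 1 / L pX)"
    using finite_cf_orbit_sum_Suc[OF assms, of "Suc 0" 1] orbit_sum_1[of f] by (simp add: numeral_2_eq_2 pcompose_idR)
  also have "L f / L pX ^ 2 + L 1 / L pX = L (f + pX) / L (pX ^ 2)"
    by (simp only: power2_eq_square L_mult L_add L_1) (simp add: field_simps)
  finally show ?thesis .
qed

lemma finite_cf_divide_add:
  "finite_cf ((s + t * L b) / t) \<longleftrightarrow> finite_cf (s / t)"
  by (cases "t = 0") (simp_all add: add_divide_distrib)

lemma orbit_sum_combine:
  assumes "orbit_sum f n = L p / L (a0 * a)" "b = poly_iterate f n" "b = a0 ^ 2 * b'" "b \<noteq> 0" "a \<noteq> 0"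
  shows "orbit_sum f (Suc n) = L (p * a0 * b' + a) / L (a * b)"
  using assms(4,5) unfolding orbit_sum_Suc assms(1) assms(2)[symmetric] assms(3)
  by (simp add: field_simps power2_eq_square)

lemma poly_iterate_not_unit: "0 < degree f \<Longrightarrow> \<not> is_unit (poly_iterate f n)"
  by (metis degree_poly_iterate is_unit_polyE degree_pCons_0 less_irrefl zero_less_power)

text \<open>The chain of \<open>identity_12\<close> is run from its end, where finiteness is known.
  The sum with n + 3 terms draws on those with n, n + 1 and n + 2 terms, so the induction carries
  all three.\<close>

lemma pX_cong_12:
  assumes deg: "0 < degree f" and f: "f = (pX - 1) ^ 2 * (1 + pX ^ 2 * r)"
  shows "finite_cf (orbit_sum f n)"
proof -
  define jp where "jp = - 2 + pX * (1 + (pX - 1) ^ 2 * r)"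
  have fj: "f = 1 + pX * jp" unfolding f jp_def by algebra
  have pc1: "pcompose f h = 1 + h * pcompose jp h" for h
    unfolding fj by (simp add: pcompose_add pcompose_mult pcompose_1 pcompose_pCons)
  have pcj: "pcompose jp h = - 2 + h * (1 + (h - 1) ^ 2 * pcompose r h)" for h
  proof -
    have "pcompose 2 h = (2 :: int poly)" by (simp add: numeral_poly pcompose_const)
    then show ?thesis
      unfolding jp_def by (simp add: pcompose_add pcompose_diff pcompose_uminus pcompose_mult pcompose_1 pcompose_pCons power2_eq_square)
  qed
  have pc2: "pcompose f h = (h - 1) ^ 2 * (1 + h ^ 2 * pcompose r h)" for h
    unfolding f by (simp add: pcompose_add pcompose_diff pcompose_mult pcompose_1 pcompose_pCons power2_eq_square)
  have nu: "\<not> is_unit (poly_iterate f n)" for n using deg by (rule poly_iterate_not_unit)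
  have "\<exists>a0 a b' ja p0 J0 c'. poly_iterate f n = a0 ^ 2 * b' \<and> poly_iterate f n = 1 + a * ja \<and>
    poly_iterate f (Suc n) = a ^ 2 * c' \<and> orbit_sum f n = L p0 / L (a0 * a) \<and> a0 * a dvd p0 * J0 - 1 \<and> a0 \<noteq> 0 \<and> a \<noteq> 0 \<and>
    a * poly_iterate f n dvd (p0 * a0 * b' + a) * (- (p0 * a0 * b' + ja)) - 1 \<and>
    finite_cf (orbit_sum f n) \<and> finite_cf (orbit_sum f (Suc n)) \<and> finite_cf (orbit_sum f (Suc (Suc n)))"
  proof (induction n)
    case 0
    have "reducible ((- pX - 1) * (1 - pX) + 1) (1 - pX)"
      using reducible_add_iff[of 1 "- pX - 1" "1 - pX"] finite_cf_L[of "1 - pX"] finite_cf_iff[of 1 "1 - pX"]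
      by (simp add: add.commute reducible_swap_iff)
    also have "(- pX - 1) * (1 - pX) + 1 = pX ^ 2" by algebra
    finally have "finite_cf (L (1 - pX) / L (pX ^ 2))" 
      by (subst finite_cf_iff) (simp_all add: reducible_swap_iff)
    moreover have "f + pX = (1 - pX) + pX ^ 2 * (1 + (pX - 1) ^ 2 * r)" unfolding f by algebra
    then have "L (f + pX) = L (1 - pX) + L (pX ^ 2) * L (1 + (pX - 1) ^ 2 * r)" by (metis L_add L_mult)
    ultimately have "finite_cf (orbit_sum f 2)"
      unfolding finite_cf_orbit_sum_2[OF deg] by (simp only: finite_cf_divide_add)
    then have fin: "finite_cf (orbit_sum f (Suc (Suc 0)))" by (simp only: numeral_2_eq_2)
    have "poly_iterate f (Suc 0) = 1 ^ 2 * f" by (simp add: pcompose_idR)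
    moreover have "1 * poly_iterate f 0 dvd (0 * 1 * pX + 1) * (- (0 * 1 * pX + (pX - 1))) - 1"
      by (rule dvdI[of _ _ "- 1"]) simp
    moreover have "poly_iterate f 0 = 1 ^ 2 * pX" "poly_iterate f 0 = 1 + 1 * (pX - 1)" by simp_all
    moreover have "orbit_sum f 0 = L 0 / L (1 * 1)" "1 * 1 dvd 0 * 0 - (1 :: int poly)" "finite_cf (orbit_sum f 0)" by simp_all
    ultimately show ?case using fin orbit_sum_1[of f] one_neq_zero by blast
  next
    case (Suc n)
    define b c d where "b = poly_iterate f n" and "c = poly_iterate f (Suc n)" and "d = poly_iterate f (Suc (Suc n))"
    from Suc obtain a0 a b' ja p0 J0 c' where b: "b = 1 + a * ja" "b = a0 ^ 2 * b'" and c: "c = a ^ 2 * c'"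
      and sum0: "orbit_sum f n = L p0 / L (a0 * a)" and J0: "a0 * a dvd p0 * J0 - 1" and nz0: "a0 \<noteq> 0" "a \<noteq> 0"
      and J1: "a * b dvd (p0 * a0 * b' + a) * (- (p0 * a0 * b' + ja)) - 1"
      and fin: "finite_cf (orbit_sum f n)" "finite_cf (orbit_sum f (Suc n))" "finite_cf (orbit_sum f (Suc (Suc n)))"
      unfolding b_def c_def by blast
    define j where "j = pcompose jp b"
    define p1 J1' p2 J2 where "p1 = p0 * a0 * b' + a" and "J1' = - (p0 * a0 * b' + ja)"
      and "p2 = p1 * a * c' + b" and "J2 = - (p1 * a * c' + j)"
    have cj: "c = 1 + b * j" unfolding c_def j_def by (simp add: pc1 b_def)
    have jb: "j = - 2 + b * (1 + (b - 1) ^ 2 * pcompose r b)" unfolding j_def by (rule pcj)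
    have dc: "d = b ^ 2 * j ^ 2 * (1 + c ^ 2 * pcompose r c)"
    proof -
      have "d = pcompose f c" unfolding d_def c_def by (rule poly_iterate_Suc)
      also have "\<dots> = (c - 1) ^ 2 * (1 + c ^ 2 * pcompose r c)" by (rule pc2)
      also have "c - 1 = b * j" using cj by simp
      finally show ?thesis by (simp add: power_mult_distrib)
    qed
    have nz: "b \<noteq> 0" "c \<noteq> 0" using nu[of n] nu[of "Suc n"] poly_iterate_nonzero[OF deg, of n] poly_iterate_nonzero[OF deg, of "Suc n"]
      by (auto simp: b_def c_def)
    have j0: "j \<noteq> 0" using cj nu[of "Suc n"] by (auto simp: c_def simp del: poly_iterate_Suc)
    have j1: "1 + j \<noteq> 0"
    proof
      assume "1 + j = 0"
      then have "b * (1 + (b - 1) ^ 2 * pcompose r b) = 1" using jb by algebra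
      then show False using nu[of n] unfolding b_def[symmetric] by (metis dvd_triv_left)
    qed
    have sum1: "orbit_sum f (Suc n) = L p1 / L (a * b)"
      unfolding p1_def using sum0 b_def b(2) nz(1) nz0(2) by (rule orbit_sum_combine)
    have sum2: "orbit_sum f (Suc (Suc n)) = L p2 / L (b * c)"
      unfolding p2_def using sum1 c_def c nz(2,1) by (rule orbit_sum_combine)
    have J2: "b * c dvd p2 * J2 - 1" unfolding p2_def J2_def p1_def using c cj b jb by (rule inverse_12)
    have eqs: "L c = L a ^ 2 * L c'" "L c = 1 + L b * L j" "L b = 1 + L a * L ja" "L b = L a0 ^ 2 * L b'"
      "L j = - 2 + L b * (1 + (L b - 1) ^ 2 * L (pcompose r b))" "L p1 = L p0 * L a0 * L b' + L a"
      subgoal unfolding c by simp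
      subgoal unfolding cj by simp
      subgoal unfolding b(1) by simp
      subgoal unfolding b(2) by simp
      subgoal by (subst jb) simp
      subgoal unfolding p1_def by simp
      done
    have "1 + L j \<noteq> 0" using j1 by (metis L_1 L_add L_eq_0_iff)
    note j1L = this
    have nzL: "L a \<noteq> 0" "L b \<noteq> 0" "L c \<noteq> 0" "L a0 \<noteq> 0" "L j \<noteq> 0" using nz nz0 j0 by simp_all
    note ids = identity_12[OF nzL j1L eqs]
    have F0: "finite_cf (L p0 / L (a0 * a))" using fin(1) sum0 by simp
    have F1: "finite_cf (L p1 / L (a * b))" using fin(2) sum1 by simp
    have F2: "finite_cf (L p2 / L (b * c))" using fin(3) sum2 by simp
    have J1d: "a * b dvd p1 * J1' - 1" using J1 by (simp add: p1_def J1'_def)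
    have nzQ: "a0 * a \<noteq> 0" "a * b \<noteq> 0" "b * c \<noteq> 0" using nz nz0 by simp_all
    note G0 = finite_cf_transport(2)[OF nzQ(1) F0 J0]
    note G1 = finite_cf_transport(2)[OF nzQ(2) F1 J1d]
    have J0': "a0 * a dvd J0 * p0 - 1" using J0 by (simp add: mult.commute)
    have LJ1': "L J1' = - (L p0 * L a0 * L b' + L ja)" and LJ2: "L J2 = - (L p1 * L a * L c' + L j)"
      and Ld: "L d = L b ^ 2 * L j ^ 2 * (1 + L c ^ 2 * L (pcompose r c))"
      by (simp_all add: J1'_def J2_def dc)
    have "finite_cf (- (L J1' / L (a * b)) + L (ja ^ 2 * pcompose r b))"
      using G1 by (simp only: finite_cf_add_iff finite_cf_minus_iff)
    then have "finite_cf ((1 + L j) / L b' / L (a0 * a) ^ 2 + L p0 / L (a0 * a))"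
      unfolding L_mult L_power LJ1' ids(4) .
    then have "finite_cf (L J0 / L (a0 * a) + 1 / ((1 + L j) / L b'))"
      using finite_cf_transport(1)[OF nzQ(1) G0 J0'] by blast
    then have "finite_cf (- (L j * L a ^ 2 * L b) / (1 + L j) / L (a0 * a) ^ 2 + L J0 / L (a0 * a))"
      unfolding L_mult ids(3)[of "L J0"] by simp
    then have "finite_cf (L p0 / L (a0 * a) + 1 / (- (L j * L a ^ 2 * L b) / (1 + L j)))"
      using finite_cf_transport(1)[OF nzQ(1) F0 J0] by blast
    then have "finite_cf (L b * L c ^ 2 / L j / L (a * b) ^ 2 + L J1' / L (a * b))"
      unfolding L_mult LJ1' ids(2) by (simp only: finite_cf_add_iff finite_cf_minus_iff)
    then have "finite_cf (L p1 / L (a * b) + 1 / (L b * L c ^ 2 / L j))"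
      using finite_cf_transport(1)[OF nzQ(2) F1 J1d] by blast
    then have "finite_cf (- (L p1 / L (a * b) + 1 / (L b * L c ^ 2 / L j)) + L (j ^ 2 * pcompose r c))"
      by (simp only: finite_cf_add_iff finite_cf_minus_iff)
    then have "finite_cf (L d / L (b * c) ^ 2 + L J2 / L (b * c))"
      unfolding L_mult L_power LJ2 Ld ids(1)[of "L (pcompose r c)"] .
    then have "finite_cf (L p2 / L (b * c) + 1 / L d)"
      using finite_cf_transport(1)[OF nzQ(3) F2 J2] by blast
    then have "finite_cf (orbit_sum f (Suc (Suc (Suc n))))"
      unfolding sum2[symmetric] d_def by simp
    moreover have "poly_iterate f (Suc n) = a ^ 2 * c'" "poly_iterate f (Suc n) = 1 + b * j"
      using c cj unfolding c_def by simp_all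
    moreover have "poly_iterate f (Suc (Suc n)) = b ^ 2 * (j ^ 2 * (1 + c ^ 2 * pcompose r c))"
      using dc unfolding d_def mult.assoc .
    moreover have "b * poly_iterate f (Suc n) dvd (p1 * a * c' + b) * (- (p1 * a * c' + j)) - 1"
      using J2 unfolding p2_def J2_def c_def .
    ultimately show ?case using sum1 J1d nz(1) nz0(2) fin(2,3) by blast
  qed
  then show ?thesis by blast
qed

lemma pX_cong_5:
  assumes deg: "0 < degree f" and f: "f = (pX - 1) ^ 2 * (1 + pX + pX ^ 2 * r)"
  shows "finite_cf (orbit_sum f n)"
proof -
  define jp where "jp = - 1 + pX * (- 1 + pX + (pX - 1) ^ 2 * r)"
  have fj: "f = 1 + pX * jp" unfolding f jp_def by algebra
  have pc1: "pcompose f h = 1 + h * pcompose jp h" for h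
    unfolding fj by (simp add: pcompose_add pcompose_mult pcompose_1 pcompose_pCons)
  have pcj: "pcompose jp h = - 1 + h * (- 1 + h + (h - 1) ^ 2 * pcompose r h)" for h
    unfolding jp_def by (simp add: pcompose_add pcompose_diff pcompose_uminus pcompose_mult pcompose_1 pcompose_pCons power2_eq_square)
  have pc2: "pcompose f h = (h - 1) ^ 2 * (1 + h + h ^ 2 * pcompose r h)" for h
    unfolding f by (simp add: pcompose_add pcompose_diff pcompose_mult pcompose_1 pcompose_pCons power2_eq_square)
  have nu: "\<not> is_unit (poly_iterate f n)" for n using deg by (rule poly_iterate_not_unit)
  have "\<exists>a00 a0 a a' b' j0 ja p00 J00 p0 J0 c'. poly_iterate f n = a0 ^ 2 * b' \<and> poly_iterate f n = 1 + a * ja \<and>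
    a = a00 ^ 2 * a' \<and> a = 1 + a0 * j0 \<and> finite_cf (L p00 / L (a00 * a0)) \<and> a00 * a0 dvd p00 * J00 - 1 \<and>
    poly_iterate f (Suc n) = a ^ 2 * c' \<and> orbit_sum f n = L p0 / L (a0 * a) \<and> a0 * a dvd p0 * J0 - 1 \<and>
    a00 \<noteq> 0 \<and> a0 \<noteq> 0 \<and> a \<noteq> 0 \<and>
    a * poly_iterate f n dvd (p0 * a0 * b' + a) * (- (p00 * a00 * a' * a0 * b' + ja)) - 1 \<and>
    finite_cf (orbit_sum f n) \<and> finite_cf (orbit_sum f (Suc n)) \<and> finite_cf (orbit_sum f (Suc (Suc n)))"
  proof (induction n)
    case 0
    have "f + pX = 1 + pX ^ 2 * (- 1 + pX + (pX - 1) ^ 2 * r)" unfolding f by algebra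
    then have "L (f + pX) = L 1 + L (pX ^ 2) * L (- 1 + pX + (pX - 1) ^ 2 * r)" by (metis L_add L_mult)
    moreover have "finite_cf (L 1 / L (pX ^ 2))" by (simp only: L_1 finite_cf_one_divide_iff finite_cf_L)
    ultimately have "finite_cf (orbit_sum f 2)"
      unfolding finite_cf_orbit_sum_2[OF deg] by (simp only: finite_cf_divide_add)
    then have fin: "finite_cf (orbit_sum f (Suc (Suc 0)))" by (simp only: numeral_2_eq_2)
    have "poly_iterate f (Suc 0) = 1 ^ 2 * f" by (simp add: pcompose_idR)
    \<comment> \<open>No sum precedes the empty one. The fraction -1/1 takes its place as p00/(a00
      a0) and makes the inverse for the first sum equal to 1.\<close>
    moreover have "1 * poly_iterate f 0 dvd (0 * 1 * pX + 1) * (- ((- 1) * 1 * 1 * 1 * pX + (pX - 1))) - 1" by simp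
    moreover have "poly_iterate f 0 = 1 ^ 2 * pX" "poly_iterate f 0 = 1 + 1 * (pX - 1)" by simp_all
    moreover have "orbit_sum f 0 = L 0 / L (1 * 1)" "1 * 1 dvd 0 * 0 - (1 :: int poly)" "finite_cf (orbit_sum f 0)" by simp_all
    moreover have "1 = 1 ^ 2 * (1 :: int poly)" "1 = 1 + 1 * (0 :: int poly)" "1 * 1 dvd (- 1) * 0 - (1 :: int poly)" by simp_all
    moreover have "finite_cf (L (- 1) / L (1 * 1))" using finite_cf_L[of "- 1"] by simp
    ultimately show ?case using fin orbit_sum_1[of f] one_neq_zero by blast
  next
    case (Suc n)
    define b c d where "b = poly_iterate f n" and "c = poly_iterate f (Suc n)" and "d = poly_iterate f (Suc (Suc n))"
    from Suc obtain a00 a0 a a' b' j0 ja p00 J00 p0 J0 c' where b: "b = 1 + a * ja" "b = a0 ^ 2 * b'" and c: "c = a ^ 2 * c'"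
      and a: "a = a00 ^ 2 * a'" "a = 1 + a0 * j0" and F00: "finite_cf (L p00 / L (a00 * a0))" and J00: "a00 * a0 dvd p00 * J00 - 1"
      and sum0: "orbit_sum f n = L p0 / L (a0 * a)" and J0: "a0 * a dvd p0 * J0 - 1" and nz0: "a00 \<noteq> 0" "a0 \<noteq> 0" "a \<noteq> 0"
      and J1: "a * b dvd (p0 * a0 * b' + a) * (- (p00 * a00 * a' * a0 * b' + ja)) - 1"
      and fin: "finite_cf (orbit_sum f n)" "finite_cf (orbit_sum f (Suc n))" "finite_cf (orbit_sum f (Suc (Suc n)))"
      unfolding b_def c_def by blast
    define j where "j = pcompose jp b"
    define s where "s = - 1 + b + (b - 1) ^ 2 * pcompose r b"
    define p1 J1' p2 J2 t where "p1 = p0 * a0 * b' + a" and "J1' = - (p00 * a00 * a' * a0 * b' + ja)"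
      and "p2 = p1 * a * c' + b" and "J2 = - (p0 * a0 * b' * a * c' + j)" and "t = 1 + j * (1 + c)"
    have cj: "c = 1 + b * j" unfolding c_def j_def by (simp add: pc1 b_def)
    have jb: "j = - 1 + b * s" unfolding j_def s_def by (rule pcj)
    have dc: "d = b ^ 2 * j ^ 2 * (1 + c + c ^ 2 * pcompose r c)"
    proof -
      have "d = pcompose f c" unfolding d_def c_def by (rule poly_iterate_Suc)
      also have "\<dots> = (c - 1) ^ 2 * (1 + c + c ^ 2 * pcompose r c)" by (rule pc2)
      also have "c - 1 = b * j" using cj by simp
      finally show ?thesis by (simp add: power_mult_distrib)
    qed
    have nz: "b \<noteq> 0" "c \<noteq> 0" using poly_iterate_nonzero[OF deg, of n] poly_iterate_nonzero[OF deg, of "Suc n"]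
      by (auto simp: b_def c_def)
    have nub: "\<not> is_unit b" and nuc: "\<not> is_unit c" using nu by (simp_all only: b_def c_def not_False_eq_True)
    have j_nz: "j \<noteq> 0" using cj nuc by auto
    have c1: "1 + c \<noteq> 0"
    proof
      assume "1 + c = 0"
      then have "c * (- 1) = 1" by algebra
      then show False using nuc by (metis dvd_triv_left)
    qed
    have t_nz: "t \<noteq> 0"
    proof
      assume "t = 0"
      then have "b * (- (2 * s + j ^ 2)) = - 1" unfolding t_def using cj jb by algebra
      then show False using nub by (metis dvd_triv_left dvd_minus_iff)
    qed
    have sum1: "orbit_sum f (Suc n) = L p1 / L (a * b)"
      unfolding p1_def using sum0 b_def b(2) nz(1) nz0(3) by (rule orbit_sum_combine)
    have sum2: "orbit_sum f (Suc (Suc n)) = L p2 / L (b * c)"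
      unfolding p2_def using sum1 c_def c nz(2,1) by (rule orbit_sum_combine)
    have J2: "b * c dvd p2 * J2 - 1" unfolding p2_def J2_def p1_def using c cj b a(2) jb by (rule inverse_5)
    have eqs: "L c = L a ^ 2 * L c'" "L c = 1 + L b * L j" "L b = 1 + L a * L ja" "L b = L a0 ^ 2 * L b'"
      "L a = L a00 ^ 2 * L a'" "L j = - 1 + L b * L s" "L s = - 1 + L b + (L b - 1) ^ 2 * L (pcompose r b)" 
      "L p1 = L p0 * L a0 * L b' + L a" "L t = 1 + L j * (1 + L c)" 
      "L J1' = - (L p00 * L a00 * L a' * L a0 * L b' + L ja)"
      subgoal unfolding c by simp
      subgoal unfolding cj by simp
      subgoal unfolding b(1) by simp
      subgoal unfolding b(2) by simp
      subgoal unfolding a(1) by simp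
      subgoal by (subst jb) simp
      subgoal unfolding s_def by simp
      subgoal unfolding p1_def by simp
      subgoal unfolding t_def by simp
      subgoal unfolding J1'_def by simp
      done
    have "1 + L c \<noteq> 0" using c1 by (metis L_1 L_add L_eq_0_iff)
    moreover have "L a \<noteq> 0" "L b \<noteq> 0" "L c \<noteq> 0" "L a0 \<noteq> 0" "L a00 \<noteq> 0" "L j \<noteq> 0" "L t \<noteq> 0"
      using nz nz0 j_nz t_nz by simp_all
    ultimately have nzL: "L a \<noteq> 0" "L b \<noteq> 0" "L c \<noteq> 0" "L a0 \<noteq> 0" "L a00 \<noteq> 0" "L j \<noteq> 0" "1 + L c \<noteq> 0" "L t \<noteq> 0"
      by blast+
    note ids = identity_5[OF nzL eqs]
    have F1: "finite_cf (L p1 / L (a * b))" using fin(2) sum1 by simp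
    have F2: "finite_cf (L p2 / L (b * c))" using fin(3) sum2 by simp
    have J1d: "a * b dvd p1 * J1' - 1" using J1 by (simp add: p1_def J1'_def)
    have nzQ: "a00 * a0 \<noteq> 0" "a * b \<noteq> 0" "b * c \<noteq> 0" using nz nz0 by simp_all
    note G0 = finite_cf_transport(2)[OF nzQ(1) F00 J00]
    note G1 = finite_cf_transport(2)[OF nzQ(2) F1 J1d]
    have J00': "a00 * a0 dvd J00 * p00 - 1" using J00 by (simp add: mult.commute)
    have LJ2: "L J2 = - (L p0 * L a0 * L b' * L a * L c' + L j)"
      and Ld: "L d = L b ^ 2 * L j ^ 2 * (1 + L c + L c ^ 2 * L (pcompose r c))"
      by (simp_all add: J2_def dc)
    define R where "R = ja ^ 2 * (b ^ 2 - 2 + 2 * pcompose r b + 2 * (- 1 - b + b ^ 2) * b * pcompose r b + (b * (b - 1) * pcompose r b) ^ 2)"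
    have LR: "L R = L ja ^ 2 * (L b ^ 2 - 2 + 2 * L (pcompose r b) + 2 * (- 1 - L b + L b ^ 2) * L b * L (pcompose r b) +
      (L b * (L b - 1) * L (pcompose r b)) ^ 2)"
      by (simp add: R_def)
    have "finite_cf (- (L J1' / L (a * b)) + L R)"
      using G1 by (simp only: finite_cf_add_iff finite_cf_minus_iff)
    then have "finite_cf (L t * (L a00 * L a0) ^ 2 / (L a ^ 2 * L b) / L (a00 * a0) ^ 2 + L p00 / L (a00 * a0))"
      unfolding L_mult ids(4) LR .
    then have "finite_cf (L J00 / L (a00 * a0) + 1 / (L t * (L a00 * L a0) ^ 2 / (L a ^ 2 * L b)))"
      using finite_cf_transport(1)[OF nzQ(1) G0 J00'] by blast
    then have "finite_cf (L J00 / L (a00 * a0) + 1 / (L t * (L a00 * L a0) ^ 2 / (L a ^ 2 * L b)) - L (a00 ^ 2 * a' ^ 2 * b'))"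
      by (simp only: finite_cf_diff_iff)
    then have "finite_cf (- (L j * (1 + L c) * L a ^ 2 * L b) / L t / L (a00 * a0) ^ 2 + L J00 / L (a00 * a0))"
      unfolding L_mult L_power ids(3)[of "L J00"] .
    then have "finite_cf (L p00 / L (a00 * a0) + 1 / (- (L j * (1 + L c) * L a ^ 2 * L b) / L t))"
      using finite_cf_transport(1)[OF nzQ(1) F00 J00] by blast
    then have "finite_cf (L b * L c ^ 2 / (L j * (1 + L c)) / L (a * b) ^ 2 + L J1' / L (a * b))"
      unfolding L_mult ids(2) by (simp only: finite_cf_minus_iff)
    then have "finite_cf (L p1 / L (a * b) + 1 / (L b * L c ^ 2 / (L j * (1 + L c))))"
      using finite_cf_transport(1)[OF nzQ(2) F1 J1d] by blast
    then have "finite_cf (- (L p1 / L (a * b) + 1 / (L b * L c ^ 2 / (L j * (1 + L c)))) + L (s + j ^ 2 * pcompose r c))"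
      by (simp only: finite_cf_add_iff finite_cf_minus_iff)
    then have "finite_cf (L d / L (b * c) ^ 2 + L J2 / L (b * c))"
      unfolding L_mult L_power L_add LJ2 Ld ids(1)[of "L (pcompose r c)"] .
    then have "finite_cf (L p2 / L (b * c) + 1 / L d)"
      using finite_cf_transport(1)[OF nzQ(3) F2 J2] by blast
    then have "finite_cf (orbit_sum f (Suc (Suc (Suc n))))"
      unfolding sum2[symmetric] d_def by simp
    moreover have "poly_iterate f (Suc n) = a ^ 2 * c'" "poly_iterate f (Suc n) = 1 + b * j"
      using c cj unfolding c_def by simp_all
    moreover have "poly_iterate f (Suc (Suc n)) = b ^ 2 * (j ^ 2 * (1 + c + c ^ 2 * pcompose r c))"
      using dc unfolding d_def mult.assoc .
    moreover have "b * poly_iterate f (Suc n) dvd (p1 * a * c' + b) * (- (p0 * a0 * b' * a * c' + j)) - 1"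
      using J2 unfolding p2_def J2_def c_def .
    moreover have "finite_cf (L p0 / L (a0 * a))" using fin(1) sum0 by simp
    ultimately show ?case using sum1 J1d J0 nz(1) nz0(2,3) fin(2,3) b a(2) by blast
  qed
  then show ?thesis by blast
qed

section \<open>Necessity in degree at least 3\<close>

lemma dvd_mult_cancel_lead:
  fixes a b c :: int
  assumes "a * c dvd b * c" "c \<noteq> 0" shows "a dvd b"
  using assms by simp

lemma int_dvd_1: "(a :: int) dvd 1 \<Longrightarrow> a \<in> {- 1, 1}"
  by (auto simp: zdvd1_eq abs_eq_iff')

lemma int_square_dvd_1: "(a :: int) ^ 2 dvd 1 \<Longrightarrow> a \<in> {- 1, 1}"
  by (metis dvd_triv_left dvd_trans int_dvd_1 power2_eq_square)

text \<open>The inverse has leading coefficient 1/B, so B is 0 or a unit. For a unit, x^2 = (B x -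
  A)(B x + A) + A^2, and the next quotient forces A^2 to divide B.\<close>

lemma reducible_linear_mod_square:
  assumes "reducible [:A, B:] (pX ^ 2)"
  shows "A \<in> {- 1, 0, 1}" "B \<in> {- 1, 0, 1}"
proof -
  have X2: "pX ^ 2 = [:0, 0, 1:]" by (simp add: power2_eq_square)
  have sw: "reducible [:0, 0, 1:] [:A, B:]" using assms unfolding X2 by (rule reducible.swap)
  have B: "B \<in> {- 1, 0, 1}"
  proof (cases "B = 0")
    case False
    then show ?thesis using reducible_lead_coeff_dvd[OF sw] int_dvd_1[of B] by simp
  qed simp
  then show "B \<in> {- 1, 0, 1}" .
  show "A \<in> {- 1, 0, 1}"
  proof (cases "A = 0")
    case A: False
    show ?thesis
    proof (cases "B = 0")
      case True
      then show ?thesis using reducible_lead_coeff_dvd[OF sw] int_dvd_1[of A] A by simp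
    next
      case False
      then have BB: "B * B = 1" using B by auto
      have "[:0, 0, 1:] = [:- A, B:] * [:A, B:] + [:A ^ 2:]" using BB by (simp add: power2_eq_square)
      then have "reducible [:A, B:] [:A ^ 2:]" using sw reducible_step by blast
      from reducible_lead_coeff_dvd[OF this] have "A ^ 2 dvd B" using A False by simp
      then have "A ^ 2 dvd 1" using BB by (metis dvd_mult2)
      then show ?thesis using int_square_dvd_1 by blast
    qed
  qed simp
qed

lemma reducible_mod_iff: "p = r + b * q \<Longrightarrow> reducible p q \<longleftrightarrow> reducible r q"
  by (simp add: reducible_add_iff)

text \<open>The divisions of \<open>reducible_linear_mod_square\<close>, with both parts multiplied
  by \<open>H\<close> and an error \<open>E\<close> whose degree is too low to affect the leading
  coefficients.\<close>

lemma reducible_stage: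
  fixes H E :: "int poly"
  assumes red: "reducible ([:\<alpha>, \<beta>:] * H + E) (pX ^ 2 * H)" and deg: "degree E + 1 < degree H"
  shows "\<beta> \<in> {- 1, 0, 1}" "\<alpha> \<in> {- 1, 0, 1}"
    and "\<beta> \<noteq> 0 \<Longrightarrow> reducible ([:\<alpha>, \<beta>:] * H + E) ([:\<alpha> ^ 2:] * H - [:- \<alpha>, \<beta>:] * E)"
proof -
  define n where "n = [:\<alpha>, \<beta>:] * H + E"
  have H0: "H \<noteq> 0" "lead_coeff H \<noteq> 0" using deg by auto
  have X2: "pX ^ 2 = [:0, 0, 1:]" by (simp add: power2_eq_square)
  have D: "degree (pX ^ 2 * H) = degree H + 2" "lead_coeff (pX ^ 2 * H) = lead_coeff H"
    unfolding X2 lead_coeff_mult using H0 by (simp_all add: degree_mult_eq)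
  have sw: "reducible (pX ^ 2 * H) n" unfolding n_def using red by (rule reducible.swap)
  have lead: "lead_coeff n dvd lead_coeff H" if "n \<noteq> 0" "degree n < degree H + 2"
    using reducible_lead_coeff_dvd[OF sw that(1)] that(2) D by simp
  have linear: "\<beta> \<in> {- 1, 1} \<and> \<alpha> \<in> {- 1, 0, 1} \<and> reducible n ([:\<alpha> ^ 2:] * H - [:- \<alpha>, \<beta>:] * E)" if b: "\<beta> \<noteq> 0"
  proof -
    have lin: "degree ([:\<alpha>, \<beta>:] * H) = degree H + 1" "lead_coeff ([:\<alpha>, \<beta>:] * H) = \<beta> * lead_coeff H"
      unfolding lead_coeff_mult using H0 b degree_mult_eq[of "[:\<alpha>, \<beta>:]" H] by auto
    then have n: "degree n = degree H + 1" "lead_coeff n = \<beta> * lead_coeff H"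
      using deg lead_coeff_add_le[of E "[:\<alpha>, \<beta>:] * H"] unfolding n_def by (simp_all add: degree_add_eq_left)
    have n0: "n \<noteq> 0" using n(1) by auto
    have "\<beta> * lead_coeff H dvd 1 * lead_coeff H" using lead[OF n0] n by simp
    then have b1: "\<beta> \<in> {- 1, 1}" using H0(2) int_dvd_1 by (metis dvd_mult_cancel_lead)
    then have "\<beta> * \<beta> = 1" by auto
    then have "[:- \<alpha>, \<beta>:] * [:\<alpha>, \<beta>:] = pX ^ 2 - [:\<alpha> ^ 2:]"
      unfolding X2 by (simp add: power2_eq_square algebra_simps)
    then have "pX ^ 2 * H = [:- \<alpha>, \<beta>:] * n + ([:\<alpha> ^ 2:] * H - [:- \<alpha>, \<beta>:] * E)"
      unfolding n_def by algebra
    then have red2: "reducible n ([:\<alpha> ^ 2:] * H - [:- \<alpha>, \<beta>:] * E)" using sw reducible_step by blast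
    have "\<alpha> \<in> {- 1, 0, 1}"
    proof (cases "\<alpha> = 0")
      case a: False
      have "degree ([:- \<alpha>, \<beta>:] * E) \<le> degree E + 1"
        by (rule order.trans[OF degree_mult_le]) (use b in simp)
      moreover have "degree ([:\<alpha> ^ 2:] * H) = degree H" using a by simp
      ultimately have le: "degree (- ([:- \<alpha>, \<beta>:] * E)) < degree ([:\<alpha> ^ 2:] * H)"
        using deg by (simp only: degree_minus)
      then have "degree ([:\<alpha> ^ 2:] * H + - ([:- \<alpha>, \<beta>:] * E)) = degree H"
        using a by (subst degree_add_eq_left[OF le]) simp
      moreover have "lead_coeff ([:\<alpha> ^ 2:] * H + - ([:- \<alpha>, \<beta>:] * E)) = \<alpha> ^ 2 * lead_coeff H"
        using lead_coeff_add_le[OF le] a by simp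
      ultimately have "degree ([:\<alpha> ^ 2:] * H - [:- \<alpha>, \<beta>:] * E) = degree H"
        "lead_coeff ([:\<alpha> ^ 2:] * H - [:- \<alpha>, \<beta>:] * E) = \<alpha> ^ 2 * lead_coeff H"
        by (simp_all only: add_uminus_conv_diff)
      moreover from this have "[:\<alpha> ^ 2:] * H - [:- \<alpha>, \<beta>:] * E \<noteq> 0" using deg by (metis degree_0 not_less0)
      ultimately have "\<alpha> ^ 2 * lead_coeff H dvd \<beta> * lead_coeff H"
        using reducible_lead_coeff_dvd[OF red2] n by simp
      then have "\<alpha> ^ 2 dvd \<beta>" using H0(2) by (rule dvd_mult_cancel_lead)
      then have "\<alpha> ^ 2 dvd 1" using \<open>\<beta> * \<beta> = 1\<close> by (metis dvd_mult2)
      then show ?thesis using int_square_dvd_1 by blast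
    qed simp
    with b1 red2 show ?thesis by blast
  qed
  have const: "\<alpha> \<in> {- 1, 0, 1}" if b: "\<beta> = 0"
  proof (cases "\<alpha> = 0")
    case a: False
    have n': "n = [:\<alpha>:] * H + E" by (simp add: n_def b)
    have "degree n = degree H" "lead_coeff n = \<alpha> * lead_coeff H"
      using deg a lead_coeff_add_le[of E "[:\<alpha>:] * H"] unfolding n' by (simp_all add: degree_add_eq_left)
    moreover from this have "n \<noteq> 0" using deg by auto
    ultimately have "\<alpha> * lead_coeff H dvd 1 * lead_coeff H" using lead by simp
    then show ?thesis using H0(2) int_dvd_1 by (metis dvd_mult_cancel_lead insert_iff)
  qed simp
  show "\<beta> \<in> {- 1, 0, 1}" "\<alpha> \<in> {- 1, 0, 1}"
    and "\<beta> \<noteq> 0 \<Longrightarrow> reducible ([:\<alpha>, \<beta>:] * H + E) ([:\<alpha> ^ 2:] * H - [:- \<alpha>, \<beta>:] * E)"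
    using linear const unfolding n_def by blast+
qed

text \<open>One more division, possible because (\<alpha> + \<beta> x)(- \<alpha> + \<beta> x) = x^2
  - 1 makes the remainder exactly x^2 E. The result has denominator \<open>pX ^ 2 * E\<close>, so
  the analysis can restart with \<open>E\<close> in place of \<open>H\<close>.\<close>

lemma reducible_stage_units:
  fixes H E :: "int poly"
  assumes red: "reducible ([:\<alpha>, \<beta>:] * H + E) (pX ^ 2 * H)" and deg: "degree E + 1 < degree H"
    and "\<alpha> \<noteq> 0" "\<beta> \<noteq> 0"
  shows "reducible (H - [:- \<alpha>, \<beta>:] * E) (pX ^ 2 * E)"
proof -
  note st = reducible_stage[OF red deg]
  have sq: "\<alpha> * \<alpha> = 1" "\<beta> * \<beta> = 1" using st(1,2) assms(3,4) by auto
  then have r: "[:\<alpha> ^ 2:] * H - [:- \<alpha>, \<beta>:] * E = H - [:- \<alpha>, \<beta>:] * E" by (simp add: power2_eq_square)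
  have "[:\<alpha>, \<beta>:] * [:- \<alpha>, \<beta>:] = pX ^ 2 - 1"
    using sq by (simp add: power2_eq_square algebra_simps one_pCons)
  then have "[:\<alpha>, \<beta>:] * H + E = [:\<alpha>, \<beta>:] * (H - [:- \<alpha>, \<beta>:] * E) + pX ^ 2 * E" by algebra
  then show ?thesis using st(3)[OF assms(4)] unfolding r using reducible_step by blast
qed

text \<open>Necessary conditions coming from the partial sum with three terms.\<close>

lemma affine_image: "f = u + g * X \<Longrightarrow> c * f + 1 = (c * u + 1) + c * g * X" for f :: "'a::comm_ring_1"
  by (simp add: algebra_simps)

text \<open>Here H = f^2 and E = B f + 1 in \<open>reducible_stage\<close>. With \<alpha> = e0 - 1
  and \<beta> = B + e1 (B - 1), the surviving triples belong to congruences (3), (5), (11), (6), an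
  exceptional family, (7) and (12), in this order. The family for (0, 0, -1) passes all tests with
  three terms and is refuted by \<open>not_exceptional\<close>.\<close>

lemma reducible_classification:
  fixes f g :: "int poly"
  assumes f: "f = [:1, B - 1:] + pX ^ 2 * g" and deg: "2 < degree f"
    and red: "reducible ([:\<alpha>, \<beta>:] * f ^ 2 + ([:B:] * f + 1)) (pX ^ 2 * f ^ 2)"
    and B: "B \<in> {- 1, 0, 1}" and b1: "B = 1 \<Longrightarrow> \<beta> = 1" and b2: "B = - 1 \<Longrightarrow> \<beta> \<noteq> 0"
  shows "(B, \<alpha>, \<beta>) \<in> {(1, - 1, 1), (0, - 1, - 1), (0, 0, 0), (0, 0, 1), (0, 0, - 1), (- 1, 1, 1), (- 1, 0, - 1)}"
proof -
  define h where "h = [:B:] * f + 1"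
  have f0: "f \<noteq> 0" using deg by auto
  have degh: "degree h \<le> degree f"
    unfolding h_def by (rule degree_add_le) (auto intro: order.trans[OF degree_mult_le])
  have degf2: "degree (f ^ 2) = 2 * degree f" using f0 by (simp add: degree_power_eq)
  have d1: "degree ([:B:] * f + 1) + 1 < degree (f ^ 2)" using degh deg unfolding degf2 h_def by linarith
  note st = reducible_stage[OF red d1]
  have fB: "f = [:1, B - 1:] + g * pX ^ 2" using f by (simp add: mult.commute)
  have nonzero: "(B, \<alpha>, \<beta>) \<in> {(1, - 1, 1), (0, - 1, - 1), (- 1, 1, 1)}" if a: "\<alpha> \<noteq> 0" and b: "\<beta> \<noteq> 0"
  proof (cases "B = 0")
    case True
    have "reducible (f ^ 2 - [:- \<alpha>, \<beta>:]) (pX ^ 2)"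
      using reducible_stage_units[OF red d1 a b] True by simp
    moreover have "f ^ 2 - [:- \<alpha>, \<beta>:] = [:1 + \<alpha>, - 2 - \<beta>:] + ([:1:] + 2 * [:1, - 1:] * g + g ^ 2 * pX ^ 2) * pX ^ 2"
    proof -
      have "[:1, -1:] ^ 2 - [:- \<alpha>, \<beta>:] = [:1 + \<alpha>, - 2 - \<beta>:] + [:1:] * pX ^ 2"
        by (simp add: power2_eq_square)
      then show ?thesis unfolding fB True diff_0 by algebra
    qed
    ultimately have "reducible [:1 + \<alpha>, - 2 - \<beta>:] (pX ^ 2)" using reducible_mod_iff by blast
    note reducible_linear_mod_square[OF this]
    then show ?thesis using st(1,2) a b True by auto
  next
    case False
    with B have BB: "B * B = 1" by auto
    have degh': "degree h = degree f"
      unfolding h_def using False deg by (subst degree_add_eq_left) simp_all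
    have f2: "f ^ 2 = h * h - 2 * h + 1"
    proof -
      have "[:B:] * [:B:] = 1" using BB by (simp add: one_pCons)
      then show ?thesis unfolding h_def by algebra
    qed
    \<comment> \<open>Since f^2 = (h - 1)^2 and h may be replaced modulo x^2 by its part of degree
      below 2, the fraction becomes [:\<alpha>2, \<beta>2:] * h + 1 over x^2 h, ready for another
      stage.\<close>
    define \<alpha>2 \<beta>2 where "\<alpha>2 = B - 1 + \<alpha>" and "\<beta>2 = 1 - B - \<beta>"
    have hB: "h = [:B + 1, 1 - B:] + [:B:] * g * pX ^ 2"
    proof -
      have "[:B:] * [:1, B - 1:] + 1 = [:B + 1, 1 - B:]" using BB by (simp add: one_pCons algebra_simps)
      then show ?thesis unfolding h_def affine_image[OF fB] by (simp only:)
    qed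
    have "reducible (f ^ 2 - [:- \<alpha>, \<beta>:] * h) (pX ^ 2 * h)"
      using reducible_stage_units[OF red d1 a b] unfolding h_def .
    moreover have "f ^ 2 - [:- \<alpha>, \<beta>:] * h = ([:\<alpha>2, \<beta>2:] * h + 1) + ([:B:] * g) * (pX ^ 2 * h)"
    proof -
      have "[:B + 1, 1 - B:] - 2 - [:- \<alpha>, \<beta>:] = [:\<alpha>2, \<beta>2:]"
        by (simp add: \<alpha>2_def \<beta>2_def numeral_poly)
      then have "h - 2 - [:- \<alpha>, \<beta>:] = [:\<alpha>2, \<beta>2:] + [:B:] * g * pX ^ 2"
        unfolding hB by (simp only: algebra_simps)
      then show ?thesis unfolding f2 by algebra
    qed
    ultimately have red2: "reducible ([:\<alpha>2, \<beta>2:] * h + 1) (pX ^ 2 * h)" using reducible_mod_iff by blast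
    have d2: "degree (1 :: int poly) + 1 < degree h" using deg degh' by simp
    note st2 = reducible_stage[OF red2 d2]
    show ?thesis
    proof (cases "B = 1")
      case True
      then have "\<alpha>2 = \<alpha>" "\<beta>2 = - 1" "\<beta> = 1" using b1 by (simp_all add: \<alpha>2_def \<beta>2_def)
      then have "reducible (h - [:- \<alpha>, - 1:] * 1) (pX ^ 2)"
        using reducible_stage_units[OF red2 d2] a by simp
      moreover have "h - [:- \<alpha>, - 1:] * 1 = [:2 + \<alpha>, 1:] + ([:B:] * g) * pX ^ 2"
        using True unfolding hB by simp
      ultimately have "reducible [:2 + \<alpha>, 1:] (pX ^ 2)" using reducible_mod_iff by blast
      note reducible_linear_mod_square[OF this]
      then show ?thesis using st(2) a True \<open>\<beta> = 1\<close> by auto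
    next
      case False
      then have "B = - 1" using BB B by auto
      then show ?thesis using st(1,2) st2(1,2) a b unfolding \<alpha>2_def \<beta>2_def by auto
    qed
  qed
  have a0: "(B, \<alpha>, \<beta>) \<in> {(0, 0, 1), (0, 0, - 1), (- 1, 0, - 1)}" if a: "\<alpha> = 0" and b: "\<beta> \<noteq> 0"
  proof (cases "B = 0")
    case True
    then show ?thesis using st(1) a b by auto
  next
    case False
    with B have BB: "B * B = 1" by auto
    have bb: "\<beta> * \<beta> = 1" using st(1) b by auto
    have e: "[:0 ^ 2:] * f ^ 2 - [:- 0, \<beta>:] * h = - ([:0, \<beta>:] * h)" by simp
    have "reducible ([:0, \<beta>:] * f ^ 2 + h) ([:0, \<beta>:] * h)"
      using st(3)[OF b] unfolding h_def[symmetric] a e reducible_neg_right_iff .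
    moreover have "[:0, \<beta>:] * f ^ 2 + h = ([:0, \<beta>:] + h) + (h - 2) * ([:0, \<beta>:] * h)"
    proof -
      have "[:B:] * [:B:] = 1" using BB by (simp add: one_pCons)
      then show ?thesis unfolding h_def by algebra
    qed
    ultimately have "reducible ([:0, \<beta>:] * h) ([:0, \<beta>:] + h)" using reducible_mod_iff reducible.swap by blast
    moreover have "[:0, \<beta>:] * h = [:0, \<beta>:] * ([:0, \<beta>:] + h) + (- (pX ^ 2))"
    proof -
      have "[:0, \<beta>:] * [:0, \<beta>:] = pX ^ 2" using bb by (simp add: power2_eq_square)
      then show ?thesis by algebra
    qed
    ultimately have "reducible ([:0, \<beta>:] + h) (pX ^ 2)" using reducible_step reducible_neg_right_iff by blast
    moreover have "[:0, \<beta>:] + h = [:B + 1, 1 - B + \<beta>:] + ([:B:] * g) * pX ^ 2"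
    proof -
      have "[:0, \<beta>:] + ([:B:] * [:1, B - 1:] + 1) = [:B + 1, 1 - B + \<beta>:]" using BB by (simp add: one_pCons algebra_simps)
      then show ?thesis unfolding h_def affine_image[OF fB] by (simp only: add.assoc[symmetric])
    qed
    ultimately have "reducible [:B + 1, 1 - B + \<beta>:] (pX ^ 2)" using reducible_mod_iff by blast
    note reducible_linear_mod_square[OF this]
    then show ?thesis using st(1) a b B False by auto
  qed
  have b0: "\<alpha> = 0" if b: "\<beta> = 0"
  proof (rule ccontr)
    assume a: "\<alpha> \<noteq> 0"
    have B0: "B = 0" using b b1 b2 B by auto
    have aa: "\<alpha> * \<alpha> = 1" using st(2) a by auto
    have "reducible ([:\<alpha>:] * f ^ 2 + 1) (pX ^ 2 * f ^ 2)" using red unfolding b B0 by simp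
    then have sw: "reducible (pX ^ 2 * f ^ 2) ([:\<alpha>:] * f ^ 2 + 1)" by (rule reducible.swap)
    have al: "[:\<alpha>:] * [:\<alpha>:] = 1" using aa by (simp add: one_pCons)
    then have "pX ^ 2 * f ^ 2 = ([:\<alpha>:] * pX ^ 2) * ([:\<alpha>:] * f ^ 2 + 1) + (- [:\<alpha>:] * pX ^ 2)" by algebra
    then have "reducible ([:\<alpha>:] * f ^ 2 + 1) (- [:\<alpha>:] * pX ^ 2)" using sw reducible_step by blast
    moreover have "- [:\<alpha>:] * pX ^ 2 = pX ^ 2 \<or> - [:\<alpha>:] * pX ^ 2 = - (pX ^ 2)"
      using st(2) a by (auto simp: one_pCons)
    ultimately have "reducible ([:\<alpha>:] * f ^ 2 + 1) (pX ^ 2)" using reducible_neg_right_iff by metis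
    moreover have "[:\<alpha>:] * f ^ 2 + 1 = [:\<alpha> + 1, - 2 * \<alpha>:] + ([:\<alpha>:] * (1 + 2 * [:1, - 1:] * g + g ^ 2 * pX ^ 2)) * pX ^ 2"
    proof -
      have "[:\<alpha>:] * [:1, -1:] ^ 2 + 1 = [:\<alpha> + 1, - 2 * \<alpha>:] + [:\<alpha>:] * pX ^ 2"
        by (simp add: power2_eq_square one_pCons)
      then show ?thesis unfolding fB B0 diff_0 by algebra
    qed
    ultimately have "reducible [:\<alpha> + 1, - 2 * \<alpha>:] (pX ^ 2)" using reducible_mod_iff by blast
    note reducible_linear_mod_square(2)[OF this]
    then show False using st(2) a by auto
  qed
  show ?thesis
  proof (cases "\<beta> = 0")
    case True
    then have "B = 0" using b1 b2 B by auto
    then show ?thesis using True b0 by simp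
  next
    case False
    show ?thesis
    proof (cases "\<alpha> = 0")
      case True
      then show ?thesis using a0[OF True False] by auto
    next
      case a: False
      then show ?thesis using nonzero[OF a False] by auto
    qed
  qed
qed

text \<open>The congruences (1), (2), (3), (5), (6), (7), (11), (12); the others are their images under \<open>conj_reflect\<close>.\<close>

definition admissible :: "int poly \<Rightarrow> bool" where
  "admissible f \<longleftrightarrow>
    (\<exists>g. f = pX ^ 2 * g) \<or>
    (\<exists>g. f = - pX + pX ^ 2 * g) \<or>
    (\<exists>g. f = 1 + pX ^ 2 * (pX - 1) * g) \<or>
    (\<exists>r. f = (pX - 1) ^ 2 * (1 + pX + pX ^ 2 * r)) \<or>
    (\<exists>r. f = 1 + (0 - 1) * pX + pX ^ 2 * (1 + (- 1) * (pX - 1) + (pX - 1) ^ 2 * r)) \<or>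
    (\<exists>r. f = 1 + (- 1 - 1) * pX + pX ^ 2 * (2 + (- 1) * (pX - 1) + (pX - 1) ^ 2 * r)) \<or>
    (\<exists>r. f = 1 + (0 - 1) * pX + pX ^ 2 * (1 + 0 * (pX - 1) + (pX - 1) ^ 2 * r)) \<or>
    (\<exists>r. f = (pX - 1) ^ 2 * (1 + pX ^ 2 * r))"

lemma admissible_imp_cf_limit:
  assumes deg: "1 < degree f" and "admissible f"
  shows "cf_limit (orbit_series f)"
proof (rule orbit_series_specializable[OF deg])
  have deg': "0 < degree f" using deg by simp
  fix m
  consider g where "f = pX ^ 2 * g" | g where "f = - pX + pX ^ 2 * g" | "\<And>n. finite_cf (orbit_sum f n)"
    using assms(2) unfolding admissible_def
    using pX_cong_3[OF deg'] pX_cong_5[OF deg'] pX_cong_6[OF deg'] pX_cong_7[OF deg'] pX_cong_11[OF deg'] pX_cong_12[OF deg']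
    by blast
  then show "\<exists>n\<ge>m. finite_cf (orbit_sum f n)"
  proof cases
    case 1
    then show ?thesis using pX_cong_1[OF deg 1, of m] by (intro exI[of _ "Suc m"]) simp
  next
    case 2
    then show ?thesis using pX_cong_2[OF deg 2, of m] by (intro exI[of _ "Suc (2 * m)"]) simp
  qed blast
qed

lemma poly_split_0: obtains g :: "int poly" where "f = [:coeff f 0, coeff f 1:] + pX ^ 2 * g"
proof (cases f)
  case (pCons a p)
  then obtain b q where "p = pCons b q" by (cases p)
  then have "f = [:coeff f 0, coeff f 1:] + pX ^ 2 * q" using pCons by (simp add: power2_eq_square)
  then show ?thesis by (rule that)
qed

lemma poly_split_1: obtains q :: "int poly" where "p = [:poly p 1:] + (pX - 1) * q"
proof -
  have "[:- 1, 1:] dvd p - [:poly p 1:]" by (subst poly_eq_0_iff_dvd[symmetric]) simp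
  then obtain q where "p - [:poly p 1:] = [:- 1, 1:] * q" by (elim dvdE)
  moreover have "[:- 1, 1:] = pX - 1" by (simp add: one_pCons)
  ultimately have "p = [:poly p 1:] + (pX - 1) * q" by (simp add: algebra_simps)
  then show ?thesis by (rule that)
qed

lemma admissible_of_value_0:
  assumes "f = [:0, B - 1:] + pX ^ 2 * g" "B \<in> {0, 1}"
  shows "admissible f"
  using assms unfolding admissible_def by auto

text \<open>The sum of two terms is (h + 1)/f, and h + 1 is its own inverse modulo f. Transport of
  the third term leaves (h - 1)/f; as f = x (h - 1) + x, the next quotient is (h - 1)/x, which is -
  3/x modulo polynomials.\<close>

lemma not_minus_2X:
  assumes deg: "2 < degree f" and cf: "cf_limit (orbit_series f)"
  shows "f \<noteq> [:0, - 2:] + pX ^ 2 * g"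
proof
  assume f: "f = [:0, - 2:] + pX ^ 2 * g"
  define h where "h = - 2 + pX * g"
  have fh: "f = pX * h" unfolding f h_def by (simp add: power2_eq_square numeral_poly)
  have deg': "0 < degree f" using deg by simp
  then have nz: "pX \<noteq> 0" "h \<noteq> 0" "f \<noteq> 0" using fh by auto
  have "orbit_sum f (Suc (Suc 0)) = 1 / L pX + 1 / L f" by (simp add: pcompose_idR)
  also have "\<dots> = L (h + 1) / L f" unfolding fh L_mult L_add L_1 using nz by (simp add: field_simps)
  finally have S2: "orbit_sum f (Suc (Suc 0)) = L (h + 1) / L f" .
  have fin: "finite_cf (L (h + 1) / L f)" "finite_cf (orbit_sum f (Suc (Suc (Suc 0))))"
    using orbit_sum_finite_cf[OF deg cf] S2 by metis+
  have dvd: "f dvd (h + 1) * (h + 1) - 1"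
  proof -
    have "(h + 1) * (h + 1) - 1 = f * g" unfolding fh by (simp add: h_def algebra_simps)
    then show ?thesis by simp
  qed
  have f2: "poly_iterate f (Suc (Suc 0)) = f * (- 2 + f * pcompose g f)"
  proof -
    have "poly_iterate f (Suc (Suc 0)) = pcompose f f" by (simp add: pcompose_idR)
    also have "\<dots> = pcompose ([:0, - 2:] + pX ^ 2 * g) f" using f by simp
    also have "\<dots> = f * (- 2 + f * pcompose g f)"
      by (simp add: pcompose_add pcompose_mult pcompose_pCons power2_eq_square algebra_simps numeral_poly)
    finally show ?thesis .
  qed
  have "finite_cf (L (h + 1) / L f + 1 / L (poly_iterate f (Suc (Suc 0))))"
    using fin(2) S2 by (subst (asm) orbit_sum_Suc) simp
  then have "finite_cf (L (poly_iterate f (Suc (Suc 0))) / L f ^ 2 + L (h + 1) / L f)"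
    using finite_cf_transport(1)[OF nz(3) fin(1) dvd] by blast
  moreover have "L (poly_iterate f (Suc (Suc 0))) / L f ^ 2 + L (h + 1) / L f = L (h - 1) / L f + L (pcompose g f)"
    unfolding f2 using nz by (simp add: field_simps power2_eq_square)
  ultimately have "reducible (h - 1) f" using nz by (simp only: finite_cf_add_iff finite_cf_iff not_False_eq_True)
  then have "reducible f (h - 1)" by (rule reducible.swap)
  moreover have "f = pX * (h - 1) + pX" unfolding fh by algebra
  ultimately have "reducible (h - 1) pX" using reducible_step by blast
  moreover have "h - 1 = [:- 3:] + g * pX" unfolding h_def by (simp add: numeral_poly one_pCons)
  ultimately have "reducible [:- 3:] pX" using reducible_mod_iff by blast
  then have "reducible pX [:- 3:]" by (rule reducible.swap)
  from reducible_lead_coeff_dvd[OF this] show False by simp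
qed

text \<open>\<open>finite_cf_orbit_step\<close> for Q = x, J = 1 and m = B - 1 + x g. The terms in
  1/x collect to 1 + (1 + e1)(B - 1) = B + e1 (B - 1), and the polynomial part is dropped.\<close>

lemma finite_cf_orbit_sum_3:
  assumes deg: "0 < degree f" and fin: "finite_cf (orbit_sum f (Suc (Suc 0)))"
    and g: "g = [:e0:] + [:e1:] * (pX - 1) + (pX - 1) ^ 2 * r" and f: "f = 1 + ([:B:] - 1) * pX + pX ^ 2 * g"
  shows "finite_cf (orbit_sum f (Suc (Suc (Suc 0)))) \<longleftrightarrow>
    reducible ([:e0 - 1, B + e1 * (B - 1):] * f ^ 2 + ([:B:] * f + 1)) (pX ^ 2 * f ^ 2)"
proof -
  define m where "m = ([:B:] - 1) + pX * g"
  have fm: "f = 1 + pX * m" unfolding m_def using f by algebra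
  have f1: "poly_iterate f (Suc 0) = f" by (simp add: pcompose_idR)
  have st: "coprime_state f (Suc 0) 1 m" unfolding coprime_state_def f1 using fm by simp
  have nz: "pX \<noteq> 0" "f \<noteq> 0" using deg by auto
  have "finite_cf (orbit_sum f (Suc (Suc (Suc 0)))) \<longleftrightarrow> finite_cf (L 1 / L pX + (1 + L [:e1:]) * L m / L pX +
    (L [:e0:] - 1) / L pX ^ 2 + L [:B:] / (L pX ^ 2 * L f) + 1 / (L pX * L f) ^ 2)"
    using finite_cf_orbit_step[OF f[unfolded g] _ _ _ deg st fin] unfolding f1 by simp
  also have "L 1 / L pX + (1 + L [:e1:]) * L m / L pX +
    (L [:e0:] - 1) / L pX ^ 2 + L [:B:] / (L pX ^ 2 * L f) + 1 / (L pX * L f) ^ 2 =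
    L ([:e0 - 1, B + e1 * (B - 1):] * f ^ 2 + ([:B:] * f + 1)) / L (pX ^ 2 * f ^ 2) + L ((1 + [:e1:]) * g)"
  proof -
    have lin: "[:e0 - 1, B + e1 * (B - 1):] = [:e0:] - 1 + ([:B:] + [:e1:] * ([:B:] - 1)) * pX"
      by (simp add: one_pCons)
    have nzL: "L pX \<noteq> 0" "L f \<noteq> 0" using nz by simp_all
    have frac: "1 / X + (1 + c1) * ((b - 1) + X * G) / X + (c0 - 1) / X ^ 2 + b / (X ^ 2 * F) + 1 / (X * F) ^ 2 =
      ((c0 - 1 + (b + c1 * (b - 1)) * X) * F ^ 2 + (b * F + 1)) / (X ^ 2 * F ^ 2) + (1 + c1) * G"
      if "X \<noteq> 0" "F \<noteq> 0" for X F G b c0 c1 :: "rat fls"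
      using that by (simp add: divide_simps) algebra
    show ?thesis unfolding lin m_def L_add L_diff L_mult L_power L_1 by (rule frac[OF nzL])
  qed
  finally show ?thesis using nz by (simp only: finite_cf_add_iff finite_cf_iff mult_eq_0_iff power_eq_0_iff simp_thms)
qed

text \<open>With four terms and Q = x f the criterion is (m - 2 f)/Q plus a very small term, up to a
  polynomial. As f = 1 + x m, m has lower degree than f, so the inverse has degree 1 and leading
  coefficient - 1/2.\<close>

lemma not_exceptional:
  assumes deg: "2 < degree f" and cf: "cf_limit (orbit_series f)"
  shows "f \<noteq> 1 + (0 - 1) * pX + pX ^ 2 * (1 + 1 * (pX - 1) + (pX - 1) ^ 2 * r)"
proof
  assume f: "f = 1 + (0 - 1) * pX + pX ^ 2 * (1 + 1 * (pX - 1) + (pX - 1) ^ 2 * r)"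
  define g where "g = 1 + 1 * (pX - 1) + (pX - 1) ^ 2 * r"
  define m where "m = - 1 + pX * g"
  have fm: "f = 1 + pX * m" unfolding m_def g_def by (subst f) algebra
  have deg': "0 < degree f" using deg by simp
  have f1: "poly_iterate f (Suc 0) = f" by (simp add: pcompose_idR)
  have st: "coprime_state f (Suc 0) 1 m" unfolding coprime_state_def f1 using fm by simp
  obtain R where st2: "coprime_state f (Suc (Suc 0)) (f * 1 + pX * m ^ 2) (m * (1 + 1 * f + f * (pX * m) * R))"
    using coprime_state_exists[OF f _ _ _ _ st] unfolding f1 by auto
  define J m2 F where "J = f * 1 + pX * m ^ 2" and "m2 = m * (1 + 1 * f + f * (pX * m) * R)"
    and "F = poly_iterate f (Suc (Suc 0))"
  have fin: "finite_cf (orbit_sum f n)" for n using orbit_sum_finite_cf[OF deg cf] .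
  have Q: "orbit_prod f (Suc (Suc 0)) = pX * f" by (simp add: pcompose_idR)
  have nz: "pX \<noteq> 0" "f \<noteq> 0" "F \<noteq> 0" using deg' poly_iterate_nonzero[OF deg', of "Suc (Suc 0)"] unfolding F_def[symmetric] by auto
  have "finite_cf (orbit_sum f (Suc (Suc (Suc (Suc 0))))) \<longleftrightarrow> finite_cf (L J / L (pX * f) + (1 + L 1) * L m2 / L (pX * f) +
    (L 1 - 1) / L (pX * f) ^ 2 + L 0 / (L (pX * f) ^ 2 * L F) + 1 / (L (pX * f) * L F) ^ 2)"
    using finite_cf_orbit_step[OF f _ _ _ deg' st2 fin] unfolding Q F_def[symmetric] J_def[symmetric] m2_def[symmetric] by simp
  moreover have "L J / L (pX * f) + (1 + L 1) * L m2 / L (pX * f) +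
    (L 1 - 1) / L (pX * f) ^ 2 + L 0 / (L (pX * f) ^ 2 * L F) + 1 / (L (pX * f) * L F) ^ 2 =
    L J / L (pX * f) + 2 * L m2 / L (pX * f) + 1 / (L (pX * f) * L F) ^ 2" by simp
  ultimately have "finite_cf (L J / L (pX * f) + 2 * L m2 / L (pX * f) + 1 / (L (pX * f) * L F) ^ 2)"
    using fin by (simp only:)
  note fin4 = this
  have "J + 2 * m2 = (m - 2 * f) + (pX * f) * (3 * g + 2 * m ^ 2 * R)"
    unfolding J_def m2_def using fm m_def by algebra
  then have "L J + 2 * L m2 = L (m - 2 * f) + L (pX * f) * L (3 * g + 2 * m ^ 2 * R)"
    by (metis L_add L_mult L_numeral)
  then have "L J / L (pX * f) + 2 * L m2 / L (pX * f) = L (m - 2 * f) / L (pX * f) + L (3 * g + 2 * m ^ 2 * R)"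
    using nz by (simp add: add_divide_distrib[symmetric] del: L_mult L_diff L_add) (simp add: add_divide_distrib del: L_mult L_diff L_add)
  from fin4[unfolded this]
  have "finite_cf (L (m - 2 * f) / L (pX * f) + 1 / (L (pX * f) * L F) ^ 2 + L (3 * g + 2 * m ^ 2 * R))"
    by (subst add.assoc, subst add.commute[of "1 / (L (pX * f) * L F) ^ 2"], subst add.assoc[symmetric])
  then have "finite_cf (L (m - 2 * f) / L (pX * f) + 1 / (L (pX * f) * L F) ^ 2)" by (simp only: finite_cf_add_iff)
  moreover have "L (m - 2 * f) / L (pX * f) + 1 / (L (pX * f) * L F) ^ 2 = L ((m - 2 * f) * (pX * f) * F ^ 2 + 1) / L ((pX * f * F) ^ 2)"
  proof -
    have "a / q + 1 / (q * c) ^ 2 = (a * q * c ^ 2 + 1) / (q * c) ^ 2" if "q \<noteq> 0" "c \<noteq> 0" for a q c :: "rat fls"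
      using that by (simp add: field_simps power2_eq_square)
    moreover have "L (pX * f) \<noteq> 0" "L F \<noteq> 0" using nz by simp_all
    moreover have "L ((m - 2 * f) * (pX * f) * F ^ 2 + 1) = L (m - 2 * f) * L (pX * f) * L F ^ 2 + 1"
      "L ((pX * f * F) ^ 2) = (L (pX * f) * L F) ^ 2"
      by (simp_all only: L_add L_mult L_power L_1)
    ultimately show ?thesis by metis
  qed
  moreover have "(pX * f * F) ^ 2 \<noteq> 0" using nz by simp
  ultimately have red: "reducible ((pX * f * F) ^ 2) ((m - 2 * f) * (pX * f) * F ^ 2 + 1)"
    by (metis finite_cf_iff reducible.swap)
  have "degree (f + - 1) = degree f" using deg' by (intro degree_add_eq_left) simp
  then have "degree f = degree (pX * m)" using fm by simp
  then have dm: "degree m < degree f" using deg' by (cases "m = 0") (simp_all add: degree_mult_eq)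
  have "degree (- (2 * f) + m) = degree f" "lead_coeff (- (2 * f) + m) = - 2 * lead_coeff f"
  proof -
    have d2: "degree (- (2 * f)) = degree f" "lead_coeff (- (2 * f)) = - 2 * lead_coeff f"
      by (simp_all add: degree_mult_eq lead_coeff_mult nz numeral_poly)
    then show "degree (- (2 * f) + m) = degree f" "lead_coeff (- (2 * f) + m) = - 2 * lead_coeff f"
      using dm lead_coeff_add_le[of m "- (2 * f)"] by (simp_all only: degree_add_eq_left)
  qed
  then have d1: "degree (m - 2 * f) = degree f" "lead_coeff (m - 2 * f) = - 2 * lead_coeff f" by simp_all
  then have mf: "m - 2 * f \<noteq> 0" using deg' by (metis degree_0 less_nat_zero_code)
  define n where "n = (m - 2 * f) * (pX * f) * F ^ 2"
  have n: "degree n = 2 * degree f + 1 + 2 * degree F"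
    unfolding n_def using nz mf d1(1) by (simp add: degree_mult_eq degree_power_eq del: mult_pCons_left mult_pCons_right)
  have n_lead: "lead_coeff n = - 2 * (lead_coeff f * lead_coeff f * lead_coeff F ^ 2)"
    unfolding n_def lead_coeff_mult lead_coeff_power d1(2) by simp
  have n': "degree (n + 1) = degree n" "lead_coeff (n + 1) = lead_coeff n"
    using n lead_coeff_add_le[of 1 n] by (simp_all add: degree_add_eq_left)
  have D: "degree ((pX * f * F) ^ 2) = 2 * degree f + 2 + 2 * degree F"
    using nz by (simp add: degree_mult_eq degree_power_eq del: mult_pCons_left mult_pCons_right)
  have D_lead: "lead_coeff ((pX * f * F) ^ 2) = lead_coeff f * lead_coeff f * lead_coeff F ^ 2"
    unfolding lead_coeff_mult lead_coeff_power by (simp add: power2_eq_square)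
  have "n + 1 \<noteq> 0" using n'(1) n by (metis degree_0 add_is_0 one_neq_zero)
  moreover have "degree (n + 1) < degree ((pX * f * F) ^ 2)" using n n'(1) D by linarith
  ultimately have "lead_coeff (n + 1) dvd lead_coeff ((pX * f * F) ^ 2)"
    using reducible_lead_coeff_dvd[OF red[folded n_def]] by blast
  then have "- 2 * (lead_coeff f * lead_coeff f * lead_coeff F ^ 2) dvd 1 * (lead_coeff f * lead_coeff f * lead_coeff F ^ 2)"
    unfolding n'(2) n_lead D_lead by (simp only: mult_1)
  then have "(- 2 :: int) dvd 1" by (rule dvd_mult_cancel_lead) (use nz in simp)
  then show False by simp
qed

lemma necessary_degree_3:
  assumes deg: "2 < degree f" and cf: "cf_limit (orbit_series f)" and pos: "0 \<le> coeff f 0"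
  shows "admissible f"
proof -
  have deg': "0 < degree f" using deg by simp
  note fin = orbit_sum_finite_cf[OF deg cf]
  define A B where "A = coeff f 0" and "B = coeff f 1 + 1"
  obtain g where "f = [:coeff f 0, coeff f 1:] + pX ^ 2 * g" by (rule poly_split_0)
  then have f: "f = [:A, B - 1:] + pX ^ 2 * g" by (simp add: A_def B_def)
  have "finite_cf (L (f + pX) / L (pX ^ 2))" using fin[of 2] finite_cf_orbit_sum_2[OF deg'] by blast
  then have "reducible (f + pX) (pX ^ 2)" by (subst (asm) finite_cf_iff) simp_all
  moreover have "f + pX = [:A, B:] + g * pX ^ 2" by (subst f) (simp add: mult.commute)
  ultimately have "reducible [:A, B:] (pX ^ 2)" using reducible_mod_iff by blast
  from reducible_linear_mod_square[OF this] pos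
  have A: "A = 0 \<or> A = 1" and B: "B \<in> {- 1, 0, 1}" by (auto simp: A_def)
  show ?thesis
  proof (cases "A = 0")
    case True
    have "B \<noteq> - 1"
      using not_minus_2X[OF deg cf, of g] f unfolding True by auto
    then show ?thesis using admissible_of_value_0[of f B g] f True B by auto
  next
    case False
    then have A1: "A = 1" using A by simp
    obtain q where q: "g = [:poly g 1:] + (pX - 1) * q" by (rule poly_split_1)
    obtain r where r: "q = [:poly q 1:] + (pX - 1) * r" by (rule poly_split_1)
    define e0 e1 where "e0 = poly g 1" and "e1 = poly q 1"
    have q': "g = [:e0:] + (pX - 1) * q" and r': "q = [:e1:] + (pX - 1) * r"
      using q r by (simp_all add: e0_def e1_def)
    then have g: "g = [:e0:] + [:e1:] * (pX - 1) + (pX - 1) ^ 2 * r" by algebra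
    have f': "f = 1 + ([:B:] - 1) * pX + pX ^ 2 * g"
      by (subst f) (simp add: A1 one_pCons)
    define \<alpha> \<beta> where "\<alpha> = e0 - 1" and "\<beta> = B + e1 * (B - 1)"
    have red: "reducible ([:\<alpha>, \<beta>:] * f ^ 2 + ([:B:] * f + 1)) (pX ^ 2 * f ^ 2)"
      using finite_cf_orbit_sum_3[OF deg' fin g f'] fin unfolding \<alpha>_def \<beta>_def by blast
    have "(B, \<alpha>, \<beta>) \<in> {(1, - 1, 1), (0, - 1, - 1), (0, 0, 0), (0, 0, 1), (0, 0, - 1), (- 1, 1, 1), (- 1, 0, - 1)}"
    proof (rule reducible_classification[OF _ deg red B])
      show "f = [:1, B - 1:] + pX ^ 2 * g" using f A1 by simp
      show "\<beta> = 1" if "B = 1" using that by (simp add: \<beta>_def)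
      \<comment> \<open>For B = -1 the value is - 1 - 2 e1, which is odd.\<close>
      show "\<beta> \<noteq> 0" if "B = - 1" using that unfolding \<beta>_def by presburger
    qed
    then consider "B = 1" "e0 = 0" | "B = 0" "e0 = 0" "e1 = 1" | "B = 0" "e0 = 1" "e1 = 0"
      | "B = 0" "e0 = 1" "e1 = - 1" | "B = 0" "e0 = 1" "e1 = 1" | "B = - 1" "e0 = 2" "e1 = - 1"
      | "B = - 1" "e0 = 1" "e1 = 0"
      unfolding \<alpha>_def \<beta>_def by auto
    then show ?thesis
    proof cases
      case 1
      have "f = 1 + pX ^ 2 * (pX - 1) * q" unfolding f' q' 1 pCons_0_0 one_pCons[symmetric] by algebra
      then show ?thesis unfolding admissible_def by blast
    next
      case 2
      have "f = (pX - 1) ^ 2 * (1 + pX + pX ^ 2 * r)"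
        unfolding f' g 2 pCons_0_0 one_pCons[symmetric] by algebra
      then show ?thesis unfolding admissible_def by blast
    next
      case 3
      have "f = 1 + (0 - 1) * pX + pX ^ 2 * (1 + 0 * (pX - 1) + (pX - 1) ^ 2 * r)"
        unfolding f' g 3 by (simp add: one_pCons)
      then show ?thesis unfolding admissible_def by blast
    next
      case 4
      have "f = 1 + (0 - 1) * pX + pX ^ 2 * (1 + (- 1) * (pX - 1) + (pX - 1) ^ 2 * r)"
        unfolding f' g 4 by (simp add: one_pCons)
      then show ?thesis unfolding admissible_def by blast
    next
      case 5
      have "f = 1 + (0 - 1) * pX + pX ^ 2 * (1 + 1 * (pX - 1) + (pX - 1) ^ 2 * r)"
        unfolding f' g 5 by (simp add: one_pCons)
      then show ?thesis using not_exceptional[OF deg cf] by blast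
    next
      case 6
      have "f = 1 + (- 1 - 1) * pX + pX ^ 2 * (2 + (- 1) * (pX - 1) + (pX - 1) ^ 2 * r)"
        unfolding f' g 6 by (simp add: one_pCons numeral_poly)
      then show ?thesis unfolding admissible_def by blast
    next
      case 7
      have e: "f = 1 - 2 * pX + pX ^ 2 * (1 + (pX - 1) ^ 2 * r)"
        unfolding f' g 7 by (simp add: one_pCons numeral_poly)
      have "f = (pX - 1) ^ 2 * (1 + pX ^ 2 * r)" unfolding e by algebra
      then show ?thesis unfolding admissible_def by blast
    qed
  qed
qed

section \<open>Necessity in degree 2\<close>

lemma fls_lc_of_int [simp]: "fls_lc (of_int n) = of_int n"
  by (simp add: fls_lc_def fls_of_int_nth)

lemma fls_lc_numeral [simp]: "fls_lc (numeral n) = numeral n"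
  using fls_lc_of_int[of "numeral n"] by (simp del: fls_lc_of_int)

definition orbit_tail :: "int poly \<Rightarrow> nat \<Rightarrow> rat fls" where
  "orbit_tail f n = orbit_series f - orbit_sum f n"

text \<open>Chosen so that inverting the tail gives \<open>1 / orbit_tail f n\<close> = f^n -
  1/\<open>quadratic_quot f n\<close>. In degree 2 this quotient has degree 0 and leading
  coefficient that of f.\<close>

definition quadratic_quot :: "int poly \<Rightarrow> nat \<Rightarrow> rat fls" where
  "quadratic_quot f n = 1 / L (poly_iterate f n) + 1 / (L (poly_iterate f n) ^ 2 * orbit_tail f (Suc n))"

lemma orbit_tail_step: "orbit_tail f n = 1 / L (poly_iterate f n) + orbit_tail f (Suc n)"
  by (simp add: orbit_tail_def)

lemma dominant_term:
  assumes "s \<noteq> 0" "tiny (fls_subdegree s) t"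
  shows "s + t \<noteq> 0" "fls_subdegree (s + t) = fls_subdegree s" "fls_lc (s + t) = fls_lc s"
  using tiny_subdegree_eq[OF assms(1), of "s + t"] assms(2) by simp_all

lemma orbit_tail_lead:
  assumes "1 < degree f"
  shows "orbit_tail f n \<noteq> 0" "fls_subdegree (orbit_tail f n) = int (degree f ^ n)"
    "fls_lc (orbit_tail f n) = 1 / of_int (lead_coeff (poly_iterate f n))"
proof -
  define s where "s = 1 / L (poly_iterate f n)"
  have nz: "L (poly_iterate f n) \<noteq> 0" using assms by (simp add: poly_iterate_nonzero)
  then have s: "s \<noteq> 0" "fls_subdegree s = int (degree f ^ n)" "fls_lc s = 1 / of_int (lead_coeff (poly_iterate f n))"
    by (simp_all add: s_def degree_poly_iterate)
  have "degree f ^ n < degree f ^ Suc n" using assms by (intro power_strict_increasing) simp_all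
  then have "tiny (fls_subdegree s) (orbit_tail f (Suc n))"
    using orbit_series_tail[OF assms, of "Suc n"] unfolding orbit_tail_def s(2) by (elim tiny_mono) linarith
  from dominant_term[OF s(1) this]
  show "orbit_tail f n \<noteq> 0" "fls_subdegree (orbit_tail f n) = int (degree f ^ n)"
    "fls_lc (orbit_tail f n) = 1 / of_int (lead_coeff (poly_iterate f n))"
    unfolding s(2,3) unfolding s_def orbit_tail_step[of f n, symmetric] by simp_all
qed

lemma quadratic_quot_lead:
  assumes "degree f = 2"
  shows "quadratic_quot f n \<noteq> 0" "fls_subdegree (quadratic_quot f n) = 0" "fls_lc (quadratic_quot f n) = of_int (lead_coeff f)"
proof -
  define F T where "F = L (poly_iterate f n)" and "T = orbit_tail f (Suc n)"
  have deg: "1 < degree f" using assms by simp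
  have F: "F \<noteq> 0" "fls_subdegree F = - (2 ^ n)" "fls_lc F = of_int (lead_coeff (poly_iterate f n))"
    using poly_iterate_nonzero[of f n] assms by (simp_all add: F_def degree_poly_iterate)
  note T = orbit_tail_lead[OF deg, of "Suc n", folded T_def]
  have lead: "lead_coeff (poly_iterate f (Suc n)) = lead_coeff f * lead_coeff (poly_iterate f n) ^ 2"
    using assms by (simp add: degree_poly_iterate lead_coeff_comp[of "poly_iterate f n" f])
  define s where "s = 1 / (F ^ 2 * T)"
  have s: "s \<noteq> 0" "fls_subdegree s = 0" "fls_lc s = of_int (lead_coeff f)"
    using F T poly_iterate_nonzero[of f n] assms unfolding s_def
    by (simp_all add: lead power2_eq_square del: poly_iterate_Suc)
  have "tiny (fls_subdegree s) (1 / F)" using F s by (simp add: tiny_iff)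
  from dominant_term[OF s(1) this]
  show "quadratic_quot f n \<noteq> 0" "fls_subdegree (quadratic_quot f n) = 0" "fls_lc (quadratic_quot f n) = of_int (lead_coeff f)"
    unfolding s quadratic_quot_def F_def[symmetric] T_def[symmetric] s_def[symmetric] add.commute[of "1 / F"] .
qed

lemma inverse_orbit_tail:
  assumes "1 < degree f"
  shows "1 / orbit_tail f n = L (poly_iterate f n) - 1 / quadratic_quot f n"
proof -
  define F T where "F = L (poly_iterate f n)" and "T = orbit_tail f (Suc n)"
  have nz: "F \<noteq> 0" "T \<noteq> 0" "1 / F + T \<noteq> 0"
    using poly_iterate_nonzero[of f n] assms orbit_tail_lead(1)[OF assms, of n] orbit_tail_lead(1)[OF assms, of "Suc n"]
    by (simp_all add: F_def T_def flip: orbit_tail_step)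
  then have D: "1 + F * T \<noteq> 0" by (auto simp: field_simps)
  have "1 / F + 1 / (F ^ 2 * T) = (1 + F * T) / (F ^ 2 * T)" using nz by (simp add: field_simps power2_eq_square)
  moreover have "1 / F + T = (1 + F * T) / F" using nz by (simp add: field_simps)
  ultimately have "1 / (1 / F + T) = F - 1 / (1 / F + 1 / (F ^ 2 * T))"
    using nz(1,2) D by (simp add: field_simps power2_eq_square)
  then show ?thesis unfolding orbit_tail_step[of f n] quadratic_quot_def F_def T_def .
qed

text \<open>Expand 1/tail through the next quotient and f^(n+1) through f. The summand 1/F in the
  definition raises the linear coefficient from B - 1 to B.\<close>

lemma quadratic_quot_recursion:
  assumes f: "f = [:A, B - 1, c:]" and "c \<noteq> 0"
  defines "F n \<equiv> L (poly_iterate f n)"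
  shows "quadratic_quot f n = of_int c + (of_int B * F n + of_int A - 1 / quadratic_quot f (Suc n)) / F n ^ 2"
proof -
  have deg: "1 < degree f" using assms by simp
  have nz: "F n \<noteq> 0" using deg by (simp add: F_def poly_iterate_nonzero)
  have "F (Suc n) = of_int A + (of_int B - 1) * F n + of_int c * F n ^ 2"
    unfolding F_def poly_iterate_Suc f by (simp add: pcompose_pCons power2_eq_square algebra_simps L_smult)
  then have "1 / orbit_tail f (Suc n) = of_int A + (of_int B - 1) * F n + of_int c * F n ^ 2 - 1 / quadratic_quot f (Suc n)"
    using inverse_orbit_tail[OF deg, of "Suc n"] by (simp add: F_def)
  moreover have "quadratic_quot f n = 1 / F n + (1 / orbit_tail f (Suc n)) / F n ^ 2"
    by (simp add: quadratic_quot_def F_def)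
  ultimately show ?thesis using nz by (simp add: field_simps power2_eq_square)
qed

lemma cf_limit_inverse_lc:
  assumes "cf_limit s" "0 < fls_subdegree s" shows "1 / fls_lc s \<in> \<int>"
proof -
  have "fls_subdegree (inverse s) < 0" using assms(2) by simp
  from cf_limit_lc_Ints[OF cf_limit_inverse[OF assms(1)] this] show ?thesis by (simp add: divide_inverse)
qed

lemma inverse_Ints_imp_unit: "1 / of_int a \<in> (\<int> :: rat set) \<Longrightarrow> a \<in> {- 1, 0, 1}"
proof -
  assume "1 / of_int a \<in> (\<int> :: rat set)"
  then obtain k where k: "1 / of_int a = (of_int k :: rat)" by (elim Ints_cases)
  show ?thesis
  proof (cases "a = 0")
    case False
    then have "(of_int (k * a) :: rat) = 1" using k by (simp add: field_simps)
    then have "a * k = 1" by (simp only: of_int_eq_1_iff mult.commute)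
    then show ?thesis using int_dvd_1[of a] by (metis dvd_triv_left insert_iff)
  qed simp
qed

lemma quadratic_first:
  assumes f: "f = [:A, B - 1, c:]" and "c \<noteq> 0" and cf: "cf_limit (orbit_series f)"
  shows "cf_limit ((of_int B * L pX + of_int A - 1 / quadratic_quot f 1) / L pX ^ 2)"
proof -
  have deg: "1 < degree f" using assms by simp
  have "1 / orbit_series f = L pX - 1 / quadratic_quot f 0"
    using inverse_orbit_tail[OF deg, of 0] by (simp add: orbit_tail_def)
  then have "quadratic_quot f 0 = inverse (- (inverse (orbit_series f) - L pX))"
    by (simp add: inverse_eq_divide)
  moreover have "cf_limit (inverse (- (inverse (orbit_series f) - L pX)))"
    using cf by (intro cf_limit_inverse cf_limit_minus cf_limit_diff_L)
  ultimately have "cf_limit (quadratic_quot f 0 - L [:c:])" using cf_limit_diff_L by metis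
  then show ?thesis using quadratic_quot_recursion[OF f assms(2), of 0] by simp
qed

lemma subdegree_plus_of_int:
  assumes "fls_subdegree r = 0" "r \<noteq> 0" "fls_lc r \<noteq> of_int A"
  shows "of_int A - r \<noteq> 0" "fls_subdegree (of_int A - r) = 0" "fls_lc (of_int A - r) = of_int A - fls_lc r"
proof -
  have 0: "(of_int A - r) $$ 0 = of_int A - fls_lc r"
    using assms(1) by (simp add: fls_lc_def fls_of_int_nth)
  then have "(of_int A - r) $$ 0 \<noteq> 0" using assms(3) by simp
  then show "of_int A - r \<noteq> 0" by force
  show "fls_subdegree (of_int A - r) = 0"
    by (rule fls_subdegree_eqI) (use \<open>(of_int A - r) $$ 0 \<noteq> 0\<close> assms(1) in \<open>simp_all add: fls_of_int_nth\<close>)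
  then show "fls_lc (of_int A - r) = of_int A - fls_lc r" using 0 by (simp add: fls_lc_def)
qed

text \<open>The conditions come from successive complete quotients of the series, starting with (B X
  + A - \<rho>)/X^2, where \<rho> has degree 0 and leading coefficient 1/c. Its inverse shows that B
  is 0 or a unit; for B = 0 it also restricts c A, while for B a unit two further inversions are
  made.\<close>

lemma quadratic_classification:
  assumes f: "f = [:A, B - 1, c:]" and c: "c \<noteq> 0" and cf: "cf_limit (orbit_series f)"
  shows "B \<in> {- 1, 0, 1}" "(A, B) \<noteq> (0, - 1)" "c * A \<in> {0, 1, 2}"
proof -
  have deg: "degree f = 2" using f c by simp
  define X F \<rho> \<rho>' where "X = L pX" and "F = L f" and "\<rho> = 1 / quadratic_quot f 1" and "\<rho>' = 1 / quadratic_quot f 2"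
  have lead: "lead_coeff f = c" using f c by simp
  have \<rho>: "\<rho> \<noteq> 0" "fls_subdegree \<rho> = 0" "fls_lc \<rho> = 1 / of_int c"
    and \<rho>': "\<rho>' \<noteq> 0" "fls_subdegree \<rho>' = 0" "fls_lc \<rho>' = 1 / of_int c"
    using quadratic_quot_lead[OF deg] unfolding lead \<rho>_def \<rho>'_def by simp_all
  have X: "X \<noteq> 0" "fls_subdegree X = - 1" "fls_lc X = 1" "fls_subdegree (X ^ 2) = - 2" "fls_lc (X ^ 2) = 1"
    by (simp_all add: X_def power2_eq_square del: L_mult)
  have F: "F \<noteq> 0" "fls_subdegree F = - 2" "fls_lc F = of_int c" 
    using deg lead by (auto simp: F_def)
  then have F2: "fls_subdegree (F ^ 2) = - 4" by (simp add: power2_eq_square)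
  have rec: "1 / \<rho> = of_int c + (of_int B * F + of_int A - \<rho>') / F ^ 2"
    using quadratic_quot_recursion[OF f c, of 1] by (simp add: \<rho>_def \<rho>'_def F_def pcompose_idR numeral_2_eq_2)
  have delta: "cf_limit ((of_int B * X + of_int A - \<rho>) / X ^ 2)"
    using quadratic_first[OF f c cf] by (simp add: X_def \<rho>_def)
  have tinyI: "tiny K s" if "K < fls_subdegree s" for K s using that by (simp add: tiny_iff)
  have tiny_A\<rho>: "tiny (- 1) (of_int A - \<rho>)" "tiny (- 1) (of_int A - \<rho>')"
    using \<rho>(2) \<rho>'(2) by (simp_all add: tiny_diff tinyI)

  have num: "of_int B * X + of_int A - \<rho> \<noteq> 0" "fls_subdegree (of_int B * X + of_int A - \<rho>) = - 1"
    "fls_lc (of_int B * X + of_int A - \<rho>) = of_int B" if "B \<noteq> 0"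
  proof -
    have s: "of_int B * X \<noteq> 0" "fls_subdegree (of_int B * X) = - 1" "fls_lc (of_int B * X) = of_int B"
      using that X by simp_all
    from dominant_term[OF s(1), of "of_int A - \<rho>"] tiny_A\<rho>
    show "of_int B * X + of_int A - \<rho> \<noteq> 0" "fls_subdegree (of_int B * X + of_int A - \<rho>) = - 1"
      "fls_lc (of_int B * X + of_int A - \<rho>) = of_int B" unfolding s(2,3) add_diff_eq by blast+
  qed
  show B: "B \<in> {- 1, 0, 1}"
  proof (cases "B = 0")
    case False
    have "0 < fls_subdegree ((of_int B * X + of_int A - \<rho>) / X ^ 2)" using num[OF False] X by simp
    from cf_limit_inverse_lc[OF delta this] have "1 / of_int B \<in> (\<int> :: rat set)" using num[OF False] X by simp
    then show ?thesis by (rule inverse_Ints_imp_unit)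
  qed simp
  have second: "cf_limit (\<rho> + (of_int A - \<rho>) ^ 2 / (of_int B * X + of_int A - \<rho>))" if "B \<noteq> 0"
  proof -
    have BB: "B * B = 1" using B that by auto
    then have BB': "of_int B * of_int B = (1 :: rat fls)" by (metis of_int_1 of_int_mult)
    have "L [:- A, B:] = of_int B * X - of_int A" by (simp add: X_def L_pCons)
    moreover have "cf_limit (inverse ((of_int B * X + of_int A - \<rho>) / X ^ 2) - L [:- A, B:])"
      using delta by (intro cf_limit_diff_L cf_limit_inverse)
    moreover have "inverse ((of_int B * X + of_int A - \<rho>) / X ^ 2) - (of_int B * X - of_int A) =
      \<rho> + (of_int A - \<rho>) ^ 2 / (of_int B * X + of_int A - \<rho>)"
    proof -
      have "X ^ 2 = (of_int B * X + of_int A - \<rho>) * (of_int B * X - (of_int A - \<rho>)) + (of_int A - \<rho>) ^ 2"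
        using BB' by algebra
      then have "X ^ 2 / (of_int B * X + of_int A - \<rho>) = (of_int B * X - (of_int A - \<rho>)) + (of_int A - \<rho>) ^ 2 / (of_int B * X + of_int A - \<rho>)"
        using num(1)[OF that] by (simp add: add_divide_distrib)
      then show ?thesis by simp
    qed
    ultimately show ?thesis by metis
  qed
  \<comment> \<open>Now F = X h with h = c X - 2, and four inversions after the starting quotient
    produce (h - 1)/X = c - 3/X up to a smaller error, the same - 3/x as in
    \<open>not_minus_2X\<close>.\<close>
  show "(A, B) \<noteq> (0, - 1)"
  proof
    assume "(A, B) = (0, - 1)"
    then have A: "A = 0" and Bm: "B = - 1" by simp_all
    define h where "h = of_int c * X - 2"
    have Fh: "F = X * h" 
      using Bm A by (simp add: F_def f L_pCons h_def X_def algebra_simps) 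
    have Xr: "X + \<rho> \<noteq> 0"
      using dominant_term(1)[OF X(1), of \<rho>] X(2) \<rho>(2) by (simp add: tiny_iff)
    have h: "h \<noteq> 0" "fls_subdegree h = - 1" using F X Fh by auto
    have Xhr: "X * h + \<rho>' \<noteq> 0" "fls_subdegree (X * h + \<rho>') = - 2"
      using dominant_term[of "X * h" \<rho>'] X h \<rho>' by (simp_all add: tiny_iff)
    have "cf_limit (inverse (\<rho> + (of_int A - \<rho>) ^ 2 / (of_int B * X + of_int A - \<rho>)) - L [:c:])"
      using second Bm by (intro cf_limit_diff_L cf_limit_inverse) simp
    moreover have "inverse (\<rho> + (of_int A - \<rho>) ^ 2 / (of_int B * X + of_int A - \<rho>)) = 1 / \<rho> + 1 / X"
    proof -
      have e: "of_int B * X + of_int A - \<rho> = - (X + \<rho>)" using A Bm by simp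
      have "\<rho> + (of_int A - \<rho>) ^ 2 / (of_int B * X + of_int A - \<rho>) = \<rho> * X / (X + \<rho>)"
      proof -
        have "r + (0 - r) ^ 2 / (- d) = r * (d - r) / d" if "d \<noteq> 0" for r d :: "rat fls"
          using that by (simp add: field_simps power2_eq_square)
        from this[OF Xr, of \<rho>] show ?thesis unfolding e unfolding A by simp
      qed
      then show ?thesis using \<rho>(1) X(1) by (simp add: field_simps)
    qed
    moreover have "1 / \<rho> + 1 / X - L [:c:] = ((h - 1) * (X * h) - \<rho>') / (X * h) ^ 2"
      unfolding rec using A Bm X h unfolding Fh by (simp add: field_simps power2_eq_square)
    ultimately have "cf_limit (((h - 1) * (X * h) - \<rho>') / (X * h) ^ 2)" by simp
    then have "cf_limit (inverse (inverse (((h - 1) * (X * h) - \<rho>') / (X * h) ^ 2) - L pX) - L [:c:])"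
      by (intro cf_limit_diff_L cf_limit_inverse)
    moreover have "inverse (inverse (((h - 1) * (X * h) - \<rho>') / (X * h) ^ 2) - L pX) - L [:c:] =
      - 3 / X - h * \<rho>' / (X * (X * h + \<rho>'))"
    proof -
      define N where "N = (h - 1) * (X * h) - \<rho>'"
      have h1: "h - 1 \<noteq> 0" "fls_subdegree (h - 1) = - 1"
        using dominant_term[of h "- 1"] h by (simp_all add: tiny_iff)
      have N: "N \<noteq> 0"
        using dominant_term(1)[of "(h - 1) * (X * h)" "- \<rho>'"] h1 h X \<rho>' by (simp add: N_def tiny_iff)
      have "inverse (N / (X * h) ^ 2) - X = X * (X * h + \<rho>') / N"
        using N by (simp add: field_simps) (simp add: N_def algebra_simps power2_eq_square)
      then have "inverse (inverse (N / (X * h) ^ 2) - X) = N / (X * (X * h + \<rho>'))" by simp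
      also have "\<dots> = (h - 1) / X - h * \<rho>' / (X * (X * h + \<rho>'))"
      proof -
        have "N = (h - 1) * (X * h + \<rho>') - h * \<rho>'" by (simp add: N_def algebra_simps)
        then show ?thesis using Xhr X by (simp add: diff_divide_distrib)
      qed
      also have "(h - 1) / X = of_int c - 3 / X" using X by (simp add: h_def field_simps)
      finally show ?thesis unfolding N_def X_def by simp
    qed
    ultimately have lim: "cf_limit (- 3 / X + - (h * \<rho>' / (X * (X * h + \<rho>'))))" by simp
    have s: "- 3 / X \<noteq> 0" "fls_subdegree (- 3 / X) = 1" "fls_lc (- 3 / X) = - 3"
      using X by simp_all
    have "tiny 1 (- (h * \<rho>' / (X * (X * h + \<rho>'))))"
      using h \<rho>' Xhr X by (simp add: tiny_iff)
    with dominant_term[OF s(1), of "- (h * \<rho>' / (X * (X * h + \<rho>')))"] s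
    have "1 / (- 3) \<in> (\<int> :: rat set)" using cf_limit_inverse_lc[OF lim] by simp
    then show False using inverse_Ints_imp_unit[of "- 3"] by simp
  qed
  show "c * A \<in> {0, 1, 2}"
  proof (cases "c * A = 1")
    case False
    have ne: "fls_lc \<rho> \<noteq> of_int A"
    proof
      assume "fls_lc \<rho> = of_int A"
      then have "(of_int (c * A) :: rat) = 1" using c by (simp add: \<rho>(3) field_simps)
      then show False using False by (simp only: of_int_eq_1_iff)
    qed
    note Ar = subdegree_plus_of_int[OF \<rho>(2,1) ne]
    have lcAr: "fls_lc (of_int A - \<rho>) = of_int (c * A - 1) / of_int c"
      using c by (simp add: Ar(3) \<rho>(3) field_simps)
    show ?thesis
    proof (cases "B = 0")
      case True
      have "0 < fls_subdegree ((of_int B * X + of_int A - \<rho>) / X ^ 2)" using True Ar(1,2) X by simp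
      from cf_limit_inverse_lc[OF delta this] have "of_int c / of_int (c * A - 1) \<in> (\<int> :: rat set)"
        using True X lcAr by simp
      then obtain k where "of_int c / of_int (c * A - 1) = (of_int k :: rat)" by (elim Ints_cases)
      moreover have "(of_int (c * A - 1) :: rat) \<noteq> 0" using False by (simp only: of_int_eq_0_iff)
      ultimately have "(of_int c :: rat) = of_int (k * (c * A - 1))"
        by (simp only: nonzero_divide_eq_eq of_int_mult not_False_eq_True)
      then have "c = k * (c * A - 1)" by (simp only: of_int_eq_iff)
      then have "(c * A - 1) * (k * A - 1) = 1" by algebra
      then have "c * A - 1 \<in> {- 1, 1}" using int_dvd_1 by (metis dvd_triv_left)
      then show ?thesis by auto
    next
      case Bn: False
      define D \<mu> v where "D = of_int B * X + of_int A - \<rho>" and "\<mu> = (of_int A - \<rho>) ^ 2 / D" and "v = \<rho> + \<mu>"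
      note D = num[OF Bn, folded D_def]
      have \<mu>: "\<mu> \<noteq> 0" "fls_subdegree \<mu> = 1" "fls_lc \<mu> = (of_int (c * A - 1) / of_int c) ^ 2 / of_int B"
        using Ar(1,2) D lcAr by (simp_all add: \<mu>_def power2_eq_square)
      have v: "v \<noteq> 0" "fls_subdegree v = 0" "fls_lc v = 1 / of_int c"
        using dominant_term[OF \<rho>(1), of \<mu>] \<rho> \<mu> by (simp_all add: v_def tiny_iff)
      define e where "e = \<rho> * ((of_int B * F + of_int A - \<rho>') / F ^ 2)"
      have e: "1 - of_int c * \<rho> = e" using rec \<rho>(1) by (simp add: e_def field_simps)
      have "tiny (- 3) (of_int B * F + of_int A - \<rho>')"
      proof -
        have "tiny (- 3) (of_int B * F)" using F Bn by (simp add: tiny_iff)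
        moreover have "tiny (- 3) (of_int A - \<rho>')" using tiny_A\<rho>(2) by (rule tiny_mono) simp
        ultimately show ?thesis unfolding add_diff_eq[symmetric] by (rule tiny_add)
      qed
      then have "tiny (- 3 + 4) ((of_int B * F + of_int A - \<rho>') * (\<rho> / F ^ 2))"
        using \<rho> F F2 by (intro tiny_mult) simp_all
      then have tiny_e: "tiny 1 e" by (simp add: e_def mult.commute)
      \<comment> \<open>Since v = \<rho> + \<mu> and 1/\<rho> is c up to an error smaller than
        \<mu>, 1/v - c is dominated by - c \<mu>/v, with leading coefficient - (c A - 1)^2/B. The
        inverse of this must be an integer.\<close>
      define s where "s = - (of_int c * \<mu>) / v"
      have s: "s \<noteq> 0" "fls_subdegree s = 1" "fls_lc s = - (of_int ((c * A - 1) ^ 2) / of_int B)"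
        using \<mu> v c by (simp_all add: s_def power2_eq_square)
      have "tiny (1 + 0) (e * inverse v)" using tiny_e v by (intro tiny_mult) simp_all
      then have "tiny (fls_subdegree s) (e / v)" by (simp add: s(2) divide_inverse)
      note w = dominant_term[OF s(1) this]
      have "cf_limit (inverse v - L [:c:])"
        using second[OF Bn] unfolding v_def \<mu>_def D_def by (intro cf_limit_diff_L cf_limit_inverse)
      moreover have "inverse v - L [:c:] = s + e / v"
      proof -
        have "s + e / v = (- (of_int c * \<mu>) + (1 - of_int c * \<rho>)) / v"
          unfolding e[symmetric] s_def by (simp only: add_divide_distrib)
        also have "- (of_int c * \<mu>) + (1 - of_int c * \<rho>) = 1 - of_int c * v" by (simp add: v_def algebra_simps)
        also have "(1 - of_int c * v) / v = inverse v - L [:c:]"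
          using v(1) by (simp add: diff_divide_distrib inverse_eq_divide)
        finally show ?thesis by simp
      qed
      ultimately have "1 / fls_lc s \<in> \<int>" using cf_limit_inverse_lc[of "s + e / v"] w s(2) by simp
      moreover have "1 / fls_lc s = - (of_int B / of_int ((c * A - 1) ^ 2))" unfolding s(3) by simp
      ultimately have "of_int B / of_int ((c * A - 1) ^ 2) \<in> (\<int> :: rat set)" using Ints_minus by fastforce
      moreover have "of_int B / of_int ((c * A - 1) ^ 2) = (1 / of_int ((c * A - 1) ^ 2) :: rat) \<or>
        of_int B / of_int ((c * A - 1) ^ 2) = - (1 / of_int ((c * A - 1) ^ 2) :: rat)" using B Bn by auto
      ultimately have "1 / of_int ((c * A - 1) ^ 2) \<in> (\<int> :: rat set)" using Ints_minus by fastforce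
      then have "(c * A - 1) ^ 2 \<in> {- 1, 0, 1}" by (rule inverse_Ints_imp_unit)
      then have "(c * A - 1) ^ 2 = 1" using False zero_le_power2[of "c * A - 1"] by auto
      then have "c * A - 1 \<in> {- 1, 1}" by (simp add: power2_eq_1_iff disj_commute)
      then show ?thesis by auto
    qed
  qed simp
qed

text \<open>The value of [b0, ..., bk, u/w], with v = (u, w) the last complete quotient, as a pair
  computed without division.\<close>

fun cf_vector :: "int poly list \<Rightarrow> int poly \<times> int poly \<Rightarrow> int poly \<times> int poly" where
  "cf_vector [] v = v"
| "cf_vector (b # bs) v = (case cf_vector bs v of (p, q) \<Rightarrow> (b * p + q, p))"

lemma reducible_cf_vector: "cf_vector bs v = (p, q) \<Longrightarrow> reducible p q \<Longrightarrow> reducible (fst v) (snd v)"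
proof (induction bs arbitrary: p q)
  case (Cons b bs)
  obtain p' q' where pq: "cf_vector bs v = (p', q')" by fastforce
  then have "p = b * p' + q'" "q = p'" using Cons.prems(1) by auto
  then have "reducible p' q'" using Cons.prems(2) reducible_step by blast
  with pq show ?case by (rule Cons.IH)
qed simp

text \<open>If p/q is so close to the sum that it would be a convergent of it, and u/w, a complete quotient of p/q, has no
  integral polynomial part, then the sum is not specializable.\<close>

lemma not_cf_limit_quadratic:
  assumes deg: "degree f = 2" and v: "cf_vector bs ([:u0, u1:], [:w:]) = (p, q)" and w: "w \<noteq> 0" "u1 \<noteq> 0" "\<not> w dvd u1"
    and q: "q \<noteq> 0" "2 * degree q < 2 ^ n"
    and r: "degree (orbit_num f n * q - p * orbit_prod f n) + degree q < degree (orbit_prod f n)"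
  shows "\<not> cf_limit (orbit_series f)"
proof
  assume cf: "cf_limit (orbit_series f)"
  have deg': "1 < degree f" "0 < degree f" using deg by simp_all
  define R Q where "R = orbit_num f n * q - p * orbit_prod f n" and "Q = orbit_prod f n"
  have Q: "Q \<noteq> 0" using deg' by (simp add: Q_def orbit_prod_nonzero)
  \<comment> \<open>The distance from the series to p/q is split at the partial sum with n terms:
    the tail is controlled by 2 deg q < 2^n, the rest by the degree of \<open>R\<close>.\<close>
  have "int (2 * degree q) < int (2 ^ n)" using q(2) by (simp only: of_nat_less_iff)
  then have "tiny (2 * int (degree q)) (orbit_series f - orbit_sum f n)"
    using orbit_series_tail[OF deg'(1), of n] unfolding deg by (elim tiny_mono) simp
  moreover have "orbit_sum f n - L p / L q = L R / L (Q * q)"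
    using Q q by (simp add: orbit_sum_eq[OF deg'(2)] R_def Q_def field_simps)
  moreover have "tiny (2 * int (degree q)) (L R / L (Q * q))"
  proof (cases "R = 0")
    case False
    then have "fls_subdegree (L R / L (Q * q)) = int (degree Q) + int (degree q) - int (degree R)"
      using Q q by (subst fls_subdegree_divide) (simp_all add: degree_mult_eq del: L_mult)
    moreover have "degree R + degree q < degree Q" using r by (simp only: R_def Q_def)
    ultimately show ?thesis unfolding tiny_iff by linarith
  qed simp
  ultimately have "tiny (2 * int (degree q)) ((orbit_series f - orbit_sum f n) + (orbit_sum f n - L p / L q))"
    by (simp only: tiny_add)
  then have "tiny (2 * int (degree q)) (orbit_series f - L p / L q)" by simp
  then have "finite_cf (L p / L q)" using cf_limit_approximant[OF cf q(1)] by blast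
  then have "reducible p q" using q(1) by (simp add: finite_cf_iff)
  then have "reducible [:u0, u1:] [:w:]" using reducible_cf_vector[OF v] by simp
  from reducible_lead_coeff_dvd[OF this] show False using w by simp
qed

text \<open>The lists are the regular continued fractions of the partial sums with n terms, up to the first complete quotient
  whose polynomial part is not integral.\<close>

lemma not_cf_limit_examples:
  "\<not> cf_limit (orbit_series [:2, - 2, 1:])"
  "\<not> cf_limit (orbit_series [:2, 0, 1:])"
  "\<not> cf_limit (orbit_series [:2, - 1, 1:])"
  "\<not> cf_limit (orbit_series [:1, 0, 2:])"
  "\<not> cf_limit (orbit_series [:1, - 1, 2:])"
  "\<not> cf_limit (orbit_series [:1, - 2, 2:])"
  "\<not> cf_limit (orbit_series [:1, 0, 1:])"
  subgoal
    by (rule not_cf_limit_quadratic[where n = 4 and bs = "[0, [:- 2, 1:], 1, [:- 1, 1:], [:0, 1:]]" and ?u0.0 = "- 8" and ?u1.0 = 3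
      and w = 9 and p = "[:- 8, 12, - 8, 3:]" and q = "[:- 1, - 12, 17, - 11, 3:]"])
      (simp_all add: eval_nat_numeral pcompose_pCons)
  subgoal
    by (rule not_cf_limit_quadratic[where n = 4 and bs = "[0, [:- 1, 1:], [:0, 1:], [:2, 1:], [:2, 1:]]" and ?u0.0 = "- 28" and ?u1.0 = 9
      and w = 81 and p = "[:25, 12, 23, 8, 9:]" and q = "[:- 3, 27, - 3, 24, - 1, 9:]"])
      (simp_all add: eval_nat_numeral pcompose_pCons)
  subgoal
    by (rule not_cf_limit_quadratic[where n = 4 and bs = "[0, [:- 1, 1:], [:0, 0, 1:], 1, [:3, - 2, 1:], 1]" and ?u0.0 = "- 5" and ?u1.0 = 2
      and w = 8 and p = "[:4, 2, 6, 6, - 1, 2:]" and q = "[:3, 6, - 5, 2, 7, - 3, 2:]"])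
      (simp_all add: eval_nat_numeral pcompose_pCons)
  subgoal
    by (rule not_cf_limit_quadratic[where n = 4 and bs = "[0, [:- 1, 1:], 1, 1, [:- 1, 1:], 1, 1, [:0, 1:], 1, 1, [:0, 1:], 1, 1]"
      and ?u0.0 = "- 109" and ?u1.0 = 18
      and w = 162 and p = "[:50, 48, 184, 128, 288:]" and q = "[:- 3, 54, - 12, 192, - 16, 288:]"])
      (simp_all add: eval_nat_numeral pcompose_pCons)
  subgoal
    by (rule not_cf_limit_quadratic[where n = 4 and bs = "[0, [:- 1, 1:], 1, 1, [:- 1, 0, 2:], 1, [:8, - 8, 8:], 1]"
      and ?u0.0 = "- 13" and ?u1.0 = 4
      and w = 16 and p = "[:8, 8, 48, 96, - 32, 128:]" and q = "[:3, 12, - 20, 16, 112, - 96, 128:]"])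
      (simp_all add: eval_nat_numeral pcompose_pCons)
  subgoal
    by (rule not_cf_limit_quadratic[where n = 4 and bs = "[0, [:- 1, 1:], [:2:], [:- 1, 1:], 1, 1, [:- 1, 1:], 1, 1]"
      and ?u0.0 = "- 17" and ?u1.0 = 6
      and w = 18 and p = "[:- 16, 48, - 64, 48:]" and q = "[:- 1, - 24, 68, - 88, 48:]"])
      (simp_all add: eval_nat_numeral pcompose_pCons)
  subgoal
    \<comment> \<open>Here \<open>q\<close> has degree 9, and 2 * 9 lies between 2^4 and 2^5, so a
      fifth term is required.\<close>
    by (rule not_cf_limit_quadratic[where n = 5
      and bs = "[0, [:- 1, 1:], [:0, 1:], 1, [:1, 0, 1:], [:0, 1:], [:1, 0, 1:], 1, [:2, 1:]]"
      and ?u0.0 = "- 28" and ?u1.0 = 9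
      and w = 81 and p = "[:19, 26, 41, 43, 56, 29, 32, 8, 9:]" and q = "[:- 3, 24, - 7, 48, - 8, 60, - 4, 33, - 1, 9:]"])
      (simp_all add: eval_nat_numeral pcompose_pCons)
  done

lemma necessary_degree_2:
  assumes deg: "degree f = 2" and cf: "cf_limit (orbit_series f)" and pos: "0 \<le> coeff f 0"
  shows "admissible f"
proof -
  define A B c where "A = coeff f 0" and "B = coeff f 1 + 1" and "c = coeff f 2"
  have f: "f = [:A, B - 1, c:]"
  proof (rule poly_eqI)
    fix i :: nat
    consider "i = 0" | "i = 1" | "i = 2" | "2 < i" by linarith
    then show "coeff f i = coeff [:A, B - 1, c:] i"
      by cases (use deg in \<open>auto simp: A_def B_def c_def coeff_eq_0 coeff_pCons numeral_2_eq_2 split: nat.splits\<close>)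
  qed
  have c: "c \<noteq> 0" using deg by (metis c_def degree_0 leading_coeff_0_iff zero_neq_numeral)
  note cl = quadratic_classification[OF f c cf]
  have split: "f = [:A, B - 1:] + pX ^ 2 * [:c:]" unfolding f by (simp add: power2_eq_square)
  have "A = 0 \<or> (A = 1 \<and> c = 1) \<or> (A = 1 \<and> c = 2) \<or> (A = 2 \<and> c = 1)"
  proof -
    have "0 \<le> A" using pos by (simp add: A_def)
    moreover have "A \<le> 2" if "A \<noteq> 0"
    proof -
      have "A dvd 1 \<or> A dvd 2" using cl(3) that c by (metis dvd_triv_right empty_iff insert_iff mult_eq_0_iff)
      then show ?thesis by (auto dest: zdvd_imp_le)
    qed
    ultimately consider "A = 0" | "A = 1" | "A = 2" by linarith
    then show ?thesis using cl(3) c by cases auto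
  qed
  then consider "A = 0" | "A = 1" "c = 1" | "A = 1" "c = 2" | "A = 2" "c = 1" by blast
  then show ?thesis
  proof cases
    case 1
    then show ?thesis using admissible_of_value_0[of f B "[:c:]"] split cl(1,2) by auto
  next
    case 2
    consider "B = 0" | "B = - 1" | "B = 1" using cl(1) by auto
    then show ?thesis
    proof cases
      case 1
      have "f = 1 + (0 - 1) * pX + pX ^ 2 * (1 + 0 * (pX - 1) + (pX - 1) ^ 2 * 0)"
        unfolding f 1 2 by (simp add: power2_eq_square one_pCons)
      then show ?thesis unfolding admissible_def by blast
    next
      case B: 2
      have "f = (pX - 1) ^ 2 * (1 + pX ^ 2 * 0)"
        unfolding f B 2 by (simp add: power2_eq_square one_pCons)
      then show ?thesis unfolding admissible_def by blast
    next
      case 3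
      then show ?thesis using cf not_cf_limit_examples unfolding f 2 by simp
    qed
  next
    case 3
    then show ?thesis using cl(1) cf not_cf_limit_examples unfolding f 3 by auto
  next
    case 4
    then show ?thesis using cl(1) cf not_cf_limit_examples unfolding f 4 by auto
  qed
qed

section \<open>The congruences and their reflections\<close>

lemma specializable_iff_admissible:
  assumes deg: "1 < degree f"
  shows "has_specializable_cf (\<Sum>n. 1 / L (poly_iterate f n)) \<longleftrightarrow> admissible f \<or> admissible (conj_reflect f)"
proof -
  have series: "has_specializable_cf (\<Sum>n. 1 / L (poly_iterate f n)) \<longleftrightarrow> cf_limit (orbit_series f)"
    unfolding has_specializable_cf_iff_cf_limit orbit_series_def ..
  \<comment> \<open>\<open>conj_reflect\<close> changes the sign of the constant term, so necessity
    is proved for a nonnegative constant term and transferred.\<close>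
  have nec: "admissible g" if "1 < degree g" "cf_limit (orbit_series g)" "0 \<le> coeff g 0" for g
    using that necessary_degree_2[of g] necessary_degree_3[of g] by (cases "degree g = 2") auto
  have cc: "coeff (conj_reflect f) 0 = - coeff f 0"
    by (simp add: conj_reflect_def reflect_def poly_pcompose flip: poly_0_coeff_0)
  show ?thesis unfolding series
  proof
    assume cf: "cf_limit (orbit_series f)"
    show "admissible f \<or> admissible (conj_reflect f)"
    proof (cases "0 \<le> coeff f 0")
      case False
      then show ?thesis using nec[of "conj_reflect f"] cf_limit_conj_reflect[OF deg cf] deg cc by simp
    qed (use nec[OF deg cf] in blast)
  next
    assume "admissible f \<or> admissible (conj_reflect f)"
    then show "cf_limit (orbit_series f)"
    proof
      assume "admissible (conj_reflect f)"
      then have "cf_limit (orbit_series (conj_reflect f))" using deg by (intro admissible_imp_cf_limit) simp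
      then show ?thesis using cf_limit_conj_reflect[of "conj_reflect f"] deg by simp
    qed (rule admissible_imp_cf_limit[OF deg])
  qed
qed

lemma ex_eq_plus_iff_dvd: "(\<exists>g. f = u + m * g) \<longleftrightarrow> m dvd f - u" for f :: "'a::comm_ring_1"
  unfolding dvd_def by (simp add: diff_eq_eq add.commute)

lemma admissible_iff:
  "admissible f \<longleftrightarrow>
      poly_congruent f 0 (pX^2)
    \<or> poly_congruent f (- pX) (pX^2)
    \<or> poly_congruent f 1 (pX^2 * (pX - 1))
    \<or> poly_congruent f (pX^3 - pX^2 - pX + 1) (pX^2 * (pX - 1)^2)
    \<or> poly_congruent f (-(pX^3) + 2 * pX^2 - pX + 1) (pX^2 * (pX - 1)^2)
    \<or> poly_congruent f (-(pX^3) + 3 * pX^2 - 2 * pX + 1) (pX^2 * (pX - 1)^2)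
    \<or> poly_congruent f (pX^2 - pX + 1) (pX^2 * (pX - 1)^2)
    \<or> poly_congruent f (pX^2 - 2 * pX + 1) (pX^2 * (pX - 1)^2)"
proof -
  have "(pX - 1) ^ 2 * (1 + pX + pX ^ 2 * r) = (pX^3 - pX^2 - pX + 1) + pX^2 * (pX - 1)^2 * r"
    "1 + (0 - 1) * pX + pX ^ 2 * (1 + (- 1) * (pX - 1) + (pX - 1) ^ 2 * r) = (-(pX^3) + 2 * pX^2 - pX + 1) + pX^2 * (pX - 1)^2 * r"
    "1 + (- 1 - 1) * pX + pX ^ 2 * (2 + (- 1) * (pX - 1) + (pX - 1) ^ 2 * r) = (-(pX^3) + 3 * pX^2 - 2 * pX + 1) + pX^2 * (pX - 1)^2 * r"
    "1 + (0 - 1) * pX + pX ^ 2 * (1 + 0 * (pX - 1) + (pX - 1) ^ 2 * r) = (pX^2 - pX + 1) + pX^2 * (pX - 1)^2 * r"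
    "(pX - 1) ^ 2 * (1 + pX ^ 2 * r) = (pX^2 - 2 * pX + 1) + pX^2 * (pX - 1)^2 * r" for r
    by algebra+
  then show ?thesis
    unfolding admissible_def ex_eq_plus_iff_dvd[symmetric] by (simp only: add_0_left)
qed

lemma reflect_dvd_iff: "reflect p dvd reflect q \<longleftrightarrow> p dvd q"
  unfolding dvd_def by (metis reflect_reflect reflect_simps(4))

text \<open>Both signs are allowed for the modulus because reflection sends x^2 (x - 1) to - x^2 (x
  + 1) but x^2 (x - 1)^2 to x^2 (x + 1)^2.\<close>

lemma poly_congruent_conj_reflect:
  assumes "reflect m = - m' \<or> reflect m = m'" "reflect u = - u'"
  shows "poly_congruent (conj_reflect f) u m \<longleftrightarrow> poly_congruent f u' m'"
proof -
  have "m dvd conj_reflect f - u \<longleftrightarrow> reflect m dvd reflect (conj_reflect f - u)" by (simp only: reflect_dvd_iff)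
  also have "reflect (conj_reflect f - u) = - (f - u')" using assms(2) by (simp add: conj_reflect_def)
  also have "reflect m dvd - (f - u') \<longleftrightarrow> m' dvd f - u'" using assms(1) by (auto simp only: dvd_minus_iff minus_dvd_iff)
  finally show ?thesis .
qed

theorem theorem7p12:
  fixes f :: "int poly"
  assumes "degree f > 1"
  shows "has_specializable_cf (\<Sum>n. 1 / laurent_of_poly (poly_iterate f n)) \<longleftrightarrow>
      poly_congruent f 0 (pX^2)
    \<or> poly_congruent f (- pX) (pX^2)
    \<or> poly_congruent f 1 (pX^2 * (pX - 1))
    \<or> poly_congruent f (- 1) (pX^2 * (pX + 1))
    \<or> poly_congruent f (pX^3 - pX^2 - pX + 1) (pX^2 * (pX - 1)^2)
    \<or> poly_congruent f (-(pX^3) + 2 * pX^2 - pX + 1) (pX^2 * (pX - 1)^2)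
    \<or> poly_congruent f (-(pX^3) + 3 * pX^2 - 2 * pX + 1) (pX^2 * (pX - 1)^2)
    \<or> poly_congruent f (pX^3 + pX^2 - pX - 1) (pX^2 * (pX + 1)^2)
    \<or> poly_congruent f (-(pX^3) - 2 * pX^2 - pX - 1) (pX^2 * (pX + 1)^2)
    \<or> poly_congruent f (-(pX^3) - 3 * pX^2 - 2 * pX - 1) (pX^2 * (pX + 1)^2)
    \<or> poly_congruent f (pX^2 - pX + 1) (pX^2 * (pX - 1)^2)
    \<or> poly_congruent f (pX^2 - 2 * pX + 1) (pX^2 * (pX - 1)^2)
    \<or> poly_congruent f (-(pX^2) - pX - 1) (pX^2 * (pX + 1)^2)
    \<or> poly_congruent f (-(pX^2) - 2 * pX - 1) (pX^2 * (pX + 1)^2)"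
proof -
  have X: "reflect pX = - pX" by (simp add: reflect_def pcompose_pCons)
  have num: "reflect (numeral k) = numeral k" for k by (simp add: reflect_def numeral_poly pcompose_const)
  have neg: "- pX - 1 = - (pX + 1)" by simp
  have rp: "reflect (p ^ 2) = reflect p ^ 2" "reflect (p ^ 3) = reflect p ^ 3" for p
    by (simp_all add: power2_eq_square power3_eq_cube)
  have m: "reflect (pX ^ 2) = pX ^ 2" "reflect (pX ^ 2 * (pX - 1)) = - (pX ^ 2 * (pX + 1))"
    "reflect (pX ^ 2 * (pX - 1) ^ 2) = pX ^ 2 * (pX + 1) ^ 2"
    unfolding reflect_simps rp X by algebra+
  have u: "reflect 0 = - 0" "reflect (- pX) = - (- pX)" "reflect 1 = - (- 1)"
    by (simp_all only: reflect_simps X minus_minus minus_zero)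
  have v: "reflect (pX^3 - pX^2 - pX + 1) = - (pX^3 + pX^2 - pX - 1)"
    "reflect (-(pX^3) + 2 * pX^2 - pX + 1) = - (-(pX^3) - 2 * pX^2 - pX - 1)"
    "reflect (-(pX^3) + 3 * pX^2 - 2 * pX + 1) = - (-(pX^3) - 3 * pX^2 - 2 * pX - 1)"
    "reflect (pX^2 - pX + 1) = - (-(pX^2) - pX - 1)"
    "reflect (pX^2 - 2 * pX + 1) = - (-(pX^2) - 2 * pX - 1)"
    unfolding reflect_simps rp X num by algebra+
  note c2 = poly_congruent_conj_reflect[OF disjI2[OF m(1)]] and c3 = poly_congruent_conj_reflect[OF disjI1[OF m(2)]]
    and c4 = poly_congruent_conj_reflect[OF disjI2[OF m(3)]]
  show ?thesis
    unfolding specializable_iff_admissible[OF assms] admissible_iff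
      c2[OF u(1)] c2[OF u(2)] c3[OF u(3)] c4[OF v(1)] c4[OF v(2)] c4[OF v(3)] c4[OF v(4)] c4[OF v(5)]
    by blast
qed

end
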